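(* Let $k$ be an algebraically closed field of characteristic $0$, $X$ a K3 surface over $k$, $\sigma\in\operatorname{Aut}(X)$ a non-symplectic automorphism of order $3$, and $\mathcal{E}_X\colon X\to\mathbb{P}^1$ a Jacobian elliptic fibration of type 2 with respect to $\sigma$, obtained as the base change of a rational elliptic surface $\mathcal{E}_R\colon R\to\mathbb{P}^1$ by $\tau\colon\mathbb{P}^1\to\mathbb{P}^1$, $[s:t]\mapsto[s^3:t^3]$. Let $\tilde R$ be the quotient by (the lift of) $\sigma$ of the blow-up of $X$ at the isolated fixed points of $\sigma$, with its induced elliptic fibration $\mathcal{E}_{\tilde R}\colon\tilde R\to\mathbb{P}^1$. Let $\mathcal{E}\colon X\to\mathbb{P}^1$ be a Jacobian elliptic fibration of type 1 with respect to $\sigma$, and let $\{D_v\}_{v\in\mathbb{P}^1}$ be the pencil of rational curves it induces on $\tilde R$. Let the restriction of $\mathcal{E}_{\tilde R}$ to $D_v$ be given by $$f_v\colon D_v\to\mathbb{P}^1,\qquad P\mapsto[x_v(P):y_v(P)].$$ Then the generic fibre of $\mathcal{E}$ can be written as $$s^3\,y_v=t^3\,x_v,$$ i.e. as the curve of pairs $(P,[s:t])\in D_v\times\mathbb{P}^1$ with $f_v(P)=\tau([s:t])$, where $v$ is the generic point of the base of $\mathcal{E}$.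
   Context: K3 surface: smooth projective surface with $K_X=0$, $h^1(\mathcal{O}_X)=0$; $\sigma$ is non-symplectic if it acts non-trivially on $H^0(X,K_X)$. A Jacobian elliptic fibration (an elliptic fibration over $\mathbb{P}^1$ with a section) is of type 1 with respect to $\sigma$ if $\sigma$ maps every fibre to itself, and of type 2 if $\sigma$ preserves the fibre class in $\operatorname{NS}X$ but the fibration is not of type 1. Let $\eta_X\colon\tilde X\to X$ be the blow-up of the isolated fixed points of $\sigma$, $\tilde\sigma$ the lift of $\sigma$ (fixing the exceptional curves pointwise), $\tilde\pi\colon\tilde X\to\tilde R=\tilde X/\tilde\sigma$ the quotient. $\mathcal{E}_X$ induces on the rational surface $\tilde R$ a Jacobian elliptic fibration $\mathcal{E}_{\tilde R}$, whose relatively minimal model is $\mathcal{E}_R\colon R\to\mathbb{P}^1$; $\tau$ is the quotient of the base of $\mathcal{E}_X$ by the action of $\sigma$, in suitable coordinates. The curves induced by $\mathcal{E}$ are $D_v=\tilde\pi(\eta_X^*F_v)$, with $F_v=\mathcal{E}^{-1}(v)$; when $\mathcal{E}$ is of type 1, $D_v$ is a rational curve for general $v$. The equation is understood birationally: the generic fibre of $\mathcal{E}$ is the smooth projective model of the curve in $D_v\times\mathbb{P}^1$ given by the equation. *)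

theory Defs
  imports
    "HOL-Analysis.Abstract_Topology"
    "HOL-Library.Poly_Mapping"
    "HOL-Library.Function_Algebras"
    "HOL-Library.Extended_Nat"
    "HOL-Library.Nat_Bijection"
    "HOL-Computational_Algebra.Polynomial"
    "HOL-Algebra.QuotRing"
begin

section \<open>Quasi-projective varieties\<close>

text \<open>
  Varieties are classical (sets of closed points). A point of projective space is the set of all
  its homogeneous coordinate vectors. Vectors are finitely supported sequences, so that every
  projective space of dimension n is a closed subspace of one common space of points and a
  quasi-projective variety is simply a set of points. Polynomials are elements of
  \<^typ>\<open>(nat \<Rightarrow>\<^sub>0 nat) \<Rightarrow>\<^sub>0 'k\<close>; a monomial maps the index of a variable to its exponent.
\<close>

type_synonym 'k pt = "(nat \<Rightarrow> 'k) set"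
type_synonym 'k mpoly = "(nat \<Rightarrow>\<^sub>0 nat) \<Rightarrow>\<^sub>0 'k"

definition pcls :: "(nat \<Rightarrow> 'k::field) \<Rightarrow> 'k pt" where
  "pcls v = {(\<lambda>i. c * v i) | c. c \<noteq> 0}"

definition Pn :: "nat \<Rightarrow> 'k::field pt set" where
  "Pn n = {pcls v | v. (\<exists>i. v i \<noteq> 0) \<and> (\<forall>i>n. v i = 0)}"

abbreviation P1 :: "'k::field pt set" where
  "P1 \<equiv> Pn 1"

text \<open>The point \<open>[s:t]\<close> of the projective line (meaningful if \<open>(s, t) \<noteq> (0, 0)\<close>).\<close>

definition hpt :: "'k::field \<Rightarrow> 'k \<Rightarrow> 'k pt" where
  "hpt s t = pcls (\<lambda>i. if i = 0 then s else if i = 1 then t else 0)"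

definition peval :: "'k::field mpoly \<Rightarrow> (nat \<Rightarrow> 'k) \<Rightarrow> 'k" where
  "peval p v = (\<Sum>m\<in>Poly_Mapping.keys p.
     Poly_Mapping.lookup p m * (\<Prod>i\<in>Poly_Mapping.keys m. v i ^ Poly_Mapping.lookup m i))"

definition homogeneous :: "nat \<Rightarrow> 'k::field mpoly \<Rightarrow> bool" where
  "homogeneous d p \<longleftrightarrow>
     (\<forall>m\<in>Poly_Mapping.keys p. (\<Sum>i\<in>Poly_Mapping.keys m. Poly_Mapping.lookup m i) = d)"

definition basic_open :: "'k::field mpoly \<Rightarrow> 'k pt set" where
  "basic_open p = {x. (\<exists>n. x \<in> Pn n) \<and> (\<exists>v\<in>x. peval p v \<noteq> 0)}"

definition zariski :: "'k::field pt topology" where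
  "zariski = topology_generated_by {basic_open p | p d. homogeneous d p}"

abbreviation zar :: "'k::field pt set \<Rightarrow> 'k pt topology" where
  "zar V \<equiv> subtopology zariski V"

definition irreducible_space :: "'a topology \<Rightarrow> bool" where
  "irreducible_space T \<longleftrightarrow> topspace T \<noteq> {} \<and>
     (\<forall>A B. closedin T A \<and> closedin T B \<and> A \<union> B = topspace T
        \<longrightarrow> A = topspace T \<or> B = topspace T)"

definition projective_variety :: "'k::field pt set \<Rightarrow> bool" where
  "projective_variety V \<longleftrightarrow> (\<exists>n. closedin (zar (Pn n)) V) \<and> irreducible_space (zar V)"

definition quasi_projective_variety :: "'k::field pt set \<Rightarrow> bool" where
  "quasi_projective_variety V \<longleftrightarrow>
     (\<exists>n U Z. openin (zar (Pn n)) U \<and> closedin (zar (Pn n)) Z \<and> V = U \<inter> Z) \<and>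
     irreducible_space (zar V)"

text \<open>Only the values of \<open>f\<close> on \<open>U\<close> matter for \<open>regular V U f\<close>.\<close>

definition regular :: "'k::field pt set \<Rightarrow> 'k pt set \<Rightarrow> ('k pt \<Rightarrow> 'k) \<Rightarrow> bool" where
  "regular V U f \<longleftrightarrow> openin (zar V) U \<and>
     (\<forall>x\<in>U. \<exists>W p q d. openin (zar V) W \<and> x \<in> W \<and> W \<subseteq> U \<and> homogeneous d p \<and> homogeneous d q \<and>
        (\<forall>y\<in>W. \<forall>v\<in>y. peval q v \<noteq> 0 \<and> f y = peval p v / peval q v))"

definition regular_at :: "'k::field pt set \<Rightarrow> 'k pt \<Rightarrow> ('k pt \<Rightarrow> 'k) \<Rightarrow> bool" where
  "regular_at V x f \<longleftrightarrow> (\<exists>U. x \<in> U \<and> regular V U f)"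

definition eq_near :: "'k::field pt set \<Rightarrow> 'k pt \<Rightarrow> ('k pt \<Rightarrow> 'k) \<Rightarrow> ('k pt \<Rightarrow> 'k) \<Rightarrow> bool" where
  "eq_near V x f g \<longleftrightarrow> (\<exists>U. openin (zar V) U \<and> x \<in> U \<and> (\<forall>y\<in>U. f y = g y))"

definition morphism :: "'k::field pt set \<Rightarrow> 'k pt set \<Rightarrow> ('k pt \<Rightarrow> 'k pt) \<Rightarrow> bool" where
  "morphism V W \<phi> \<longleftrightarrow> \<phi> ` V \<subseteq> W \<and> continuous_map (zar V) (zar W) \<phi> \<and>
     (\<forall>U f. regular W U f \<longrightarrow> regular V {x\<in>V. \<phi> x \<in> U} (\<lambda>x. f (\<phi> x)))"

definition isomorphism :: "'k::field pt set \<Rightarrow> 'k pt set \<Rightarrow> ('k pt \<Rightarrow> 'k pt) \<Rightarrow> bool" where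
  "isomorphism V W \<phi> \<longleftrightarrow> morphism V W \<phi> \<and>
     (\<exists>\<psi>. morphism W V \<psi> \<and> (\<forall>x\<in>V. \<psi> (\<phi> x) = x) \<and> (\<forall>y\<in>W. \<phi> (\<psi> y) = y))"

abbreviation automorphism :: "'k::field pt set \<Rightarrow> ('k pt \<Rightarrow> 'k pt) \<Rightarrow> bool" where
  "automorphism V \<sigma> \<equiv> isomorphism V V \<sigma>"

definition automorphism_order :: "'k::field pt set \<Rightarrow> ('k pt \<Rightarrow> 'k pt) \<Rightarrow> nat \<Rightarrow> bool" where
  "automorphism_order V \<sigma> n \<longleftrightarrow> n > 0 \<and> (\<forall>x\<in>V. (\<sigma> ^^ n) x = x) \<and>
     (\<forall>m. 0 < m \<and> m < n \<longrightarrow> (\<exists>x\<in>V. (\<sigma> ^^ m) x \<noteq> x))"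

text \<open>Segre embedding; products of varieties are taken in this embedding.\<close>

definition segre :: "'k::field pt \<Rightarrow> 'k pt \<Rightarrow> 'k pt" where
  "segre x y = {(\<lambda>k. v (fst (prod_decode k)) * w (snd (prod_decode k))) | v w. v \<in> x \<and> w \<in> y}"

definition prod_variety :: "'k::field pt set \<Rightarrow> 'k pt set \<Rightarrow> 'k pt set" where
  "prod_variety V W = {segre x y | x y. x \<in> V \<and> y \<in> W}"

definition krull_dim :: "'k::field pt set \<Rightarrow> enat" where
  "krull_dim V = Sup {enat n | n. \<exists>Z.
     (\<forall>i\<le>n. closedin (zar V) (Z i) \<and> irreducible_space (zar (Z i))) \<and>
     (\<forall>i<n. Z i \<subset> Z (Suc i))}"

definition birational :: "'k::field pt set \<Rightarrow> 'k pt set \<Rightarrow> bool" where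
  "birational V W \<longleftrightarrow> (\<exists>U U' \<phi>. openin (zar V) U \<and> U \<noteq> {} \<and> openin (zar W) U' \<and> U' \<noteq> {} \<and>
     isomorphism U U' \<phi>)"

definition birational_morphism ::
    "'k::field pt set \<Rightarrow> 'k pt set \<Rightarrow> ('k pt \<Rightarrow> 'k pt) \<Rightarrow> bool" where
  "birational_morphism V W \<phi> \<longleftrightarrow> morphism V W \<phi> \<and>
     (\<exists>U U'. openin (zar V) U \<and> U \<noteq> {} \<and> openin (zar W) U' \<and> U' \<noteq> {} \<and> isomorphism U U' \<phi>)"


section \<open>Tangent vectors, differential forms, smoothness\<close>

text \<open>
  The Zariski tangent space at \<open>x\<close>: derivations of the local ring at \<open>x\<close> with values in the residue
  field \<open>k\<close>. A derivation is extended by \<open>0\<close> to functions that are not regular at \<open>x\<close>.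
\<close>

type_synonym 'k tangent_vector = "('k pt \<Rightarrow> 'k) \<Rightarrow> 'k"

definition tangent_space :: "'k::field pt set \<Rightarrow> 'k pt \<Rightarrow> 'k tangent_vector set" where
  "tangent_space V x = {\<delta>.
     (\<forall>f. \<not> regular_at V x f \<longrightarrow> \<delta> f = 0) \<and>
     (\<forall>c. \<delta> (\<lambda>_. c) = 0) \<and>
     (\<forall>f g. regular_at V x f \<and> regular_at V x g \<longrightarrow>
        (eq_near V x f g \<longrightarrow> \<delta> f = \<delta> g) \<and>
        \<delta> (\<lambda>y. f y + g y) = \<delta> f + \<delta> g \<and>
        \<delta> (\<lambda>y. f y * g y) = f x * \<delta> g + g x * \<delta> f)}"

definition tangent_dim :: "'k::field pt set \<Rightarrow> 'k pt \<Rightarrow> nat" where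
  "tangent_dim V x = vector_space.dim (\<lambda>c \<delta>. \<lambda>f. c * \<delta> f) (tangent_space V x)"

definition smooth :: "'k::field pt set \<Rightarrow> bool" where
  "smooth V \<longleftrightarrow> (\<forall>x\<in>V. enat (tangent_dim V x) = krull_dim V)"

definition differential ::
    "'k::field pt set \<Rightarrow> ('k pt \<Rightarrow> 'k pt) \<Rightarrow> 'k pt \<Rightarrow> 'k tangent_vector \<Rightarrow> 'k tangent_vector" where
  "differential W \<phi> x \<delta> = (\<lambda>f. if regular_at W (\<phi> x) f then \<delta> (\<lambda>y. f (\<phi> y)) else 0)"

text \<open>
  Regular differential forms on a smooth variety, as families of alternating forms on the tangent
  spaces that are locally of the form \<open>\<Sum> g df\<close>, respectively \<open>\<Sum> g df \<and> dh\<close>, with regular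
  \<open>g, f, h\<close>. They are extended by \<open>0\<close> outside of their domain so that equality of forms is
  equality of functions.
\<close>

type_synonym 'k form1 = "'k pt \<Rightarrow> 'k tangent_vector \<Rightarrow> 'k"
type_synonym 'k form2 = "'k pt \<Rightarrow> 'k tangent_vector \<Rightarrow> 'k tangent_vector \<Rightarrow> 'k"

definition regular_form1 :: "'k::field pt set \<Rightarrow> 'k form1 \<Rightarrow> bool" where
  "regular_form1 V \<omega> \<longleftrightarrow>
     (\<forall>x \<delta>. x \<notin> V \<or> \<delta> \<notin> tangent_space V x \<longrightarrow> \<omega> x \<delta> = 0) \<and>
     (\<forall>x\<in>V. \<exists>U L. x \<in> U \<and> openin (zar V) U \<and>
        (\<forall>(g, f) \<in> set L. regular V U g \<and> regular V U f) \<and>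
        (\<forall>y\<in>U. \<forall>\<delta>\<in>tangent_space V y. \<omega> y \<delta> = (\<Sum>(g, f)\<leftarrow>L. g y * \<delta> f)))"

definition regular_form2 :: "'k::field pt set \<Rightarrow> 'k form2 \<Rightarrow> bool" where
  "regular_form2 V \<omega> \<longleftrightarrow>
     (\<forall>x \<delta> \<epsilon>. x \<notin> V \<or> \<delta> \<notin> tangent_space V x \<or> \<epsilon> \<notin> tangent_space V x \<longrightarrow> \<omega> x \<delta> \<epsilon> = 0) \<and>
     (\<forall>x\<in>V. \<exists>U L. x \<in> U \<and> openin (zar V) U \<and>
        (\<forall>(g, f, h) \<in> set L. regular V U g \<and> regular V U f \<and> regular V U h) \<and>
        (\<forall>y\<in>U. \<forall>\<delta>\<in>tangent_space V y. \<forall>\<epsilon>\<in>tangent_space V y.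
           \<omega> y \<delta> \<epsilon> = (\<Sum>(g, f, h)\<leftarrow>L. g y * (\<delta> f * \<epsilon> h - \<delta> h * \<epsilon> f))))"

definition pullback_form2 :: "'k::field pt set \<Rightarrow> ('k pt \<Rightarrow> 'k pt) \<Rightarrow> 'k form2 \<Rightarrow> 'k form2" where
  "pullback_form2 V \<sigma> \<omega> = (\<lambda>x \<delta> \<epsilon>.
     if x \<in> V \<and> \<delta> \<in> tangent_space V x \<and> \<epsilon> \<in> tangent_space V x
     then \<omega> (\<sigma> x) (differential V \<sigma> x \<delta>) (differential V \<sigma> x \<epsilon>) else 0)"

definition smooth_curve :: "'k::field pt set \<Rightarrow> bool" where
  "smooth_curve C \<longleftrightarrow> quasi_projective_variety C \<and> krull_dim C = 1 \<and> smooth C"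

definition smooth_projective_surface :: "'k::field pt set \<Rightarrow> bool" where
  "smooth_projective_surface X \<longleftrightarrow> projective_variety X \<and> krull_dim X = 2 \<and> smooth X"

definition genus :: "'k::field pt set \<Rightarrow> nat" where
  "genus C = vector_space.dim (\<lambda>c \<omega>. \<lambda>x \<delta>. c * \<omega> x \<delta>) {\<omega>. regular_form1 C \<omega>}"


section \<open>K3 surfaces\<close>

text \<open>
  \<open>K\<^sub>X = 0\<close>: the sheaf of 2-forms has a nowhere vanishing global section.
\<close>

definition trivial_canonical :: "'k::field pt set \<Rightarrow> bool" where
  "trivial_canonical X \<longleftrightarrow> (\<exists>\<omega>. regular_form2 X \<omega> \<and>
     (\<forall>x\<in>X. \<exists>\<delta>\<in>tangent_space X x. \<exists>\<epsilon>\<in>tangent_space X x. \<omega> x \<delta> \<epsilon> \<noteq> 0))"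

text \<open>
  Vanishing of the first (Cech) cohomology group of the structure sheaf. The group is the direct
  limit over open covers with injective transition maps, and varieties are quasi-compact, so it
  vanishes iff every 1-cocycle on every finite open cover is a coboundary.
\<close>

definition h1_structure_sheaf_zero :: "'k::field pt set \<Rightarrow> bool" where
  "h1_structure_sheaf_zero X \<longleftrightarrow>
     (\<forall>(N::nat) U f.
        (\<forall>i<N. openin (zar X) (U i)) \<and> X = (\<Union>i<N. U i) \<and>
        (\<forall>i<N. \<forall>j<N. regular X (U i \<inter> U j) (f i j)) \<and>
        (\<forall>i<N. \<forall>j<N. \<forall>l<N. \<forall>x\<in>U i \<inter> U j \<inter> U l. f i j x + f j l x = f i l x) \<longrightarrow>
        (\<exists>g. (\<forall>i<N. regular X (U i) (g i)) \<and>
             (\<forall>i<N. \<forall>j<N. \<forall>x\<in>U i \<inter> U j. f i j x = g j x - g i x)))"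

definition K3_surface :: "'k::field pt set \<Rightarrow> bool" where
  "K3_surface X \<longleftrightarrow>
     smooth_projective_surface X \<and> trivial_canonical X \<and> h1_structure_sheaf_zero X"

definition non_symplectic :: "'k::field pt set \<Rightarrow> ('k pt \<Rightarrow> 'k pt) \<Rightarrow> bool" where
  "non_symplectic X \<sigma> \<longleftrightarrow> (\<exists>\<omega>. regular_form2 X \<omega> \<and> pullback_form2 X \<sigma> \<omega> \<noteq> \<omega>)"


section \<open>Divisors and the Neron-Severi group\<close>

text \<open>
  Effective Cartier divisors are systems of local equations; \<open>div_eq\<close> is equality of divisors.
\<close>

type_synonym 'k eff_divisor = "('k pt set \<times> ('k pt \<Rightarrow> 'k)) set"

definition same_up_to_unit ::
    "'k::field pt set \<Rightarrow> 'k pt set \<times> ('k pt \<Rightarrow> 'k) \<Rightarrow> 'k pt set \<times> ('k pt \<Rightarrow> 'k) \<Rightarrow> bool" where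
  "same_up_to_unit V e e' \<longleftrightarrow> (\<exists>u. regular V (fst e \<inter> fst e') u \<and>
     (\<forall>x\<in>fst e \<inter> fst e'. u x \<noteq> 0 \<and> snd e x = u x * snd e' x))"

definition eff_cartier :: "'k::field pt set \<Rightarrow> 'k eff_divisor \<Rightarrow> bool" where
  "eff_cartier V D \<longleftrightarrow> (\<Union>e\<in>D. fst e) = V \<and>
     (\<forall>(U, f)\<in>D. regular V U f \<and> (U = {} \<or> (\<exists>x\<in>U. f x \<noteq> 0))) \<and>
     (\<forall>e\<in>D. \<forall>e'\<in>D. same_up_to_unit V e e')"

definition div_eq :: "'k::field pt set \<Rightarrow> 'k eff_divisor \<Rightarrow> 'k eff_divisor \<Rightarrow> bool" where
  "div_eq V D D' \<longleftrightarrow> (\<forall>e\<in>D. \<forall>e'\<in>D'. same_up_to_unit V e e')"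

definition div_plus :: "'k::field eff_divisor \<Rightarrow> 'k eff_divisor \<Rightarrow> 'k eff_divisor" where
  "div_plus D D' = {(U \<inter> U', \<lambda>x. f x * f' x) | U f U' f'. (U, f) \<in> D \<and> (U', f') \<in> D'}"

definition div_zero :: "'k::field pt set \<Rightarrow> 'k eff_divisor" where
  "div_zero V = {(V, \<lambda>_. 1)}"

definition div_pullback ::
    "'k::field pt set \<Rightarrow> ('k pt \<Rightarrow> 'k pt) \<Rightarrow> 'k eff_divisor \<Rightarrow> 'k eff_divisor" where
  "div_pullback V \<phi> D = {({x\<in>V. \<phi> x \<in> U}, \<lambda>x. f (\<phi> x)) | U f. (U, f) \<in> D}"

text \<open>Sections over \<open>U\<close> of the ideal sheaf of the reduced closed subset \<open>Z\<close>.\<close>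

definition ideal_section ::
    "'k::field pt set \<Rightarrow> 'k pt set \<Rightarrow> 'k pt set \<Rightarrow> ('k pt \<Rightarrow> 'k) \<Rightarrow> bool" where
  "ideal_section V Z U f \<longleftrightarrow> regular V U f \<and> (\<forall>x\<in>U \<inter> Z. f x = 0)"

definition prime_divisor :: "'k::field pt set \<Rightarrow> 'k pt set \<Rightarrow> 'k eff_divisor" where
  "prime_divisor V Z = {(U, f). ideal_section V Z U f \<and>
     (\<forall>U' h. U' \<subseteq> U \<and> ideal_section V Z U' h \<longrightarrow>
        (\<exists>g. regular V U' g \<and> (\<forall>x\<in>U'. h x = g x * f x)))}"

text \<open>
  Prealgebraic equivalence: both divisors are fibres of a relative effective Cartier divisor on
  \<open>X \<times> T\<close> over a smooth curve \<open>T\<close>. Since the fibres of \<open>X \<times> T \<rightarrow> T\<close> are integral, an effective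
  Cartier divisor on \<open>X \<times> T\<close> is flat over \<open>T\<close> iff its restriction to every fibre is again an
  effective Cartier divisor.
\<close>

definition eff_prealg_equiv ::
    "'k::field pt set \<Rightarrow> 'k eff_divisor \<Rightarrow> 'k eff_divisor \<Rightarrow> bool" where
  "eff_prealg_equiv X A B \<longleftrightarrow> eff_cartier X A \<and> eff_cartier X B \<and>
     (\<exists>T W a b. smooth_curve T \<and> eff_cartier (prod_variety X T) W \<and>
        (\<forall>t\<in>T. eff_cartier X (div_pullback X (\<lambda>x. segre x t) W)) \<and>
        a \<in> T \<and> b \<in> T \<and>
        div_eq X (div_pullback X (\<lambda>x. segre x a) W) A \<and>
        div_eq X (div_pullback X (\<lambda>x. segre x b) W) B)"

text \<open>A pair \<open>(D, D')\<close> of effective divisors stands for the divisor \<open>D - D'\<close>.\<close>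

definition prealg_equiv :: "'k::field pt set \<Rightarrow>
    'k eff_divisor \<times> 'k eff_divisor \<Rightarrow> 'k eff_divisor \<times> 'k eff_divisor \<Rightarrow> bool" where
  "prealg_equiv X D E \<longleftrightarrow>
     eff_cartier X (fst D) \<and> eff_cartier X (snd D) \<and>
     eff_cartier X (fst E) \<and> eff_cartier X (snd E) \<and>
     (\<exists>A B. eff_prealg_equiv X A B \<and>
        div_eq X (div_plus (fst D) (div_plus (snd E) B)) (div_plus (fst E) (div_plus (snd D) A)))"

definition same_NS_class ::
    "'k::field pt set \<Rightarrow> 'k eff_divisor \<Rightarrow> 'k eff_divisor \<Rightarrow> bool" where
  "same_NS_class X D E \<longleftrightarrow> (prealg_equiv X)\<^sup>*\<^sup>* (D, div_zero X) (E, div_zero X)"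


section \<open>Elliptic fibrations\<close>

definition fibre :: "'k::field pt set \<Rightarrow> ('k pt \<Rightarrow> 'k pt) \<Rightarrow> 'k pt \<Rightarrow> 'k pt set" where
  "fibre X E v = {x\<in>X. E x = v}"

text \<open>
  \<open>E\<close> is a submersion at \<open>x\<close>. If this holds at all points of a fibre, the scheme-theoretic
  fibre is smooth, in particular reduced.
\<close>

definition submersive_at ::
    "'k::field pt set \<Rightarrow> 'k pt set \<Rightarrow> ('k pt \<Rightarrow> 'k pt) \<Rightarrow> 'k pt \<Rightarrow> bool" where
  "submersive_at X B E x \<longleftrightarrow> differential B E x ` tangent_space X x = tangent_space B (E x)"

definition elliptic_fibration :: "'k::field pt set \<Rightarrow> ('k pt \<Rightarrow> 'k pt) \<Rightarrow> bool" where
  "elliptic_fibration X E \<longleftrightarrow> morphism X P1 E \<and> E ` X = P1 \<and>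
     finite {v\<in>P1. \<not> (smooth_curve (fibre X E v) \<and> genus (fibre X E v) = 1 \<and>
                      (\<forall>x\<in>fibre X E v. submersive_at X P1 E x))}"

definition jacobian_fibration :: "'k::field pt set \<Rightarrow> ('k pt \<Rightarrow> 'k pt) \<Rightarrow> bool" where
  "jacobian_fibration X E \<longleftrightarrow> elliptic_fibration X E \<and>
     (\<exists>s. morphism P1 X s \<and> (\<forall>v\<in>P1. E (s v) = v))"

definition fibration_type1 ::
    "'k::field pt set \<Rightarrow> ('k pt \<Rightarrow> 'k pt) \<Rightarrow> ('k pt \<Rightarrow> 'k pt) \<Rightarrow> bool" where
  "fibration_type1 X \<sigma> E \<longleftrightarrow> (\<forall>v\<in>P1. \<sigma> ` fibre X E v = fibre X E v)"

definition fibre_divisor :: "'k::field pt set \<Rightarrow> ('k pt \<Rightarrow> 'k pt) \<Rightarrow> 'k pt \<Rightarrow> 'k eff_divisor" where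
  "fibre_divisor X E v = div_pullback X E (prime_divisor P1 {v})"

definition preserves_fibre_class ::
    "'k::field pt set \<Rightarrow> ('k pt \<Rightarrow> 'k pt) \<Rightarrow> ('k pt \<Rightarrow> 'k pt) \<Rightarrow> bool" where
  "preserves_fibre_class X \<sigma> E \<longleftrightarrow>
     (\<forall>v\<in>P1. same_NS_class X (div_pullback X \<sigma> (fibre_divisor X E v)) (fibre_divisor X E v))"

definition fibration_type2 ::
    "'k::field pt set \<Rightarrow> ('k pt \<Rightarrow> 'k pt) \<Rightarrow> ('k pt \<Rightarrow> 'k pt) \<Rightarrow> bool" where
  "fibration_type2 X \<sigma> E \<longleftrightarrow> preserves_fibre_class X \<sigma> E \<and> \<not> fibration_type1 X \<sigma> E"

definition relatively_minimal :: "'k::field pt set \<Rightarrow> ('k pt \<Rightarrow> 'k pt) \<Rightarrow> bool" where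
  "relatively_minimal X E \<longleftrightarrow>
     (\<forall>Y F \<phi>. smooth_projective_surface Y \<and> morphism Y P1 F \<and>
        birational_morphism X Y \<phi> \<and> (\<forall>x\<in>X. F (\<phi> x) = E x) \<longrightarrow> isomorphism X Y \<phi>)"

definition rational_elliptic_surface :: "'k::field pt set \<Rightarrow> ('k pt \<Rightarrow> 'k pt) \<Rightarrow> bool" where
  "rational_elliptic_surface R E \<longleftrightarrow> smooth_projective_surface R \<and> birational R (Pn 2) \<and>
     jacobian_fibration R E \<and> relatively_minimal R E"

definition relatively_minimal_model :: "'k::field pt set \<Rightarrow> ('k pt \<Rightarrow> 'k pt) \<Rightarrow>
    'k pt set \<Rightarrow> ('k pt \<Rightarrow> 'k pt) \<Rightarrow> ('k pt \<Rightarrow> 'k pt) \<Rightarrow> bool" where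
  "relatively_minimal_model Y F R E \<rho> \<longleftrightarrow> smooth_projective_surface R \<and> morphism R P1 E \<and>
     birational_morphism Y R \<rho> \<and> (\<forall>y\<in>Y. E (\<rho> y) = F y) \<and> relatively_minimal R E"

text \<open>\<open>\<tau> [s:t] = [s^3:t^3]\<close>\<close>

definition tau :: "'k::field pt \<Rightarrow> 'k pt" where
  "tau x = {(\<lambda>i. c * v i ^ 3) | c v. c \<noteq> 0 \<and> v \<in> x}"

lemma tau_hpt: "tau (hpt s t) = hpt (s ^ 3) (t ^ 3)"
proof -
  have "\<exists>b. b \<noteq> 0 \<and> (\<lambda>i. c * (a * (if i = 0 then s else if i = 1 then t else 0)) ^ 3) =
          (\<lambda>i::nat. b * (if i = 0 then s ^ 3 else if i = 1 then t ^ 3 else 0))"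
    if "c \<noteq> 0" "a \<noteq> 0" for a c :: 'a
    using that by (intro exI[of _ "c * a ^ 3"]) (auto simp: fun_eq_iff power_mult_distrib)
  moreover have "\<exists>c a. c \<noteq> 0 \<and> a \<noteq> 0 \<and>
          (\<lambda>i::nat. b * (if i = 0 then s ^ 3 else if i = 1 then t ^ 3 else 0)) =
          (\<lambda>i. c * (a * (if i = 0 then s else if i = 1 then t else 0)) ^ 3)"
    if "b \<noteq> 0" for b :: 'a
    using that by (intro exI[of _ b] exI[of _ 1]) (auto simp: fun_eq_iff)
  ultimately show ?thesis
    unfolding tau_def hpt_def pcls_def by fastforce
qed

text \<open>
  The surface fibred by \<open>F\<close> is the base change of the surface \<open>R\<close> by \<open>\<tau>\<close>: the relatively minimal
  smooth model, over the new base, of the fibre product.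
\<close>

definition fibre_product_tau :: "'k::field pt set \<Rightarrow> ('k pt \<Rightarrow> 'k pt) \<Rightarrow> 'k pt set" where
  "fibre_product_tau R E = {segre r q | r q. r \<in> R \<and> q \<in> P1 \<and> E r = tau q}"

definition base_change_by_tau :: "'k::field pt set \<Rightarrow> ('k pt \<Rightarrow> 'k pt) \<Rightarrow>
    'k pt set \<Rightarrow> ('k pt \<Rightarrow> 'k pt) \<Rightarrow> bool" where
  "base_change_by_tau X F R E \<longleftrightarrow> smooth_projective_surface X \<and> relatively_minimal X F \<and>
     irreducible_space (zar (fibre_product_tau R E)) \<and>
     (\<exists>U U' \<phi>. openin (zar X) U \<and> U \<noteq> {} \<and>
        openin (zar (fibre_product_tau R E)) U' \<and> U' \<noteq> {} \<and> isomorphism U U' \<phi> \<and>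
        (\<forall>x\<in>U. \<exists>r\<in>R. \<phi> x = segre r (F x)))"


section \<open>Blow-ups and quotients\<close>

definition isolated_fixed_points :: "'k::field pt set \<Rightarrow> ('k pt \<Rightarrow> 'k pt) \<Rightarrow> 'k pt set" where
  "isolated_fixed_points X \<sigma> = {x\<in>X. \<sigma> x = x \<and>
     (\<exists>U. openin (zar X) U \<and> x \<in> U \<and> (\<forall>y\<in>U. \<sigma> y = y \<longrightarrow> y = x))}"

text \<open>
  The inverse image under \<open>\<phi>\<close> of the ideal sheaf of \<open>Z\<close> is invertible: each of its stalks is
  generated by one nonzero germ \<open>h\<close>.
\<close>

definition invertible_inverse_image :: "'k::field pt set \<Rightarrow> 'k pt set \<Rightarrow>
    'k pt set \<Rightarrow> ('k pt \<Rightarrow> 'k pt) \<Rightarrow> bool" where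
  "invertible_inverse_image X Z Y \<phi> \<longleftrightarrow>
     (\<forall>y\<in>Y. \<exists>h. regular_at Y y h \<and> \<not> eq_near Y y h (\<lambda>_. 0) \<and>
        (\<forall>U f. \<phi> y \<in> U \<and> ideal_section X Z U f \<longrightarrow>
           (\<exists>g. regular_at Y y g \<and> eq_near Y y (\<lambda>z. f (\<phi> z)) (\<lambda>z. g z * h z))) \<and>
        (\<exists>(n::nat) U f g. \<phi> y \<in> U \<and>
           (\<forall>i<n. ideal_section X Z U (f i) \<and> regular_at Y y (g i)) \<and>
           eq_near Y y h (\<lambda>z. \<Sum>i<n. g i z * f i (\<phi> z))))"

text \<open>Blow-up of the reduced closed subset \<open>Z\<close>, by its universal property.\<close>

definition blow_up :: "'k::field pt set \<Rightarrow> 'k pt set \<Rightarrow>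
    'k pt set \<Rightarrow> ('k pt \<Rightarrow> 'k pt) \<Rightarrow> bool" where
  "blow_up X Z Y \<eta> \<longleftrightarrow> projective_variety Y \<and> morphism Y X \<eta> \<and>
     invertible_inverse_image X Z Y \<eta> \<and>
     (\<forall>Y' \<phi>. quasi_projective_variety Y' \<and> morphism Y' X \<phi> \<and>
        invertible_inverse_image X Z Y' \<phi> \<longrightarrow>
        (\<exists>\<psi>. morphism Y' Y \<psi> \<and> (\<forall>y\<in>Y'. \<eta> (\<psi> y) = \<phi> y) \<and>
           (\<forall>\<psi>'. morphism Y' Y \<psi>' \<and> (\<forall>y\<in>Y'. \<eta> (\<psi>' y) = \<phi> y) \<longrightarrow>
              (\<forall>y\<in>Y'. \<psi>' y = \<psi> y))))"

text \<open>
  Quotient by the finite cyclic group generated by \<open>\<sigma>\<close>, as a space with functions.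
\<close>

definition quotient_by :: "'k::field pt set \<Rightarrow> ('k pt \<Rightarrow> 'k pt) \<Rightarrow>
    'k pt set \<Rightarrow> ('k pt \<Rightarrow> 'k pt) \<Rightarrow> bool" where
  "quotient_by Y \<sigma> Q \<pi> \<longleftrightarrow> projective_variety Q \<and> morphism Y Q \<pi> \<and> \<pi> ` Y = Q \<and>
     (\<forall>x\<in>Y. \<forall>y\<in>Y. \<pi> x = \<pi> y \<longleftrightarrow> (\<exists>n. y = (\<sigma> ^^ n) x)) \<and>
     (\<forall>U. U \<subseteq> Q \<longrightarrow> (openin (zar Q) U \<longleftrightarrow> openin (zar Y) {y\<in>Y. \<pi> y \<in> U})) \<and>
     (\<forall>U f. openin (zar Q) U \<longrightarrow>
        (regular Q U f \<longleftrightarrow> regular Y {y\<in>Y. \<pi> y \<in> U} (\<lambda>y. f (\<pi> y))))"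


section \<open>Generic fibres\<close>

text \<open>
  Function field of a variety: a rational function is the set of all its representatives
  \<open>(U, f)\<close>, \<open>f\<close> regular on the nonempty open set \<open>U\<close>.
\<close>

type_synonym 'k ratfun = "('k pt set \<times> ('k pt \<Rightarrow> 'k)) set"

definition ratfun :: "'k::field pt set \<Rightarrow> 'k pt set \<Rightarrow> ('k pt \<Rightarrow> 'k) \<Rightarrow> 'k ratfun" where
  "ratfun V U f = {(U', f'). U' \<noteq> {} \<and> regular V U' f' \<and> (\<forall>x\<in>U \<inter> U'. f' x = f x)}"

definition ratfun_op :: "'k::field pt set \<Rightarrow> ('k \<Rightarrow> 'k \<Rightarrow> 'k) \<Rightarrow>
    'k ratfun \<Rightarrow> 'k ratfun \<Rightarrow> 'k ratfun" where
  "ratfun_op V opr a b = {(W, h). W \<noteq> {} \<and> regular V W h \<and>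
     (\<forall>(U, f)\<in>a. \<forall>(U', f')\<in>b. \<forall>x\<in>W \<inter> U \<inter> U'. h x = opr (f x) (f' x))}"

definition function_field :: "'k::field pt set \<Rightarrow> 'k ratfun ring" where
  "function_field V =
     \<lparr> carrier = {ratfun V U f | U f. U \<noteq> {} \<and> regular V U f},
       mult = ratfun_op V (*),
       one = ratfun V V (\<lambda>_. 1),
       zero = ratfun V V (\<lambda>_. 0),
       add = ratfun_op V (+) \<rparr>"

text \<open>Pullback of rational functions along a dominant morphism \<open>V \<rightarrow> B\<close>.\<close>

definition ratfun_pullback ::
    "'k::field pt set \<Rightarrow> ('k pt \<Rightarrow> 'k pt) \<Rightarrow> 'k ratfun \<Rightarrow> 'k ratfun" where
  "ratfun_pullback V \<phi> a = {(W, h). W \<noteq> {} \<and> regular V W h \<and>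
     (\<forall>(U, f)\<in>a. \<forall>x\<in>W. \<phi> x \<in> U \<longrightarrow> h x = f (\<phi> x))}"

text \<open>
  Let \<open>K = k(P1)\<close>, embedded in the function field of the source of a dominant morphism to \<open>P1\<close> by
  pullback. The generic fibre of a dominant morphism from an irreducible variety to \<open>P1\<close> is an
  integral \<open>K\<close>-scheme with the same function field as the total space.

  The predicate below says: the generic fibre of \<open>E\<close> (total space \<open>X\<close>) is the smooth projective
  model of the generic fibre of \<open>g\<close> (total space \<open>C\<close>). Its clauses are: the generic fibre of \<open>E\<close>
  is a projective integral curve; it is smooth over \<open>K\<close>, i.e. over a nonempty open part of \<open>P1\<close>
  the total space is smooth and \<open>E\<close> is submersive; the generic fibre of \<open>g\<close> is integral and
  projective; both are birational over \<open>K\<close> (so the generic fibre of \<open>g\<close> is a curve as well).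
\<close>

definition generic_fibre_is_smooth_model :: "'k::field pt set \<Rightarrow> ('k pt \<Rightarrow> 'k pt) \<Rightarrow>
    'k pt set \<Rightarrow> ('k pt \<Rightarrow> 'k pt) \<Rightarrow> bool" where
  "generic_fibre_is_smooth_model X E C g \<longleftrightarrow>
     projective_variety X \<and> krull_dim X = 2 \<and> morphism X P1 E \<and> E ` X = P1 \<and>
     (\<exists>U. openin (zar P1) U \<and> U \<noteq> {} \<and> (\<forall>x\<in>X. E x \<in> U \<longrightarrow>
        enat (tangent_dim X x) = krull_dim X \<and> submersive_at X P1 E x)) \<and>
     projective_variety C \<and> morphism C P1 g \<and> g ` C = P1 \<and>
     (\<exists>\<theta>\<in>ring_iso (function_field C) (function_field X).
        \<forall>a\<in>carrier (function_field P1). \<theta> (ratfun_pullback C g a) = ratfun_pullback X E a)"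


section \<open>The induced curves\<close>

text \<open>The curve \<open>D\<^sub>v = \<pi>(\<eta>\<^sup>*F\<^sub>v)\<close> on the quotient of the blow-up \<open>Y\<close>.\<close>

definition induced_curve :: "'k::field pt set \<Rightarrow> ('k pt \<Rightarrow> 'k pt) \<Rightarrow> ('k pt \<Rightarrow> 'k pt) \<Rightarrow>
    ('k pt \<Rightarrow> 'k pt) \<Rightarrow> 'k pt \<Rightarrow> 'k pt set" where
  "induced_curve Y \<eta> \<pi> E v = \<pi> ` {z\<in>Y. E (\<eta> z) = v}"

text \<open>The curve \<open>s^3 y = t^3 x\<close> in \<open>D \<times> P1\<close>.\<close>

definition cubic_cover :: "'k::field pt set \<Rightarrow> ('k pt \<Rightarrow> 'k) \<Rightarrow> ('k pt \<Rightarrow> 'k) \<Rightarrow> 'k pt set" where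
  "cubic_cover D x y = {segre P (hpt s t) | P s t.
     P \<in> D \<and> (s, t) \<noteq> (0, 0) \<and> s ^ 3 * y P = t ^ 3 * x P}"

end

theory Submission
  imports Defs
begin

text \<open>
  Write \<open>Y\<close> for the blow-up and \<open>C\<close> for the set of pairs \<open>(P, q)\<close> in \<open>Rt \<times> P1\<close> with
  \<open>E_Rt P = \<tau> q\<close>. As \<open>E\<close> is of type 1, \<open>E \<circ> \<eta>\<close> is invariant and descends to \<open>Rt\<close>; its fibres are
  the curves \<open>D\<^sub>v\<close>, so \<open>C\<close> is fibred by the curves \<open>s\<^sup>3 y\<^sub>v = t\<^sup>3 x\<^sub>v\<close>. Since
  \<open>\<tau> \<circ> E_X\<close> is \<open>\<sigma>\<close>-invariant and \<open>E_X\<close> is not of type 1, irreducibility gives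
  \<open>E_X \<circ> \<sigma> = \<zeta> E_X\<close> for a primitive third root of unity \<open>\<zeta>\<close>. Hence \<open>z \<mapsto> (\<pi> z, E_X (\<eta> z))\<close>
  maps \<open>Y\<close> onto \<open>C\<close>, which is therefore irreducible, and it is birational: any rational function
  on \<open>Y\<close> is a sum of three \<open>\<sigma>\<close>-eigenfunctions, each the product of an invariant function and a power
  of the coordinate of \<open>E_X\<close>.

  The blow-up is known only by its universal property, which supplies an inverse of \<open>\<eta>\<close> over
  the points moved by \<open>\<sigma>\<close>. That \<open>C\<close> has no empty fibre needs a lift of the section of \<open>E\<close> to \<open>Y\<close>.
  It exists because the isolated fixed points are finite in number (by Hilbert's basis theorem) and
  do not contain the section, and because ideals in the local rings of \<open>P1\<close> are principal.
\<close>

section \<open>Homogeneous polynomial functions\<close>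

text \<open>The argument is Kummer theory of degree 3: an affine coordinate \<open>u\<close> of
  \<open>E_X\<close> satisfies \<open>u \<circ> \<sigma> = \<zeta> u\<close>, so k(X) is k(Rt)(u),
  with the cube of \<open>u\<close> coming from the base of \<open>E_Rt\<close>. This is why
  \<open>\<zeta>\<close> must be primitive: for an invariant \<open>E_X\<close> the map to
  \<open>C\<close> would be constant on orbits and could not be birational. \<open>C\<close> is
  built as one fibre product, so that closedness, irreducibility and the function field concern a
  single projective set and the fibres over \<open>v\<close> can be read off afterwards. The smooth
  model is compared with \<open>C\<close> through function fields only; its smoothness comes from
  \<open>E\<close> alone. Two obstacles shape the rest. Morphisms are given by pulling back regular
  functions, a condition that says little about products, restrictions and coincidence loci; hence
  maps are first turned into locally polynomial ones. And surjectivity of the blow-up map over its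
  centre is not part of the universal property: relations are therefore stated at points
  \<open>\<eta> z\<close> or spread by density, and a curve meeting every fibre of \<open>E\<close>
  has to be lifted.\<close>

definition meval :: "(nat \<Rightarrow>\<^sub>0 nat) \<Rightarrow> (nat \<Rightarrow> 'k::field) \<Rightarrow> 'k" where
  "meval m v = (\<Prod>i\<in>Poly_Mapping.keys m. v i ^ Poly_Mapping.lookup m i)"

definition mdeg :: "(nat \<Rightarrow>\<^sub>0 nat) \<Rightarrow> nat" where
  "mdeg m = (\<Sum>i\<in>Poly_Mapping.keys m. Poly_Mapping.lookup m i)"

lemma meval_superset:
  assumes "finite A" "Poly_Mapping.keys m \<subseteq> A"
  shows "meval m v = (\<Prod>i\<in>A. v i ^ Poly_Mapping.lookup m i)"
  unfolding meval_def using assms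
  by (intro prod.mono_neutral_left) (auto simp: in_keys_iff)

lemma mdeg_superset:
  assumes "finite A" "Poly_Mapping.keys m \<subseteq> A"
  shows "mdeg m = (\<Sum>i\<in>A. Poly_Mapping.lookup m i)"
  unfolding mdeg_def using assms
  by (intro sum.mono_neutral_left) (auto simp: in_keys_iff)

lemma meval_add: "meval (m + m') v = meval m v * meval m' v"
proof -
  let ?A = "Poly_Mapping.keys m \<union> Poly_Mapping.keys m'"
  have "Poly_Mapping.keys (m + m') \<subseteq> ?A" by (rule Poly_Mapping.keys_add)
  then show ?thesis
    by (simp add: meval_superset[of ?A] lookup_add power_add prod.distrib)
qed

lemma mdeg_add: "mdeg (m + m') = mdeg m + mdeg m'"
proof -
  let ?A = "Poly_Mapping.keys m \<union> Poly_Mapping.keys m'"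
  have "Poly_Mapping.keys (m + m') \<subseteq> ?A" by (rule Poly_Mapping.keys_add)
  then show ?thesis
    by (simp add: mdeg_superset[of ?A] lookup_add sum.distrib)
qed

lemma meval_scale: "meval m (\<lambda>i. c * v i) = c ^ mdeg m * meval m v"
  by (simp add: meval_def mdeg_def power_mult_distrib prod.distrib power_sum)

lemma peval_meval: "peval p v = (\<Sum>m\<in>Poly_Mapping.keys p. Poly_Mapping.lookup p m * meval m v)"
  by (simp add: peval_def meval_def)

lemma homogeneous_mdeg: "homogeneous d p \<longleftrightarrow> (\<forall>m\<in>Poly_Mapping.keys p. mdeg m = d)"
  by (simp add: homogeneous_def mdeg_def)

lemma peval_superset:
  assumes "finite A" "Poly_Mapping.keys p \<subseteq> A"
  shows "peval p v = (\<Sum>m\<in>A. Poly_Mapping.lookup p m * meval m v)"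
  unfolding peval_meval using assms
  by (intro sum.mono_neutral_left) (auto simp: in_keys_iff)

lemma peval_add: "peval (p + q) v = peval p v + peval q v"
proof -
  let ?A = "Poly_Mapping.keys p \<union> Poly_Mapping.keys q"
  have "Poly_Mapping.keys (p + q) \<subseteq> ?A" by (rule Poly_Mapping.keys_add)
  then show ?thesis
    by (simp add: peval_superset[of ?A] lookup_add algebra_simps sum.distrib)
qed

lemma peval_0 [simp]: "peval 0 v = 0"
  by (simp add: peval_def)

lemma peval_sum: "peval (\<Sum>i\<in>A. p i) v = (\<Sum>i\<in>A. peval (p i) v)"
  by (induction A rule: infinite_finite_induct) (simp_all add: peval_add)

lemma peval_single: "peval (Poly_Mapping.single m c) v = c * meval m v"
  by (simp add: peval_meval)

lemma poly_mapping_expand: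
  "p = (\<Sum>m\<in>Poly_Mapping.keys p. Poly_Mapping.single m (Poly_Mapping.lookup p m))"
  by (rule poly_mapping_eqI)
    (simp add: lookup_sum lookup_single when_def in_keys_iff)

lemma peval_mult: "peval (p * q) v = peval p v * peval q v"
proof -
  have "p * q = (\<Sum>m\<in>Poly_Mapping.keys p. \<Sum>m'\<in>Poly_Mapping.keys q.
      Poly_Mapping.single (m + m') (Poly_Mapping.lookup p m * Poly_Mapping.lookup q m'))"
    by (subst poly_mapping_expand[of p], subst poly_mapping_expand[of q])
      (simp add: sum_product mult_single)
  then have "peval (p * q) v = (\<Sum>m\<in>Poly_Mapping.keys p. \<Sum>m'\<in>Poly_Mapping.keys q.
      Poly_Mapping.lookup p m * Poly_Mapping.lookup q m' * (meval m v * meval m' v))"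
    by (simp only: peval_sum peval_single meval_add)
  then show ?thesis
    by (simp add: peval_meval sum_product algebra_simps)
qed

text \<open>Forms enter only through their values, so they are kept as functions of the coordinate
  vector: products and substitutions then need no calculus of polynomials, and the zero function has
  every degree.\<close>

definition hpoly :: "nat \<Rightarrow> ((nat \<Rightarrow> 'k::field) \<Rightarrow> 'k) \<Rightarrow> bool" where
  "hpoly d F \<longleftrightarrow> (\<exists>p. homogeneous d p \<and> F = peval p)"

lemma hpolyE:
  assumes "hpoly d F"
  obtains p where "homogeneous d p" "F = peval p"
  using assms by (auto simp: hpoly_def)

lemma hpoly_peval: "homogeneous d p \<Longrightarrow> hpoly d (peval p)"
  by (auto simp: hpoly_def)

lemma hpoly_const [intro]: "hpoly 0 (\<lambda>v. c)"
  unfolding hpoly_def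
  by (rule exI[of _ "Poly_Mapping.single 0 c"])
    (auto simp: peval_single homogeneous_mdeg fun_eq_iff meval_def mdeg_def split: if_splits)

lemma hpoly_zero [intro]: "hpoly d (\<lambda>v. 0)"
  unfolding hpoly_def by (rule exI[of _ 0]) (auto simp: homogeneous_mdeg fun_eq_iff)

lemma hpoly_var [intro]: "hpoly 1 (\<lambda>v. v i)"
  unfolding hpoly_def
  by (rule exI[of _ "Poly_Mapping.single (Poly_Mapping.single i 1) 1"])
    (auto simp: peval_single homogeneous_mdeg fun_eq_iff meval_def mdeg_def)

lemma hpoly_add [intro]:
  assumes "hpoly d F" "hpoly d G" shows "hpoly d (\<lambda>v. F v + G v)"
proof -
  from assms obtain p q where "homogeneous d p" "F = peval p" "homogeneous d q" "G = peval q"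
    by (auto elim!: hpolyE)
  then show ?thesis
    unfolding hpoly_def using Poly_Mapping.keys_add[of p q]
    by (intro exI[of _ "p + q"]) (auto simp: homogeneous_mdeg peval_add fun_eq_iff)
qed

lemma hpoly_mult [intro]:
  assumes "hpoly d F" "hpoly e G" shows "hpoly (d + e) (\<lambda>v. F v * G v)"
proof -
  from assms obtain p q where "homogeneous d p" "F = peval p" "homogeneous e q" "G = peval q"
    by (auto elim!: hpolyE)
  then show ?thesis
    unfolding hpoly_def using keys_mult[of p q]
    by (intro exI[of _ "p * q"]) (fastforce simp: homogeneous_mdeg peval_mult fun_eq_iff mdeg_add)
qed

lemma hpoly_cmult: "hpoly d F \<Longrightarrow> hpoly d (\<lambda>v. c * F v)"
  using hpoly_mult[OF hpoly_const, of d F c] by simp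

lemma hpoly_diff:
  assumes "hpoly d F" "hpoly d G" shows "hpoly d (\<lambda>v. F v - G v)"
  using hpoly_add[OF assms(1) hpoly_cmult[OF assms(2), of "-1"]] by simp

lemma hpoly_sum:
  assumes "\<And>i. i \<in> A \<Longrightarrow> hpoly d (F i)" shows "hpoly d (\<lambda>v. \<Sum>i\<in>A. F i v)"
  using assms by (induction A rule: infinite_finite_induct) auto

lemma hpoly_prod:
  assumes "\<And>i. i \<in> A \<Longrightarrow> hpoly (d i) (F i)" shows "hpoly (\<Sum>i\<in>A. d i) (\<lambda>v. \<Prod>i\<in>A. F i v)"
  using assms by (induction A rule: infinite_finite_induct) auto

lemma hpoly_power: "hpoly d F \<Longrightarrow> hpoly (d * n) (\<lambda>v. F v ^ n)"
  by (induction n) auto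

text \<open>Each monomial of \<open>F\<close> is a product of \<open>d\<close> factors of degree
  \<open>e\<close>. This makes forms and fractions pull back along maps given by forms of one common
  degree.\<close>

lemma hpoly_subst:
  assumes "hpoly d F" "\<And>i. hpoly e (Q i)" shows "hpoly (d * e) (\<lambda>v. F (\<lambda>i. Q i v))"
proof -
  obtain p where p: "homogeneous d p" "F = peval p" using assms(1) by (rule hpolyE)
  have "hpoly (d * e) (\<lambda>v. Poly_Mapping.lookup p m * meval m (\<lambda>i. Q i v))"
    if "m \<in> Poly_Mapping.keys p" for m
  proof -
    have "d * e = (\<Sum>i\<in>Poly_Mapping.keys m. e * Poly_Mapping.lookup m i)"
      using p(1) that by (simp add: homogeneous_mdeg mdeg_def sum_distrib_left[symmetric])
    then show ?thesis
      unfolding meval_def using hpoly_power[OF assms(2)] by (auto intro!: hpoly_cmult hpoly_prod)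
  qed
  then show ?thesis
    unfolding p(2) peval_meval by (rule hpoly_sum)
qed

lemma hpoly_scale:
  assumes "hpoly d F" shows "F (\<lambda>i. c * v i) = c ^ d * F v"
proof -
  obtain p where "homogeneous d p" "F = peval p" using assms by (rule hpolyE)
  then show ?thesis
    by (simp add: peval_meval meval_scale homogeneous_mdeg sum_distrib_left algebra_simps)
qed

section \<open>The Zariski topology\<close>

definition PP :: "'k::field pt set" where
  "PP = (\<Union>n. Pn n)"

lemma Pn_subset_PP: "Pn n \<subseteq> PP"
  by (auto simp: PP_def)

lemma pcls_self [simp]: "v \<in> pcls v"
  unfolding pcls_def by (auto intro!: exI[of _ 1])

lemma mem_pcls: "w \<in> pcls v \<longleftrightarrow> (\<exists>c. c \<noteq> 0 \<and> w = (\<lambda>i. c * v i))"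
  by (auto simp: pcls_def)

lemma pcls_scale:
  assumes "c \<noteq> 0" shows "pcls (\<lambda>i. c * v i) = pcls v"
proof -
  have "\<exists>d'. d' \<noteq> 0 \<and> (\<lambda>i. d * v i) = (\<lambda>i. d' * (c * v i))" if "d \<noteq> 0" for d
    using assms that by (intro exI[of _ "d / c"]) auto
  moreover have "\<exists>d'. d' \<noteq> 0 \<and> (\<lambda>i. d * (c * v i)) = (\<lambda>i. d' * v i)" if "d \<noteq> 0" for d
    using assms that by (intro exI[of _ "d * c"]) (auto simp: mult.assoc)
  ultimately show ?thesis by (auto simp: pcls_def)
qed

lemma pcls_eqI: "w \<in> pcls v \<Longrightarrow> pcls w = pcls v"
  by (auto simp: mem_pcls pcls_scale)

lemma PnE:
  assumes "x \<in> Pn n"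
  obtains v i where "x = pcls v" "v i \<noteq> 0" "\<forall>j>n. v j = 0"
  using assms unfolding Pn_def by blast

lemma PnI: "v i \<noteq> 0 \<Longrightarrow> (\<And>j. j > n \<Longrightarrow> v j = 0) \<Longrightarrow> pcls v \<in> Pn n"
  by (auto simp: Pn_def)

lemma Pn_rep:
  assumes "x \<in> Pn n" "v \<in> x"
  shows "x = pcls v" "\<exists>i. v i \<noteq> 0" "j > n \<Longrightarrow> v j = 0"
proof -
  obtain w i where w: "x = pcls w" "w i \<noteq> 0" "\<forall>j>n. w j = 0"
    using assms(1) by (rule PnE)
  then obtain c where "c \<noteq> 0" "v = (\<lambda>i. c * w i)" using assms(2) by (auto simp: mem_pcls)
  with w show "x = pcls v" "\<exists>i. v i \<noteq> 0" "j > n \<Longrightarrow> v j = 0"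
    by (auto simp: pcls_scale)
qed

lemma PP_rep:
  assumes "x \<in> PP" "v \<in> x"
  shows "x = pcls v" "\<exists>i. v i \<noteq> 0"
  using assms Pn_rep by (fastforce simp: PP_def)+

lemma PP_nonempty: "x \<in> PP \<Longrightarrow> \<exists>v. v \<in> x"
proof -
  assume "x \<in> PP"
  then obtain v where "x = pcls v" unfolding PP_def Pn_def by blast
  then show ?thesis using pcls_self by blast
qed

text \<open>Proportionality is the vanishing of all 2 by 2 minors, a polynomial condition; equality
  of two maps thereby becomes a closed condition.\<close>

lemma pcls_eq_iff:
  assumes "a k \<noteq> 0" "b l \<noteq> 0"
  shows "pcls a = pcls b \<longleftrightarrow> (\<forall>i j. a i * b j = a j * b i)"
proof
  assume "pcls a = pcls b"
  then have "a \<in> pcls b" using pcls_self by metis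
  then show "\<forall>i j. a i * b j = a j * b i" by (auto simp: mem_pcls)
next
  assume *: "\<forall>i j. a i * b j = a j * b i"
  then have "a l \<noteq> 0" using assms by (metis mult_eq_0_iff)
  have "a = (\<lambda>i. (a l / b l) * b i)"
    using * assms by (auto simp: field_simps)
  then have "a \<in> pcls b"
    using \<open>a l \<noteq> 0\<close> assms by (auto simp: mem_pcls intro!: exI[of _ "a l / b l"])
  then show "pcls a = pcls b" by (rule pcls_eqI)
qed

lemma PP_cases:
  assumes "x \<in> PP"
  obtains v i where "x = pcls v" "v i \<noteq> 0"
  using assms unfolding PP_def Pn_def by blast

text \<open>Rescaling multiplies the value by a power of a nonzero scalar, so one representative
  vector decides for the whole point; \<open>\<exists>v\<in>y\<close> and
  \<open>\<forall>v\<in>y\<close> are interchangeable in open conditions.\<close>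

lemma hpoly_nonzero_rep:
  assumes "hpoly d F" "x \<in> PP" "v \<in> x" "w \<in> x"
  shows "F v \<noteq> 0 \<longleftrightarrow> F w \<noteq> 0"
proof -
  have "w \<in> pcls v" using PP_rep(1)[OF assms(2,3)] assms(4) by simp
  then obtain c where "c \<noteq> 0" "w = (\<lambda>i. c * v i)" by (auto simp: mem_pcls)
  then show ?thesis using hpoly_scale[OF assms(1), of c v] by simp
qed

abbreviation nonvanishing :: "'k::field pt set \<Rightarrow> ((nat \<Rightarrow> 'k) \<Rightarrow> 'k) \<Rightarrow> 'k pt set" where
  "nonvanishing V F \<equiv> {y\<in>V. \<forall>v\<in>y. F v \<noteq> 0}"

text \<open>The generating sets already form a base: a finite intersection is cut out by the product
  of the forms.\<close>

lemma openin_zariski_basic: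
  assumes "openin zariski U" "x \<in> U"
  shows "x \<in> PP \<and> (\<exists>F d. hpoly d F \<and> (\<forall>v\<in>x. F v \<noteq> 0) \<and> nonvanishing PP F \<subseteq> U)"
proof -
  let ?S = "{basic_open p | p d. homogeneous d p} :: 'a pt set set"
  have "generate_topology_on ?S U"
    using assms(1) by (simp add: zariski_def openin_topology_generated_by_iff)
  then show ?thesis using assms(2)
  proof (induction arbitrary: x)
    case (Int A B)
    have "x \<in> A" "x \<in> B" using Int.prems by auto
    from Int.IH(1)[OF this(1)] Int.IH(2)[OF this(2)]
    obtain F d G e where *: "x \<in> PP" "hpoly d F" "\<forall>v\<in>x. F v \<noteq> 0" "nonvanishing PP F \<subseteq> A"
      "hpoly e G" "\<forall>v\<in>x. G v \<noteq> 0" "nonvanishing PP G \<subseteq> B" by blast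
    have "hpoly (d + e) (\<lambda>v. F v * G v)" "\<forall>v\<in>x. F v * G v \<noteq> 0"
      "{y\<in>PP. \<forall>v\<in>y. F v * G v \<noteq> 0} \<subseteq> A \<inter> B"
      using * by auto
    then show ?case using *(1) by blast
  next
    case (UN K)
    then obtain k where "k \<in> K" "x \<in> k" by auto
    with UN.IH[of k x] show ?case by blast
  next
    case (Basis s)
    then obtain p d where p: "homogeneous d p" "s = basic_open p" by auto
    with Basis have x: "x \<in> PP" "\<exists>v\<in>x. peval p v \<noteq> 0" by (auto simp: basic_open_def PP_def)
    have "hpoly d (peval p)" using p(1) by (rule hpoly_peval)
    moreover have "\<forall>v\<in>x. peval p v \<noteq> 0"
      using x(2) hpoly_nonzero_rep[OF hpoly_peval[OF p(1)] x(1)] by blast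
    moreover have "{y\<in>PP. \<forall>v\<in>y. peval p v \<noteq> 0} \<subseteq> s"
      unfolding p(2) basic_open_def using PP_nonempty PP_def by blast
    ultimately show ?case using x(1) by blast
  qed auto
qed

lemma openin_zariski_nonzero:
  assumes "hpoly d F" shows "openin zariski (nonvanishing PP F)"
proof -
  obtain p where p: "homogeneous d p" "F = peval p" using assms by (rule hpolyE)
  have "y \<in> basic_open p \<longleftrightarrow> y \<in> PP \<and> (\<forall>v\<in>y. F v \<noteq> 0)" for y
    using hpoly_nonzero_rep[OF assms, of y] PP_nonempty[of y]
    unfolding basic_open_def p(2) PP_def by blast
  then have "nonvanishing PP F = basic_open p" by blast
  then show ?thesis
    using p(1) by (auto simp: zariski_def intro!: topology_generated_by_Basis)
qed

lemma topspace_zariski: "topspace zariski = PP"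
proof
  show "topspace zariski \<subseteq> PP" using openin_zariski_basic by blast
  have "openin zariski {y\<in>PP. \<forall>v\<in>y. (\<lambda>_ :: nat \<Rightarrow> 'a. 1 :: 'a) v \<noteq> 0}"
    by (rule openin_zariski_nonzero) (rule hpoly_const)
  then show "PP \<subseteq> (topspace zariski :: 'a pt set)" using openin_subset by fastforce
qed

lemma topspace_zar: "V \<subseteq> PP \<Longrightarrow> topspace (zar V) = V"
  by (auto simp: topspace_zariski)

lemma openin_zar_self: "V \<subseteq> PP \<Longrightarrow> openin (zar V) V"
  using openin_topspace[of "zar V"] topspace_zar by metis

lemma closedin_zar_self: "V \<subseteq> PP \<Longrightarrow> closedin (zar V) V"
  using closedin_topspace[of "zar V"] topspace_zar by metis

lemma openin_zar_subset: "openin (zar V) U \<Longrightarrow> U \<subseteq> V"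
  by (rule openin_imp_subset)

lemma openin_zar_nonzero:
  assumes "hpoly d F" "V \<subseteq> PP" shows "openin (zar V) (nonvanishing V F)"
proof -
  have "nonvanishing V F = V \<inter> nonvanishing PP F" using assms by auto
  then show ?thesis using openin_zariski_nonzero[OF assms(1)]
    by (simp add: openin_subtopology_Int2)
qed

lemma openin_zar_iff:
  assumes "V \<subseteq> PP"
  shows "openin (zar V) U \<longleftrightarrow> U \<subseteq> V \<and>
    (\<forall>x\<in>U. \<exists>F d. hpoly d F \<and> (\<forall>v\<in>x. F v \<noteq> 0) \<and> nonvanishing V F \<subseteq> U)"
proof (intro iffI conjI ballI)
  assume "openin (zar V) U"
  then show "U \<subseteq> V" by (rule openin_zar_subset)
  fix x assume "x \<in> U"
  obtain T where T: "openin zariski T" "U = T \<inter> V"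
    using \<open>openin (zar V) U\<close> by (auto simp: openin_subtopology)
  then obtain F d where "hpoly d F" "\<forall>v\<in>x. F v \<noteq> 0" "nonvanishing PP F \<subseteq> T"
    using openin_zariski_basic[OF T(1)] \<open>x \<in> U\<close> by blast
  then show "\<exists>F d. hpoly d F \<and> (\<forall>v\<in>x. F v \<noteq> 0) \<and> nonvanishing V F \<subseteq> U"
    using T(2) assms by blast
next
  assume *: "U \<subseteq> V \<and> (\<forall>x\<in>U. \<exists>F d. hpoly d F \<and> (\<forall>v\<in>x. F v \<noteq> 0) \<and> nonvanishing V F \<subseteq> U)"
  show "openin (zar V) U"
  proof (subst openin_subopen, intro ballI)
    fix x assume "x \<in> U"
    with * obtain F d where F: "hpoly d F" "\<forall>v\<in>x. F v \<noteq> 0" "nonvanishing V F \<subseteq> U" by blast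
    with * \<open>x \<in> U\<close> openin_zar_nonzero[OF F(1) assms]
    show "\<exists>T. openin (zar V) T \<and> x \<in> T \<and> T \<subseteq> U" by blast
  qed
qed

lemma openin_zar_trans: "openin (zar V) U \<Longrightarrow> openin (zar U) W \<Longrightarrow> openin (zar V) W"
  by (metis openin_zar_subset inf.absorb_iff2 openin_trans_full subtopology_subtopology)

lemma openin_zar_restrict:
  assumes "openin (zar V) U" "V' \<subseteq> V" shows "openin (zar V') (U \<inter> V')"
  using assms by (metis inf.absorb_iff2 openin_subtopology_Int subtopology_subtopology)

text \<open>The form in which irreducibility is used throughout: nonempty open sets are dense, so
  identities spread from any one of them.\<close>

lemma irreducible_opens_meet:
  assumes "irreducible_space T" "openin T A" "openin T B" "A \<noteq> {}" "B \<noteq> {}"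
  shows "A \<inter> B \<noteq> {}"
proof
  assume "A \<inter> B = {}"
  have sub: "A \<subseteq> topspace T" "B \<subseteq> topspace T" using assms(2,3) openin_subset by auto
  have "closedin T (topspace T - A)" "closedin T (topspace T - B)" using assms(2,3) by auto
  moreover have "(topspace T - A) \<union> (topspace T - B) = topspace T" using \<open>A \<inter> B = {}\<close> by auto
  ultimately have "topspace T - A = topspace T \<or> topspace T - B = topspace T"
    using assms(1) unfolding irreducible_space_def by blast
  with sub assms(4,5) show False by blast
qed

lemma irreducible_spaceI:
  assumes "topspace T \<noteq> {}"
    and "\<And>A B. openin T A \<Longrightarrow> openin T B \<Longrightarrow> A \<noteq> {} \<Longrightarrow> B \<noteq> {} \<Longrightarrow> A \<inter> B \<noteq> {}"
  shows "irreducible_space T"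
  unfolding irreducible_space_def
proof (intro conjI allI impI)
  fix A B assume *: "closedin T A \<and> closedin T B \<and> A \<union> B = topspace T"
  show "A = topspace T \<or> B = topspace T"
  proof (rule ccontr)
    assume "\<not> ?thesis"
    then have "topspace T - A \<noteq> {}" "topspace T - B \<noteq> {}"
      using * closedin_subset by blast+
    moreover have "openin T (topspace T - A)" "openin T (topspace T - B)" using * by auto
    ultimately have "(topspace T - A) \<inter> (topspace T - B) \<noteq> {}" using assms(2) by blast
    then show False using * by blast
  qed
qed (rule assms(1))

lemma irreducible_open_subset:
  assumes "irreducible_space (zar V)" "openin (zar V) U" "U \<noteq> {}"
  shows "irreducible_space (zar U)"
proof (rule irreducible_spaceI)
  show "topspace (zar U) \<noteq> {}"
    using assms(2,3) openin_subset[OF assms(2)] by auto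
  fix A B assume "openin (zar U) A" "openin (zar U) B" "A \<noteq> {}" "B \<noteq> {}"
  then show "A \<inter> B \<noteq> {}"
    using irreducible_opens_meet[OF assms(1)] openin_zar_trans[OF assms(2)] by blast
qed

lemma irreducible_space_image:
  assumes "irreducible_space S" "continuous_map S T f" "f ` topspace S = topspace T"
  shows "irreducible_space T"
proof (rule irreducible_spaceI)
  show "topspace T \<noteq> {}" using assms(1,3) unfolding irreducible_space_def by auto
  fix A B assume AB: "openin T A" "openin T B" "A \<noteq> {}" "B \<noteq> {}"
 have op: "openin S {x\<in>topspace S. f x \<in> A}" "openin S {x\<in>topspace S. f x \<in> B}"
    using AB assms(2) by (auto simp: continuous_map)
  have ne: "{x\<in>topspace S. f x \<in> O'} \<noteq> {}" if O': "openin T O'" "O' \<noteq> {}" for O'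
  proof -
    obtain y where "y \<in> O'" using O'(2) by blast
    then have "y \<in> f ` topspace S" using openin_subset[OF O'(1)] assms(3) by auto
    then show ?thesis using \<open>y \<in> O'\<close> by auto
  qed
  with op have "{x\<in>topspace S. f x \<in> A} \<inter> {x\<in>topspace S. f x \<in> B} \<noteq> {}"
    using irreducible_opens_meet[OF assms(1) _ _ ne[OF AB(1,3)] ne[OF AB(2,4)]] by blast
  then show "A \<inter> B \<noteq> {}" by blast
qed

section \<open>Regular functions\<close>

definition fraction_on :: "'k::field pt set \<Rightarrow> ((nat \<Rightarrow> 'k) \<Rightarrow> 'k) \<Rightarrow> ((nat \<Rightarrow> 'k) \<Rightarrow> 'k) \<Rightarrow>
    ('k pt \<Rightarrow> 'k) \<Rightarrow> bool" where
  "fraction_on W P Q f \<longleftrightarrow> (\<forall>y\<in>W. \<forall>v\<in>y. Q v \<noteq> 0 \<and> f y = P v / Q v)"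

lemma fraction_onI:
  "(\<And>y v. y \<in> W \<Longrightarrow> v \<in> y \<Longrightarrow> Q v \<noteq> 0) \<Longrightarrow>
   (\<And>y v. y \<in> W \<Longrightarrow> v \<in> y \<Longrightarrow> f y = P v / Q v) \<Longrightarrow> fraction_on W P Q f"
  by (simp add: fraction_on_def)

lemma fraction_onD:
  assumes "fraction_on W P Q f" "y \<in> W" "v \<in> y"
  shows "Q v \<noteq> 0" "f y = P v / Q v"
  using bspec[OF bspec[OF assms(1)[unfolded fraction_on_def] assms(2)] assms(3)] by auto

lemma fraction_on_subset: "fraction_on W P Q f \<Longrightarrow> W' \<subseteq> W \<Longrightarrow> fraction_on W' P Q f"
  unfolding fraction_on_def by blast

abbreviation fraction_near ::
    "'k::field pt set \<Rightarrow> 'k pt set \<Rightarrow> ('k pt \<Rightarrow> 'k) \<Rightarrow> 'k pt \<Rightarrow> bool" where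
  "fraction_near V U f x \<equiv> (\<exists>W P Q d. openin (zar V) W \<and> x \<in> W \<and> W \<subseteq> U \<and>
     hpoly d P \<and> hpoly d Q \<and> fraction_on W P Q f)"

lemma regular_iff:
  "regular V U f \<longleftrightarrow> openin (zar V) U \<and>
     (\<forall>x\<in>U. fraction_near V U f x)"
  (is "_ \<longleftrightarrow> _ \<and> (\<forall>x\<in>U. ?R x)")
proof -
  have "(\<exists>W p q d. openin (zar V) W \<and> x \<in> W \<and> W \<subseteq> U \<and> homogeneous d p \<and> homogeneous d q \<and>
      fraction_on W (peval p) (peval q) f) \<longleftrightarrow> ?R x" for x
    by (blast intro: hpoly_peval elim: hpolyE)
  then show ?thesis unfolding regular_def fraction_on_def[symmetric] by simp
qed

lemma regular_openin: "regular V U f \<Longrightarrow> openin (zar V) U"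
  by (simp add: regular_def)

lemma regularE:
  assumes "regular V U f" "x \<in> U"
  obtains W P Q d where "openin (zar V) W" "x \<in> W" "W \<subseteq> U" "hpoly d P" "hpoly d Q"
    "fraction_on W P Q f"
  using assms unfolding regular_iff by blast

lemma regularI:
  assumes "openin (zar V) U"
    and "\<And>x. x \<in> U \<Longrightarrow> fraction_near V U f x"
  shows "regular V U f"
  unfolding regular_iff using assms by blast

lemma regular_subset:
  assumes "regular V U f" "openin (zar V) U'" "U' \<subseteq> U" shows "regular V U' f"
proof (rule regularI[OF assms(2)])
  fix x assume x: "x \<in> U'"
  obtain W P Q d where *: "openin (zar V) W" "x \<in> W" "W \<subseteq> U" "hpoly d P" "hpoly d Q"
    "fraction_on W P Q f"
    by (rule regularE[OF assms(1) subsetD[OF assms(3) x]])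
  then have "openin (zar V) (W \<inter> U')" "x \<in> W \<inter> U'" "fraction_on (W \<inter> U') P Q f"
    using assms(2) x by (auto intro: fraction_on_subset)
  with *(4,5) show "fraction_near V U' f x" by blast
qed

lemma regular_cong:
  assumes "regular V U f" "\<And>x. x \<in> U \<Longrightarrow> g x = f x" shows "regular V U g"
proof (rule regularI)
  show "openin (zar V) U" using assms(1) by (rule regular_openin)
  fix x assume x: "x \<in> U"
  obtain W P Q d where *: "openin (zar V) W" "x \<in> W" "W \<subseteq> U" "hpoly d P" "hpoly d Q"
    "fraction_on W P Q f"
    by (rule regularE[OF assms(1) x])
  moreover have "fraction_on W P Q g"
    using *(3) assms(2) fraction_onD[OF *(6)] by (intro fraction_onI) (auto dest!: subsetD)
  ultimately show "fraction_near V U g x" by blast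
qed

lemma regular_const:
  assumes "openin (zar V) U" shows "regular V U (\<lambda>_. c)"
proof (rule regularI[OF assms])
  have "fraction_on U (\<lambda>_. c) (\<lambda>_. 1) (\<lambda>_. c)" by (simp add: fraction_on_def)
  then show "fraction_near V U (\<lambda>_. c) x" if "x \<in> U" for x
    using assms that hpoly_const by blast
qed

text \<open>With the common denominator \<open>Q * Q'\<close> of degree \<open>d + e\<close>, sum
  and product differ only in their numerator \<open>N\<close>.\<close>

lemma regular_binop:
  assumes f: "regular V A f" and g: "regular V B g"
    and op: "\<And>P Q P' Q' d e. hpoly d P \<Longrightarrow> hpoly d Q \<Longrightarrow> hpoly e P' \<Longrightarrow> hpoly e Q' \<Longrightarrow>
      \<exists>N. hpoly (d + e) N \<and> (\<forall>v. Q v \<noteq> 0 \<longrightarrow> Q' v \<noteq> 0 \<longrightarrow>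
        opr (P v / Q v) (P' v / Q' v) = N v / (Q v * Q' v))"
  shows "regular V (A \<inter> B) (\<lambda>x. opr (f x) (g x))"
proof (rule regularI)
  show "openin (zar V) (A \<inter> B)" using f g by (auto dest: regular_openin)
  fix x assume x: "x \<in> A \<inter> B"
  obtain W P Q d where W:
    "openin (zar V) W" "x \<in> W" "W \<subseteq> A" "hpoly d P" "hpoly d Q" "fraction_on W P Q f"
    by (rule regularE[OF f IntD1[OF x]])
  obtain W' P' Q' e where W':
    "openin (zar V) W'" "x \<in> W'" "W' \<subseteq> B" "hpoly e P'" "hpoly e Q'" "fraction_on W' P' Q' g"
    by (rule regularE[OF g IntD2[OF x]])
  obtain N where N: "hpoly (d + e) N" "\<forall>v. Q v \<noteq> 0 \<longrightarrow> Q' v \<noteq> 0 \<longrightarrow>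
        opr (P v / Q v) (P' v / Q' v) = N v / (Q v * Q' v)"
    using op[OF W(4,5) W'(4,5)] by (elim exE conjE)
  have "fraction_on (W \<inter> W') N (\<lambda>v. Q v * Q' v) (\<lambda>x. opr (f x) (g x))"
    using N(2) W(6) W'(6) by (auto simp: fraction_on_def)
  moreover have "hpoly (d + e) (\<lambda>v. Q v * Q' v)" using W(5) W'(5) by (rule hpoly_mult)
  moreover have "openin (zar V) (W \<inter> W')" "x \<in> W \<inter> W'" "W \<inter> W' \<subseteq> A \<inter> B" using W W' by auto
  ultimately show "\<exists>W P Q d. openin (zar V) W \<and> x \<in> W \<and> W \<subseteq> A \<inter> B \<and> hpoly d P \<and> hpoly d Q \<and>
        fraction_on W P Q (\<lambda>x. opr (f x) (g x))"
    using N(1) by blast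
qed

lemma regular_add:
  assumes "regular V A f" "regular V B g" shows "regular V (A \<inter> B) (\<lambda>x. f x + g x)"
proof (rule regular_binop[OF assms])
  fix P Q P' Q' :: "(nat \<Rightarrow> 'a) \<Rightarrow> 'a" and d e
  assume "hpoly d P" "hpoly d Q" "hpoly e P'" "hpoly e Q'"
  then have "hpoly (d + e) (\<lambda>v. P v * Q' v + Q v * P' v)" by (intro hpoly_add hpoly_mult)
  then show "\<exists>N. hpoly (d + e) N \<and> (\<forall>v. Q v \<noteq> 0 \<longrightarrow> Q' v \<noteq> 0 \<longrightarrow>
        P v / Q v + P' v / Q' v = N v / (Q v * Q' v))"
    by (intro exI[of _ "\<lambda>v. P v * Q' v + Q v * P' v"]) (auto simp: field_simps)
qed

lemma regular_mult:
  assumes "regular V A f" "regular V B g" shows "regular V (A \<inter> B) (\<lambda>x. f x * g x)"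
proof (rule regular_binop[OF assms])
  fix P Q P' Q' :: "(nat \<Rightarrow> 'a) \<Rightarrow> 'a" and d e
  assume "hpoly d P" "hpoly d Q" "hpoly e P'" "hpoly e Q'"
  then have "hpoly (d + e) (\<lambda>v. P v * P' v)" by (intro hpoly_mult)
  then show "\<exists>N. hpoly (d + e) N \<and> (\<forall>v. Q v \<noteq> 0 \<longrightarrow> Q' v \<noteq> 0 \<longrightarrow>
        P v / Q v * (P' v / Q' v) = N v / (Q v * Q' v))"
    by (intro exI[of _ "\<lambda>v. P v * P' v"]) auto
qed

lemma regular_add': "regular V A f \<Longrightarrow> regular V A g \<Longrightarrow> regular V A (\<lambda>x. f x + g x)"
  using regular_add[of V A f A g] by simp

lemma regular_mult': "regular V A f \<Longrightarrow> regular V A g \<Longrightarrow> regular V A (\<lambda>x. f x * g x)"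
  using regular_mult[of V A f A g] by simp

lemma regular_power: "regular V A f \<Longrightarrow> regular V A (\<lambda>x. f x ^ n)"
  by (induction n) (auto intro: regular_const regular_openin regular_mult')

lemma regular_nonzero_open:
  assumes "regular V A f" "V \<subseteq> PP" shows "openin (zar V) {x\<in>A. f x \<noteq> 0}"
proof (subst openin_subopen, intro ballI)
  fix x assume x0: "x \<in> {x\<in>A. f x \<noteq> 0}"
  then have x: "x \<in> A" by simp
  obtain W P Q d where *: "openin (zar V) W" "x \<in> W" "W \<subseteq> A" "hpoly d P" "hpoly d Q"
    "fraction_on W P Q f"
    by (rule regularE[OF assms(1) x])
  have sub: "W \<subseteq> V" using *(1) by (rule openin_zar_subset)
  let ?T = "W \<inter> nonvanishing V P"
  have "openin (zar V) ?T" using *(1) openin_zar_nonzero[OF *(4) assms(2)] by blast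
  moreover have "x \<in> ?T" using x0 *(2) fraction_onD[OF *(6)] sub by fastforce
  moreover have "?T \<subseteq> {x\<in>A. f x \<noteq> 0}"
  proof
    fix y assume y: "y \<in> ?T"
    then obtain v where "v \<in> y" using assms(2) sub PP_nonempty by blast
    with y *(3) fraction_onD[OF *(6), of y v] show "y \<in> {x\<in>A. f x \<noteq> 0}" by auto
  qed
  ultimately show "\<exists>T. openin (zar V) T \<and> x \<in> T \<and> T \<subseteq> {x\<in>A. f x \<noteq> 0}" by blast
qed

lemma regular_inverse:
  assumes "regular V A f" "V \<subseteq> PP" "\<And>x. x \<in> A \<Longrightarrow> f x \<noteq> 0"
  shows "regular V A (\<lambda>x. inverse (f x))"
proof (rule regularI)
  show op: "openin (zar V) A" using assms(1) by (rule regular_openin)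
  fix x assume x: "x \<in> A"
  obtain W P Q d where *: "openin (zar V) W" "x \<in> W" "W \<subseteq> A" "hpoly d P" "hpoly d Q"
    "fraction_on W P Q f"
    by (rule regularE[OF assms(1) x])
  have "fraction_on W Q P (\<lambda>x. inverse (f x))"
    using *(3,6) assms(3) by (force simp: fraction_on_def)
  then show "fraction_near V A (\<lambda>x. inverse (f x)) x" using * by blast
qed

lemma regular_neq_open:
  assumes "regular V A f" "regular V B g" "V \<subseteq> PP"
  shows "openin (zar V) {x\<in>A \<inter> B. f x \<noteq> g x}"
proof -
  have "regular V (A \<inter> B) (\<lambda>x. f x + (-1) * g x)"
    using assms by (intro regular_add[of V A f B] regular_mult'[of V B "\<lambda>_. - 1"])
      (auto intro: regular_const regular_openin)
  from regular_nonzero_open[OF this assms(3)] show ?thesis by simp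
qed

text \<open>Identity theorem: the locus where \<open>f\<close> and \<open>g\<close> differ is open,
  so if nonempty it would meet \<open>O'\<close>.\<close>

lemma regular_eq_dense:
  assumes "irreducible_space (zar V)" "V \<subseteq> PP" "regular V A f" "regular V B g"
    and "openin (zar V) O'" "O' \<noteq> {}" "\<And>x. x \<in> A \<inter> B \<inter> O' \<Longrightarrow> f x = g x" "x \<in> A \<inter> B"
  shows "f x = g x"
proof (rule ccontr)
  assume "f x \<noteq> g x"
  then have "{x\<in>A \<inter> B. f x \<noteq> g x} \<noteq> {}" using assms(8) by blast
  then have "{x\<in>A \<inter> B. f x \<noteq> g x} \<inter> O' \<noteq> {}"
    using irreducible_opens_meet[OF assms(1) regular_neq_open[OF assms(3,4,2)] assms(5)] assms(6) by blast
  with assms(7) show False by blast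
qed

lemma regular_open_subvariety:
  assumes "openin (zar V) U" "regular U A f" shows "regular V A f"
proof (rule regularI)
  show "openin (zar V) A" using assms by (blast intro: openin_zar_trans regular_openin)
  fix x assume x: "x \<in> A"
  obtain W P Q d where "openin (zar U) W" "x \<in> W" "W \<subseteq> A" "hpoly d P" "hpoly d Q"
    "fraction_on W P Q f"
    by (rule regularE[OF assms(2) x])
  then show "fraction_near V A f x"
    using openin_zar_trans[OF assms(1)] by blast
qed

text \<open>A scaling factor cancels in the ratio, so the chosen representative is immaterial. Where
  coordinate \<open>i\<close> vanishes the value is the default 0, outside the set on which
  regularity is claimed.\<close>

definition coord_ratio :: "nat \<Rightarrow> nat \<Rightarrow> 'k::field pt \<Rightarrow> 'k" where
  "coord_ratio i j y = (SOME v. v \<in> y) j / (SOME v. v \<in> y) i"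

lemma coord_ratio_eq:
  assumes "y \<in> PP" "v \<in> y" shows "coord_ratio i j y = v j / v i"
proof -
  have "(SOME v. v \<in> y) \<in> y" using assms(2) by (rule someI[of "\<lambda>v. v \<in> y"])
  then have "(SOME v. v \<in> y) \<in> pcls v" using PP_rep(1)[OF assms] by simp
  then show ?thesis by (auto simp: mem_pcls coord_ratio_def)
qed

lemma regular_coord_ratio:
  assumes "V \<subseteq> PP"
  shows "regular V {y\<in>V. \<forall>v\<in>y. v i \<noteq> 0} (coord_ratio i j)"
proof (rule regularI)
  let ?U = "{y\<in>V. \<forall>v\<in>y. v i \<noteq> 0}"
  show op: "openin (zar V) ?U" by (rule openin_zar_nonzero[OF hpoly_var assms])
  fix x assume x: "x \<in> ?U"
  have "fraction_on ?U (\<lambda>v. v j) (\<lambda>v. v i) (coord_ratio i j)"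
    using assms by (intro fraction_onI) (auto simp: coord_ratio_eq subset_iff)
  then show "fraction_near V ?U (coord_ratio i j) x"
    using op x hpoly_var[of i] hpoly_var[of j] by blast
qed

section \<open>Morphisms as locally polynomial maps\<close>

definition represents_on :: "'k::field pt set \<Rightarrow> (nat \<Rightarrow> (nat \<Rightarrow> 'k) \<Rightarrow> 'k) \<Rightarrow> ('k pt \<Rightarrow> 'k pt) \<Rightarrow> bool" where
  "represents_on W P \<phi> \<longleftrightarrow> (\<forall>y\<in>W. \<forall>v\<in>y. \<phi> y = pcls (\<lambda>i. P i v) \<and> (\<exists>i. P i v \<noteq> 0))"

lemma represents_onI:
  "(\<And>y v. y \<in> W \<Longrightarrow> v \<in> y \<Longrightarrow> \<phi> y = pcls (\<lambda>i. P i v) \<and> (\<exists>i. P i v \<noteq> 0)) \<Longrightarrow> represents_on W P \<phi>"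
  by (simp add: represents_on_def)

lemma represents_onD:
  assumes "represents_on W P \<phi>" "y \<in> W" "v \<in> y"
  shows "\<phi> y = pcls (\<lambda>i. P i v)" "\<exists>i. P i v \<noteq> 0" "(\<lambda>i. P i v) \<in> \<phi> y"
proof -
  have *: "\<phi> y = pcls (\<lambda>i. P i v) \<and> (\<exists>i. P i v \<noteq> 0)"
    using bspec[OF bspec[OF assms(1)[unfolded represents_on_def] assms(2)] assms(3)] .
  then show "\<phi> y = pcls (\<lambda>i. P i v)" "\<exists>i. P i v \<noteq> 0" by auto
  show "(\<lambda>i. P i v) \<in> \<phi> y" using conjunct1[OF *] pcls_self by metis
qed

definition locpoly_at :: "'k::field pt set \<Rightarrow> ('k pt \<Rightarrow> 'k pt) \<Rightarrow> 'k pt \<Rightarrow> bool" where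
  "locpoly_at V \<phi> x \<longleftrightarrow>
     (\<exists>W P d. openin (zar V) W \<and> x \<in> W \<and> (\<forall>i. hpoly d (P i)) \<and> represents_on W P \<phi>)"

lemma locpoly_atI:
  assumes "openin (zar V) W" "x \<in> W" "\<And>i. hpoly d (P i)" "represents_on W P \<phi>"
  shows "locpoly_at V \<phi> x"
  unfolding locpoly_at_def using assms by (intro exI[of _ W] exI[of _ P] exI[of _ d]) simp

definition locpoly :: "'k::field pt set \<Rightarrow> ('k pt \<Rightarrow> 'k pt) \<Rightarrow> bool" where
  "locpoly V \<phi> \<longleftrightarrow> (\<forall>x\<in>V. locpoly_at V \<phi> x)"

lemma locpolyI: "(\<And>x. x \<in> V \<Longrightarrow> locpoly_at V \<phi> x) \<Longrightarrow> locpoly V \<phi>"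
  by (simp add: locpoly_def)

lemma locpolyE:
  assumes "locpoly V \<phi>" "x \<in> V"
  obtains W P d where "openin (zar V) W" "x \<in> W" "\<forall>i. hpoly d (P i)" "represents_on W P \<phi>"
proof -
  have "locpoly_at V \<phi> x" using assms by (simp add: locpoly_def)
  then show ?thesis unfolding locpoly_at_def by (elim exE conjE) (rule that)
qed

lemma locpoly_subset:
  assumes "locpoly V \<phi>" "V' \<subseteq> V" shows "locpoly V' \<phi>"
proof (rule locpolyI)
  fix x assume x: "x \<in> V'"
  obtain W P d where *: "openin (zar V) W" "x \<in> W" "\<forall>i. hpoly d (P i)" "represents_on W P \<phi>"
    using locpolyE[OF assms(1) subsetD[OF assms(2) x]] .
  have "openin (zar V') (W \<inter> V')" using *(1) assms(2) by (rule openin_zar_restrict)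
  moreover have "represents_on (W \<inter> V') P \<phi>" using *(4) unfolding represents_on_def by blast
  moreover have "x \<in> W \<inter> V'" using *(2) x by simp
  ultimately show "locpoly_at V' \<phi> x"
    using *(3) by (intro locpoly_atI[where P = P and d = d]) simp_all
qed

text \<open>Pull back the affine coordinates \<open>coord_ratio i j\<close> of a chart around
  \<open>\<phi> x\<close>: they become fractions of forms, and clearing denominators yields
  homogeneous coordinates of \<open>\<phi>\<close>. The bound \<open>W \<subseteq> Pn n\<close>
  leaves only finitely many fractions to bring to a common denominator.\<close>

lemma morphism_imp_locpoly:
  assumes \<phi>: "morphism V W \<phi>" and V: "V \<subseteq> PP" and W: "W \<subseteq> Pn n"
  shows "locpoly V \<phi>"
proof (rule locpolyI)
  fix x assume x: "x \<in> V"
  have WPP: "W \<subseteq> PP" using W Pn_subset_PP by blast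
  have im: "\<phi> y \<in> W" if "y \<in> V" for y using \<phi> that by (auto simp: morphism_def)
  obtain a i where a: "\<phi> x = pcls a" "a i \<noteq> 0"
    using im[OF x] WPP by (meson PP_cases subsetD)
  let ?T = "{y\<in>W. \<forall>v\<in>y. v i \<noteq> 0}"
  have xT: "x \<in> {z\<in>V. \<phi> z \<in> ?T}" using x im[OF x] a by (auto simp: mem_pcls)
  have "regular V {z\<in>V. \<phi> z \<in> ?T} (\<lambda>z. coord_ratio i j (\<phi> z))" for j
    using \<phi> regular_coord_ratio[OF WPP, of i j] unfolding morphism_def by blast
  note reg = this
  \<comment> \<open>Bundling the conclusions in one predicate lets a single choice pick
    neighbourhood, numerator, denominator and degree for every \<open>j\<close>.\<close>
  define \<Phi> where "\<Phi> j W P Q d \<longleftrightarrow> openin (zar V) W \<and> x \<in> W \<and> W \<subseteq> {z\<in>V. \<phi> z \<in> ?T} \<and>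
      hpoly d P \<and> hpoly d Q \<and> fraction_on W P Q (\<lambda>z. coord_ratio i j (\<phi> z))" for j W P Q d
  have "\<exists>W P Q d. \<Phi> j W P Q d" for j
    using conjunct2[OF reg[of j, unfolded regular_iff]] xT unfolding \<Phi>_def by (rule bspec)
  then obtain Wf Pf Qf df where \<Phi>: "\<And>j. \<Phi> j (Wf j) (Pf j) (Qf j) (df j)" by metis
  have Wf: "openin (zar V) (Wf j)" "x \<in> Wf j" "Wf j \<subseteq> {z\<in>V. \<phi> z \<in> ?T}"
    and hp: "hpoly (df j) (Pf j)" "hpoly (df j) (Qf j)"
    and fr: "fraction_on (Wf j) (Pf j) (Qf j) (\<lambda>z. coord_ratio i j (\<phi> z))" for j
    using \<Phi>[of j] unfolding \<Phi>_def by blast+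
  define W0 where "W0 = (\<Inter>j\<in>{..n}. Wf j)"
  \<comment> \<open>The numerator of the \<open>j\<close>-th ratio times all other denominators:
    every entry then has degree \<open>\<Sum>l\<in>{..n}. df l\<close>, and the entries form a
    multiple of a vector \<open>b\<close> of \<open>\<phi> y\<close>, with factor
    \<open>(\<Prod>l\<in>{..n}. Qf l v) / b i\<close>.\<close>
  define R where "R j = (if j \<le> n then (\<lambda>v. Pf j v * (\<Prod>l\<in>{..n}-{j}. Qf l v)) else (\<lambda>v. 0))" for j
  have "openin (zar V) W0" unfolding W0_def by (rule openin_Inter) (auto simp: Wf)
  moreover have "x \<in> W0" using Wf(2) by (simp add: W0_def)
  moreover have "hpoly (\<Sum>l\<in>{..n}. df l) (R j)" for j
  proof (cases "j \<le> n")
    case True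
    have "hpoly (df j + (\<Sum>l\<in>{..n}-{j}. df l)) (\<lambda>v. Pf j v * (\<Prod>l\<in>{..n}-{j}. Qf l v))"
      using hp by (intro hpoly_mult hpoly_prod)
    then show ?thesis using True sum.remove[of "{..n}" j df] by (simp add: R_def)
  qed (auto simp: R_def)
  moreover have "represents_on W0 R \<phi>"
  proof (rule represents_onI)
    fix y v assume y: "y \<in> W0" and v: "v \<in> y"
    have yj: "y \<in> Wf j" if "j \<le> n" for j using y that by (auto simp: W0_def)
    from yj[of 0] Wf(3) have "\<phi> y \<in> ?T" by auto
    then have \<phi>y: "\<phi> y \<in> Pn n" "\<And>v. v \<in> \<phi> y \<Longrightarrow> v i \<noteq> 0" using W by auto
    then obtain b where b: "b \<in> \<phi> y" using PP_nonempty Pn_subset_PP by blast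
    then have bi: "b i \<noteq> 0" using \<phi>y(2) by blast
    have "R j v = ((\<Prod>l\<in>{..n}. Qf l v) / b i) * b j" for j
    proof (cases "j \<le> n")
      case True
      have "Qf j v \<noteq> 0" "coord_ratio i j (\<phi> y) = Pf j v / Qf j v"
        using fraction_onD[OF fr yj[OF True] v] by auto
      moreover have "coord_ratio i j (\<phi> y) = b j / b i"
        using b \<phi>y(1) Pn_subset_PP by (blast intro: coord_ratio_eq)
      moreover have "(\<Prod>l\<in>{..n}. Qf l v) = Qf j v * (\<Prod>l\<in>{..n}-{j}. Qf l v)"
        using True by (simp add: prod.remove)
      ultimately show ?thesis using True bi by (simp add: R_def field_simps)
    next
      case False
      then show ?thesis using Pn_rep(3)[OF \<phi>y(1) b, of j] by (simp add: R_def)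
    qed
    moreover have c: "(\<Prod>l\<in>{..n}. Qf l v) / b i \<noteq> 0"
      using bi fraction_onD(1)[OF fr yj v] by simp
    ultimately show "\<phi> y = pcls (\<lambda>i. R i v) \<and> (\<exists>i. R i v \<noteq> 0)"
      using pcls_scale[OF c, of b] Pn_rep(1)[OF \<phi>y(1) b] bi by auto
  qed
  ultimately show "locpoly_at V \<phi> x"
    by (rule locpoly_atI)
qed

text \<open>Forms and fractions on \<open>W\<close> become forms and fractions on \<open>V\<close>
  by substituting the local coordinates \<open>P\<close> of \<open>\<phi>\<close>.\<close>

lemma locpoly_imp_morphism:
  assumes \<phi>: "locpoly V \<phi>" and V: "V \<subseteq> PP" and W: "W \<subseteq> PP" and im: "\<phi> ` V \<subseteq> W"
  shows "morphism V W \<phi>"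
  unfolding morphism_def
proof (intro conjI allI impI)
  show "\<phi> ` V \<subseteq> W" by (rule im)
  have op: "openin (zar V) {x\<in>V. \<phi> x \<in> A}" if A: "openin (zar W) A" for A
  proof (subst openin_subopen, intro ballI)
    fix x assume x: "x \<in> {x\<in>V. \<phi> x \<in> A}"
    then have xV: "x \<in> V" by simp
    obtain W0 P d where *: "openin (zar V) W0" "x \<in> W0" "\<forall>i. hpoly d (P i)" "represents_on W0 P \<phi>"
      using locpolyE[OF \<phi> xV] .
    obtain F e where F: "hpoly e F" "\<forall>v\<in>\<phi> x. F v \<noteq> 0" "nonvanishing W F \<subseteq> A"
      using A x unfolding openin_zar_iff[OF W] by blast
    let ?T = "W0 \<inter> {y\<in>V. \<forall>v\<in>y. F (\<lambda>i. P i v) \<noteq> 0}"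
    have "openin (zar V) ?T"
      using *(1) openin_zar_nonzero[OF hpoly_subst[OF F(1) *(3)[THEN spec]] V] by (rule openin_Int)
    moreover have "x \<in> ?T" using *(2) xV F(2) represents_onD(3)[OF *(4,2)] by blast
    moreover have "?T \<subseteq> {x\<in>V. \<phi> x \<in> A}"
    proof
      fix y assume y: "y \<in> ?T"
      then obtain v where v: "v \<in> y" using V PP_nonempty by blast
      have "\<phi> y \<in> W" using y im by blast
      moreover have "F w \<noteq> 0" if "w \<in> \<phi> y" for w
        using hpoly_nonzero_rep[OF F(1) subsetD[OF W \<open>\<phi> y \<in> W\<close>] represents_onD(3)[OF *(4) _ v] that] y v
        by blast
      ultimately have "\<phi> y \<in> A" using F(3) by blast
      then show "y \<in> {x\<in>V. \<phi> x \<in> A}" using y by blast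
    qed
    ultimately show "\<exists>T. openin (zar V) T \<and> x \<in> T \<and> T \<subseteq> {x\<in>V. \<phi> x \<in> A}" by blast
  qed
  then show "continuous_map (zar V) (zar W) \<phi>"
    using im unfolding continuous_map topspace_zar[OF V] topspace_zar[OF W] by blast
  fix U f assume f: "regular W U f"
  show "regular V {x\<in>V. \<phi> x \<in> U} (\<lambda>x. f (\<phi> x))"
  proof (rule regularI)
    show "openin (zar V) {x\<in>V. \<phi> x \<in> U}" using f by (blast intro: op regular_openin)
    fix x assume x: "x \<in> {x\<in>V. \<phi> x \<in> U}"
    then have xV: "x \<in> V" and xU: "\<phi> x \<in> U" by auto
    obtain W0 P d where *: "openin (zar V) W0" "x \<in> W0" "\<forall>i. hpoly d (P i)" "represents_on W0 P \<phi>"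
      using locpolyE[OF \<phi> xV] .
    obtain W1 N D e where f1: "openin (zar W) W1" "\<phi> x \<in> W1" "W1 \<subseteq> U" "hpoly e N" "hpoly e D" "fraction_on W1 N D f"
      using regularE[OF f xU] .
    let ?T = "W0 \<inter> {y\<in>V. \<phi> y \<in> W1}"
    have "openin (zar V) ?T" using *(1) op[OF f1(1)] by (rule openin_Int)
    moreover have "x \<in> ?T" "?T \<subseteq> {x\<in>V. \<phi> x \<in> U}" using xV *(2) f1(2,3) by auto
    moreover have "fraction_on ?T (\<lambda>v. N (\<lambda>i. P i v)) (\<lambda>v. D (\<lambda>i. P i v)) (\<lambda>x. f (\<phi> x))"
      using fraction_onD[OF f1(6)] represents_onD(3)[OF *(4)] by (intro fraction_onI) auto
    ultimately show "\<exists>W P Q d. openin (zar V) W \<and> x \<in> W \<and> W \<subseteq> {x\<in>V. \<phi> x \<in> U} \<and>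
        hpoly d P \<and> hpoly d Q \<and> fraction_on W P Q (\<lambda>x. f (\<phi> x))"
      using hpoly_subst[OF f1(4) *(3)[THEN spec]] hpoly_subst[OF f1(5) *(3)[THEN spec]]
      by (intro exI conjI)
  qed
qed

text \<open>Not immediate from the definition, as a regular function on the smaller target
  \<open>W'\<close> need not be one on \<open>W\<close>; locally polynomial coordinates restrict to
  any subset.\<close>

lemma morphism_restrict:
  assumes "morphism V W \<phi>" "V \<subseteq> PP" "W \<subseteq> Pn n" "V' \<subseteq> V" "\<phi> ` V' \<subseteq> W'" "W' \<subseteq> PP"
  shows "morphism V' W' \<phi>"
  using locpoly_subset[OF morphism_imp_locpoly[OF assms(1-3)] assms(4)] assms(2,4,5,6)
  by (intro locpoly_imp_morphism) auto

lemma morphism_comp: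
  assumes "morphism A B \<phi>" "morphism B C \<psi>" shows "morphism A C (\<lambda>x. \<psi> (\<phi> x))"
proof -
  have *: "\<phi> ` A \<subseteq> B" "\<psi> ` B \<subseteq> C" using assms by (auto simp: morphism_def)
  have "regular A {x\<in>A. \<psi> (\<phi> x) \<in> U} (\<lambda>x. f (\<psi> (\<phi> x)))" if "regular C U f" for U f
  proof -
    have "regular B {x\<in>B. \<psi> x \<in> U} (\<lambda>x. f (\<psi> x))" using assms(2) that by (simp add: morphism_def)
    then have "regular A {x\<in>A. \<phi> x \<in> {x\<in>B. \<psi> x \<in> U}} (\<lambda>x. f (\<psi> (\<phi> x)))"
      using assms(1) unfolding morphism_def by blast
    moreover have "{x\<in>A. \<phi> x \<in> {x\<in>B. \<psi> x \<in> U}} = {x\<in>A. \<psi> (\<phi> x) \<in> U}" using *(1) by auto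
    ultimately show ?thesis by simp
  qed
  moreover have "continuous_map (zar A) (zar C) (\<lambda>x. \<psi> (\<phi> x))"
    using continuous_map_compose[of "zar A" "zar B" \<phi> "zar C" \<psi>] assms by (simp add: morphism_def o_def)
  moreover have "(\<lambda>x. \<psi> (\<phi> x)) ` A \<subseteq> C" using * by blast
  ultimately show ?thesis by (simp add: morphism_def)
qed

lemma morphism_preimage_open:
  assumes "morphism A B \<phi>" "openin (zar B) U" "A \<subseteq> PP"
  shows "openin (zar A) {x\<in>A. \<phi> x \<in> U}"
proof -
  have "continuous_map (zar A) (zar B) \<phi>" using assms(1) by (simp add: morphism_def)
  from openin_continuous_map_preimage[OF this assms(2)] show ?thesis
    unfolding topspace_zar[OF assms(3)] .
qed

lemma morphism_regular:
  assumes "morphism A B \<phi>" "regular B U f" shows "regular A {x\<in>A. \<phi> x \<in> U} (\<lambda>x. f (\<phi> x))"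
  using assms by (simp add: morphism_def)

lemma morphism_in: "morphism A B \<phi> \<Longrightarrow> x \<in> A \<Longrightarrow> \<phi> x \<in> B"
  by (auto simp: morphism_def)

lemma morphism_id:
  assumes "A \<subseteq> B" "B \<subseteq> PP" shows "morphism A B (\<lambda>x. x)"
proof (rule locpoly_imp_morphism)
  have PP: "A \<subseteq> PP" using assms by blast
  show "locpoly A (\<lambda>x. x)"
  proof (rule locpolyI)
    fix x assume x: "x \<in> A"
    have "represents_on A (\<lambda>i v. v i) (\<lambda>x. x)"
      using PP PP_rep by (intro represents_onI) blast
    moreover have "openin (zar A) A" by (rule openin_zar_self[OF PP])
    ultimately show "locpoly_at A (\<lambda>x. x) x"
      using x hpoly_var by (intro locpoly_atI[where P = "\<lambda>i v. v i"]) simp_all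
  qed
qed (use assms in auto)

text \<open>Separatedness: near a point where the maps differ, some 2 by 2 minor of their local
  coordinates stays nonzero. It yields openness of the set of points moved by an automorphism and
  closedness of fibre products.\<close>

lemma neq_open:
  assumes a: "locpoly V a" and b: "locpoly V b" and V: "V \<subseteq> PP"
  shows "openin (zar V) {x\<in>V. a x \<noteq> b x}"
proof (subst openin_subopen, intro ballI)
  fix x assume "x \<in> {x\<in>V. a x \<noteq> b x}"
  then have x: "x \<in> V" "a x \<noteq> b x" by auto
  obtain v where v: "v \<in> x" using x V PP_nonempty by blast
  obtain W P d where 1: "openin (zar V) W" "x \<in> W" "\<forall>i. hpoly d (P i)" "represents_on W P a"
    using locpolyE[OF a x(1)] .
  obtain W' Q e where 2: "openin (zar V) W'" "x \<in> W'" "\<forall>i. hpoly e (Q i)" "represents_on W' Q b"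
    using locpolyE[OF b x(1)] .
  obtain i j where ij: "P i v * Q j v \<noteq> P j v * Q i v"
    using pcls_eq_iff[of "\<lambda>i. P i v" _ "\<lambda>i. Q i v"] represents_onD(1,2)[OF 1(4,2) v]
      represents_onD(1,2)[OF 2(4,2) v] x(2) by metis
  define F where "F v = P i v * Q j v - P j v * Q i v" for v
  have F: "hpoly (d + e) F" unfolding F_def using 1(3) 2(3) by (intro hpoly_diff hpoly_mult) simp_all
  let ?T = "W \<inter> W' \<inter> nonvanishing V F"
  have "openin (zar V) ?T" using 1(1) 2(1) openin_zar_nonzero[OF F V] by blast
  moreover have "x \<in> ?T"
  proof -
    have "F v \<noteq> 0" using ij by (simp add: F_def)
    then show ?thesis using hpoly_nonzero_rep[OF F subsetD[OF V x(1)] v] 1(2) 2(2) x(1) by blast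
  qed
  moreover have "?T \<subseteq> {x\<in>V. a x \<noteq> b x}"
  proof
    fix y assume y: "y \<in> ?T"
    then obtain w where w: "w \<in> y" using V PP_nonempty by blast
    have ne: "P i w * Q j w \<noteq> P j w * Q i w" using y w by (auto simp: F_def)
    have yW: "y \<in> W" "y \<in> W'" using y by auto
    obtain k l where kl: "P k w \<noteq> 0" "Q l w \<noteq> 0"
      using represents_onD(2)[OF 1(4) yW(1) w] represents_onD(2)[OF 2(4) yW(2) w] by blast
    have "pcls (\<lambda>i. P i w) \<noteq> pcls (\<lambda>i. Q i w)"
      using pcls_eq_iff[of "\<lambda>i. P i w" k "\<lambda>i. Q i w" l] kl ne by blast
    then have "a y \<noteq> b y"
      using represents_onD(1)[OF 1(4) yW(1) w] represents_onD(1)[OF 2(4) yW(2) w] by simp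
    then show "y \<in> {x\<in>V. a x \<noteq> b x}" using y by blast
  qed
  ultimately show "\<exists>T. openin (zar V) T \<and> x \<in> T \<and> T \<subseteq> {x\<in>V. a x \<noteq> b x}" by blast
qed

section \<open>The Segre embedding and fibre products\<close>

lemma pcls_memI: "c \<noteq> 0 \<Longrightarrow> w = (\<lambda>i. c * v i) \<Longrightarrow> w \<in> pcls v"
  by (auto simp: mem_pcls)

lemma pcls_memE:
  assumes "w \<in> pcls v" obtains c where "c \<noteq> 0" "w = (\<lambda>i. c * v i)"
  using assms by (auto simp: mem_pcls)

definition segre_vec :: "(nat \<Rightarrow> 'k::field) \<Rightarrow> (nat \<Rightarrow> 'k) \<Rightarrow> nat \<Rightarrow> 'k" where
  "segre_vec v w = (\<lambda>k. v (fst (prod_decode k)) * w (snd (prod_decode k)))"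

lemma segre_vec_encode [simp]: "segre_vec v w (prod_encode (i, j)) = v i * w j"
  by (simp add: segre_vec_def)

lemma segre_vec_scale: "segre_vec (\<lambda>i. c * v i) (\<lambda>i. d * w i) = (\<lambda>k. (c * d) * segre_vec v w k)"
  by (simp add: segre_vec_def fun_eq_iff)

lemma segre_vec_scale_left: "segre_vec (\<lambda>i. c * v i) w = (\<lambda>k. c * segre_vec v w k)"
  by (simp add: segre_vec_def fun_eq_iff)

lemma segre_pcls: "segre (pcls v) (pcls w) = pcls (segre_vec v w)"
proof
  show "segre (pcls v) (pcls w) \<subseteq> pcls (segre_vec v w)"
  proof
    fix u assume "u \<in> segre (pcls v) (pcls w)"
    then obtain c d where "c \<noteq> 0" "d \<noteq> 0" "u = segre_vec (\<lambda>i. c * v i) (\<lambda>i. d * w i)"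
      unfolding segre_def mem_pcls segre_vec_def by blast
    then show "u \<in> pcls (segre_vec v w)" unfolding segre_vec_scale mem_pcls by (intro exI[of _ "c * d"]) simp
  qed
  show "pcls (segre_vec v w) \<subseteq> segre (pcls v) (pcls w)"
  proof
    fix u assume "u \<in> pcls (segre_vec v w)"
    then obtain c where "c \<noteq> 0" "u = (\<lambda>k. c * segre_vec v w k)" unfolding mem_pcls by blast
    then have "u = segre_vec (\<lambda>i. c * v i) w" "(\<lambda>i. c * v i) \<in> pcls v"
      by (auto simp: segre_vec_scale_left mem_pcls)
    moreover have "segre_vec (\<lambda>i. c * v i) w \<in> segre (pcls v) (pcls w)"
      unfolding segre_def segre_vec_def using \<open>(\<lambda>i. c * v i) \<in> pcls v\<close> pcls_self[of w]
      by (intro CollectI exI[of _ "\<lambda>i. c * v i"] exI[of _ w]) simp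
    ultimately show "u \<in> segre (pcls v) (pcls w)" by simp
  qed
qed

text \<open>The product vector is a matrix of rank one; its columns and rows recover the two factors
  up to scale.\<close>

lemma segre_inj:
  assumes "x \<in> PP" "y \<in> PP" "x' \<in> PP" "y' \<in> PP" "segre x y = segre x' y'"
  shows "x = x'" "y = y'"
proof -
  obtain v i where v: "x = pcls v" "v i \<noteq> 0" using assms(1) by (rule PP_cases)
  obtain w j where w: "y = pcls w" "w j \<noteq> 0" using assms(2) by (rule PP_cases)
  obtain v' i' where v': "x' = pcls v'" "v' i' \<noteq> 0" using assms(3) by (rule PP_cases)
  obtain w' j' where w': "y' = pcls w'" "w' j' \<noteq> 0" using assms(4) by (rule PP_cases)
  have "pcls (segre_vec v w) = pcls (segre_vec v' w')" using assms(5) by (simp add: v(1) w(1) v'(1) w'(1) segre_pcls)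
  then have "segre_vec v w \<in> pcls (segre_vec v' w')" using pcls_self by metis
  then obtain c where c: "c \<noteq> 0" "segre_vec v w = (\<lambda>k. c * segre_vec v' w' k)" unfolding mem_pcls by blast
  have eq: "v a * w b = c * (v' a * w' b)" for a b
    using fun_cong[OF c(2), of "prod_encode (a, b)"] by simp
  have nz: "v' i * w' j \<noteq> 0" using eq[of i j] v(2) w(2) by auto
  have "v = (\<lambda>a. (c * w' j / w j) * v' a)" using eq[of _ j] w(2) by (auto simp: field_simps)
  moreover have "w = (\<lambda>b. (c * v' i / v i) * w' b)" using eq[of i] v(2) by (auto simp: field_simps)
  ultimately have "v \<in> pcls v'" "w \<in> pcls w'"
    using nz c(1) v(2) w(2)
    by (auto intro: pcls_memI[of "c * w' j / w j"] pcls_memI[of "c * v' i / v i"])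
  then show "x = x'" "y = y'" using v(1) w(1) v'(1) w'(1) pcls_eqI by metis+
qed

definition segre_fst :: "'k::field pt \<Rightarrow> 'k pt" where
  "segre_fst c = (SOME x. x \<in> PP \<and> (\<exists>y\<in>PP. c = segre x y))"

definition segre_snd :: "'k::field pt \<Rightarrow> 'k pt" where
  "segre_snd c = (SOME y. y \<in> PP \<and> (\<exists>x\<in>PP. c = segre x y))"

lemma segre_fst_segre: "x \<in> PP \<Longrightarrow> y \<in> PP \<Longrightarrow> segre_fst (segre x y) = x"
  unfolding segre_fst_def by (rule some_equality) (use segre_inj(1) in blast)+

lemma segre_snd_segre: "x \<in> PP \<Longrightarrow> y \<in> PP \<Longrightarrow> segre_snd (segre x y) = y"
  unfolding segre_snd_def by (rule some_equality) (use segre_inj(2) in blast)+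

lemma segre_in_Pn:
  assumes "x \<in> Pn n" "y \<in> Pn m" and N: "\<And>i j. i \<le> n \<Longrightarrow> j \<le> m \<Longrightarrow> prod_encode (i, j) \<le> N"
  shows "segre x y \<in> Pn N"
proof -
  obtain v i where v: "x = pcls v" "v i \<noteq> 0" "\<forall>j>n. v j = 0" using assms(1) by (rule PnE)
  obtain w j where w: "y = pcls w" "w j \<noteq> 0" "\<forall>i>m. w i = 0" using assms(2) by (rule PnE)
  have "segre_vec v w k = 0" if "k > N" for k
  proof -
    obtain a b where k: "k = prod_encode (a, b)" by (metis prod_decode_inverse surj_pair)
    then have "a > n \<or> b > m" using N[of a b] that by fastforce
    then show ?thesis using v(3) w(3) by (auto simp: k)
  qed
  then show ?thesis
    unfolding v(1) w(1) segre_pcls using v(2) w(2) by (intro PnI[of _ "prod_encode (i, j)"]) auto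
qed

lemma ex_segre_bound: "\<exists>N::nat. \<forall>i\<le>n. \<forall>j\<le>m. prod_encode (i, j) \<le> N"
  by (rule exI[of _ "Max (prod_encode ` ({..n} \<times> {..m}))"]) auto

lemma prod_varietyE:
  assumes "c \<in> prod_variety V W"
  obtains x y where "x \<in> V" "y \<in> W" "c = segre x y"
  using assms unfolding prod_variety_def by blast

lemma prod_varietyI: "x \<in> V \<Longrightarrow> y \<in> W \<Longrightarrow> segre x y \<in> prod_variety V W"
  unfolding prod_variety_def by blast

lemma locpoly_segre:
  assumes a: "locpoly V a" and b: "locpoly V b"
  shows "locpoly V (\<lambda>x. segre (a x) (b x))"
proof (rule locpolyI)
  fix x assume x: "x \<in> V"
  obtain W P d where 1: "openin (zar V) W" "x \<in> W" "\<forall>i. hpoly d (P i)" "represents_on W P a"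
    using locpolyE[OF a x] .
  obtain W' Q e where 2: "openin (zar V) W'" "x \<in> W'" "\<forall>i. hpoly e (Q i)" "represents_on W' Q b"
    using locpolyE[OF b x] .
  let ?R = "\<lambda>k v. P (fst (prod_decode k)) v * Q (snd (prod_decode k)) v"
  have "represents_on (W \<inter> W') ?R (\<lambda>x. segre (a x) (b x))"
  proof (rule represents_onI)
    fix y v assume y: "y \<in> W \<inter> W'" and v: "v \<in> y"
    obtain i j where "P i v \<noteq> 0" "Q j v \<noteq> 0"
      using represents_onD(2)[OF 1(4) _ v] represents_onD(2)[OF 2(4) _ v] y by blast
    then have "segre_vec (\<lambda>i. P i v) (\<lambda>i. Q i v) (prod_encode (i, j)) \<noteq> 0" by simp
    moreover have "segre (a y) (b y) = pcls (segre_vec (\<lambda>i. P i v) (\<lambda>i. Q i v))"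
      using represents_onD(1)[OF 1(4) _ v] represents_onD(1)[OF 2(4) _ v] y by (simp add: segre_pcls)
    ultimately show "segre (a y) (b y) = pcls (\<lambda>k. ?R k v) \<and> (\<exists>k. ?R k v \<noteq> 0)"
      unfolding segre_vec_def by blast
  qed
  moreover have "hpoly (d + e) (?R k)" for k by (rule hpoly_mult[OF 1(3)[THEN spec] 2(3)[THEN spec]])
  ultimately show "locpoly_at V (\<lambda>x. segre (a x) (b x)) x"
    using openin_Int[OF 1(1) 2(1)] 1(2) 2(2) by (intro locpoly_atI[where P = ?R]) simp_all
qed

text \<open>Where the matrix entry \<open>(i, j)\<close> is nonzero, column \<open>j\<close>
  represents the first factor and row \<open>i\<close> the second, both linear in the
  coordinates.\<close>

lemma locpoly_seg:
  assumes S: "S \<subseteq> prod_variety PP PP" and PP: "S \<subseteq> PP"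
  shows "locpoly S segre_fst" "locpoly S segre_snd"
proof -
  have "\<exists>i j. (\<forall>u\<in>c. u (prod_encode (i, j)) \<noteq> 0) \<and>
      represents_on {c\<in>S. \<forall>u\<in>c. u (prod_encode (i, j)) \<noteq> 0} (\<lambda>k u. u (prod_encode (k, j))) segre_fst \<and>
      represents_on {c\<in>S. \<forall>u\<in>c. u (prod_encode (i, j)) \<noteq> 0} (\<lambda>k u. u (prod_encode (i, k))) segre_snd"
    if c: "c \<in> S" for c
  proof -
    obtain x y where xy: "x \<in> PP" "y \<in> PP" "c = segre x y" using S c by (blast elim: prod_varietyE)
    obtain v i where v: "x = pcls v" "v i \<noteq> 0" using xy(1) by (rule PP_cases)
    obtain w j where w: "y = pcls w" "w j \<noteq> 0" using xy(2) by (rule PP_cases)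
    have *: "segre_fst c' = pcls (\<lambda>k. u (prod_encode (k, j))) \<and> (\<exists>k. u (prod_encode (k, j)) \<noteq> 0) \<and>
        segre_snd c' = pcls (\<lambda>k. u (prod_encode (i, k))) \<and> (\<exists>k. u (prod_encode (i, k)) \<noteq> 0)"
      if c': "c' \<in> S" "u \<in> c'" "u (prod_encode (i, j)) \<noteq> 0" for c' u
    proof -
      obtain x' y' where xy': "x' \<in> PP" "y' \<in> PP" "c' = segre x' y'" using S c'(1) by (blast elim: prod_varietyE)
      obtain v' i' where v': "x' = pcls v'" "v' i' \<noteq> 0" using xy'(1) by (rule PP_cases)
      obtain w' j' where w': "y' = pcls w'" "w' j' \<noteq> 0" using xy'(2) by (rule PP_cases)
      obtain e where e: "e \<noteq> 0" "u = (\<lambda>k. e * segre_vec v' w' k)"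
        using c'(2) unfolding xy'(3) v'(1) w'(1) segre_pcls by (rule pcls_memE)
      have 1: "(\<lambda>k. u (prod_encode (k, j))) = (\<lambda>k. (e * w' j) * v' k)"
        and 2: "(\<lambda>k. u (prod_encode (i, k))) = (\<lambda>k. (e * v' i) * w' k)" by (auto simp: e(2))
      have "e * w' j \<noteq> 0" "e * v' i \<noteq> 0" using c'(3) by (auto simp: e(2))
      then have "pcls (\<lambda>k. u (prod_encode (k, j))) = x'" "pcls (\<lambda>k. u (prod_encode (i, k))) = y'"
        unfolding 1 2 v'(1) w'(1) using pcls_scale by blast+
      then show ?thesis using segre_fst_segre[OF xy'(1,2)] segre_snd_segre[OF xy'(1,2)] xy'(3) c'(3) by blast
    qed
    have "\<forall>u\<in>c. u (prod_encode (i, j)) \<noteq> 0"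
      unfolding xy(3) v(1) w(1) segre_pcls using v(2) w(2) by (auto simp: mem_pcls)
    with * show ?thesis unfolding represents_on_def by blast
  qed
  note chart = this
  have "locpoly_at S segre_fst c \<and> locpoly_at S segre_snd c" if c: "c \<in> S" for c
  proof -
    obtain i j where ij: "\<forall>u\<in>c. u (prod_encode (i, j)) \<noteq> 0"
      "represents_on {c\<in>S. \<forall>u\<in>c. u (prod_encode (i, j)) \<noteq> 0} (\<lambda>k u. u (prod_encode (k, j))) segre_fst"
      "represents_on {c\<in>S. \<forall>u\<in>c. u (prod_encode (i, j)) \<noteq> 0} (\<lambda>k u. u (prod_encode (i, k))) segre_snd"
      using chart[OF c] by (elim exE conjE)
    have op: "openin (zar S) {c\<in>S. \<forall>u\<in>c. u (prod_encode (i, j)) \<noteq> 0}"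
      by (rule openin_zar_nonzero[OF hpoly_var PP])
    have "c \<in> {c\<in>S. \<forall>u\<in>c. u (prod_encode (i, j)) \<noteq> 0}" using c ij(1) by blast
    then show ?thesis
      using locpoly_atI[OF op _ hpoly_var ij(2)] locpoly_atI[OF op _ hpoly_var ij(3)] by blast
  qed
  then show "locpoly S segre_fst" "locpoly S segre_snd" by (simp_all add: locpoly_def)
qed

text \<open>A point off the Segre variety either has a nonzero entry outside the block of indices up
  to \<open>n\<close> and \<open>m\<close>, or violates a 2 by 2 minor relation through a nonzero
  entry; in both cases a form vanishing on the variety separates it.\<close>

lemma closedin_segre:
  assumes N: "\<And>i j. i \<le> n \<Longrightarrow> j \<le> m \<Longrightarrow> prod_encode (i, j) \<le> N"
  shows "closedin (zar (Pn N)) (prod_variety (Pn n) (Pn m))" (is "closedin _ ?S")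
proof -
  have sub: "?S \<subseteq> Pn N" using segre_in_Pn[OF _ _ N] by (blast elim: prod_varietyE)
  have "openin (zar (Pn N)) (Pn N - ?S)"
    unfolding openin_zar_iff[OF Pn_subset_PP]
  proof (intro conjI ballI)
    fix c assume c: "c \<in> Pn N - ?S"
    then obtain u k where u: "c = pcls u" "u k \<noteq> 0" by (meson DiffD1 PnE)
    define i0 j0 where "i0 = fst (prod_decode k)" "j0 = snd (prod_decode k)"
    have k: "k = prod_encode (i0, j0)" by (simp add: i0_j0_def)
    have *: "\<exists>F d. hpoly d F \<and> (\<forall>v\<in>c. F v \<noteq> 0) \<and> {y\<in>Pn N. \<forall>v\<in>y. F v \<noteq> 0} \<subseteq> Pn N - ?S"
      if F: "hpoly d F" "F u \<noteq> 0"
        and 0: "\<And>v w. (\<And>i. i > n \<Longrightarrow> v i = 0) \<Longrightarrow> (\<And>j. j > m \<Longrightarrow> w j = 0) \<Longrightarrow> F (segre_vec v w) = 0" for F d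
    proof -
      have "\<forall>v\<in>c. F v \<noteq> 0"
        using hpoly_nonzero_rep[OF F(1), of c u] c F(2) pcls_self u(1) Pn_subset_PP by blast
      moreover have False if "y \<in> ?S" "\<forall>v\<in>y. F v \<noteq> 0" for y
      proof -
        obtain x z where xz: "x \<in> Pn n" "z \<in> Pn m" "y = segre x z" using \<open>y \<in> ?S\<close> by (rule prod_varietyE)
        obtain v i where v: "x = pcls v" "v i \<noteq> 0" "\<forall>i>n. v i = 0" using xz(1) by (rule PnE)
        obtain w j where w: "z = pcls w" "w j \<noteq> 0" "\<forall>i>m. w i = 0" using xz(2) by (rule PnE)
        have "segre_vec v w \<in> y" by (simp add: xz(3) v(1) w(1) segre_pcls)
        then show False using 0[of v w] v(3) w(3) that(2) by blast
      qed
      ultimately show ?thesis using F(1) by blast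
    qed
    show "\<exists>F d. hpoly d F \<and> (\<forall>v\<in>c. F v \<noteq> 0) \<and> {y\<in>Pn N. \<forall>v\<in>y. F v \<noteq> 0} \<subseteq> Pn N - ?S"
    proof (cases "\<exists>i j. (i > n \<or> j > m) \<and> u (prod_encode (i, j)) \<noteq> 0")
      case True
      then obtain i j where ij: "i > n \<or> j > m" "u (prod_encode (i, j)) \<noteq> 0" by blast
      show ?thesis by (rule *[OF hpoly_var ij(2)]) (use ij(1) in auto)
    next
      case van: False
      show ?thesis
      proof (cases "\<exists>i j. u (prod_encode (i, j)) * u k \<noteq> u (prod_encode (i, j0)) * u (prod_encode (i0, j))")
        case True
        then obtain i j where ij: "u (prod_encode (i, j)) * u k - u (prod_encode (i, j0)) * u (prod_encode (i0, j)) \<noteq> 0"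
          by auto
        have "hpoly (1 + 1) (\<lambda>u. u (prod_encode (i, j)) * u k - u (prod_encode (i, j0)) * u (prod_encode (i0, j)) :: 'a)"
          by (intro hpoly_diff hpoly_mult hpoly_var)
        then show ?thesis
          by (rule *[where F = "\<lambda>u. u (prod_encode (i, j)) * u k - u (prod_encode (i, j0)) * u (prod_encode (i0, j))"])
            (use ij in \<open>auto simp: k\<close>)
      next
        case False
        \<comment> \<open>Column and row through the nonzero entry \<open>u k\<close>: as all minors
          through it vanish, their product is \<open>u k\<close> times the whole matrix.\<close>
        define v w where "v = (\<lambda>i. u (prod_encode (i, j0)))" "w = (\<lambda>j. u (prod_encode (i0, j)))"
        have sg: "segre_vec v w l = u k * u l" for l
        proof -
          obtain a b where l: "l = prod_encode (a, b)" by (metis prod_decode_inverse surj_pair)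
          show ?thesis using False by (simp add: l v_w_def mult.commute)
        qed
        have "segre_vec v w = (\<lambda>l. u k * u l)" using sg by (rule ext)
        then have "c = pcls (segre_vec v w)" using pcls_scale[OF u(2), of u] u(1) by simp
        then have "c = segre (pcls v) (pcls w)" by (simp add: segre_pcls)
        moreover have "pcls v \<in> Pn n" using van u(2) by (intro PnI[of v i0]) (auto simp: v_w_def k)
        moreover have "pcls w \<in> Pn m" using van u(2) by (intro PnI[of w j0]) (auto simp: v_w_def k)
        ultimately show ?thesis using c prod_varietyI by blast
      qed
    qed
  qed auto
  then show ?thesis using sub by (simp add: closedin_def topspace_zar[OF Pn_subset_PP] del: topspace_subtopology)
qed

lemma closedin_preimage:
  assumes "morphism A B \<phi>" "closedin (zar B) Z" "A \<subseteq> PP"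
  shows "closedin (zar A) {x\<in>A. \<phi> x \<in> Z}"
proof -
  have "continuous_map (zar A) (zar B) \<phi>" using assms(1) by (simp add: morphism_def)
  from closedin_continuous_map_preimage[OF this assms(2)] show ?thesis
    unfolding topspace_zar[OF assms(3)] .
qed

lemma closedin_zar_subset: "closedin (zar V) Z \<Longrightarrow> Z \<subseteq> V"
  by (meson closedin_imp_subset)

lemma closedin_zar_trans:
  assumes "closedin (zar V) U" "closedin (zar U) W" shows "closedin (zar V) W"
proof -
  have "zar U = subtopology (zar V) U"
    using closedin_zar_subset[OF assms(1)] by (simp add: subtopology_subtopology inf.absorb2)
  then show ?thesis using closedin_trans_full[of "zar V" U W] assms by simp
qed

text \<open>The product of \<open>V\<close> and \<open>W\<close> is closed in the Segre variety as
  an intersection of preimages under the projections, and inside it the equaliser is the complement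
  of the open set from \<open>neq_open\<close>.\<close>

lemma closedin_fibre_product:
  fixes V W :: "'k::field pt set"
  assumes V: "closedin (zar (Pn n)) V" and W: "closedin (zar (Pn m)) W"
    and a: "morphism V (Pn r) a" and b: "morphism W (Pn r) b"
    and N: "\<And>i j. i \<le> n \<Longrightarrow> j \<le> m \<Longrightarrow> prod_encode (i, j) \<le> N"
  shows "closedin (zar (Pn N)) {segre x y | x y. x \<in> V \<and> y \<in> W \<and> a x = b y}"
proof -
  let ?S = "prod_variety (Pn n) (Pn m) :: 'k pt set"
  let ?T = "{c\<in>?S. segre_fst c \<in> V} \<inter> {c\<in>?S. segre_snd c \<in> W}"
  have SN: "closedin (zar (Pn N)) ?S" using N by (rule closedin_segre)
  have SPP: "?S \<subseteq> PP" using closedin_zar_subset[OF SN] Pn_subset_PP by blast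
  have S2: "?S \<subseteq> prod_variety PP PP" unfolding prod_variety_def using Pn_subset_PP by blast
  have s: "segre_fst (segre x y) = x" "segre_snd (segre x y) = y" if "x \<in> Pn n" "y \<in> Pn m" for x y :: "'k pt"
    using segre_fst_segre segre_snd_segre that Pn_subset_PP by blast+
  have "segre_fst ` ?S \<subseteq> Pn n" "segre_snd ` ?S \<subseteq> Pn m" using s unfolding prod_variety_def by auto
  then have m: "morphism ?S (Pn n) segre_fst" "morphism ?S (Pn m) segre_snd"
    using locpoly_imp_morphism[OF _ SPP Pn_subset_PP] locpoly_seg[OF S2 SPP] by blast+
  have T: "closedin (zar ?S) ?T"
    using closedin_preimage[OF m(1) V SPP] closedin_preimage[OF m(2) W SPP] by (rule closedin_Int)
  have TS: "?T \<subseteq> ?S" by blast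
  have TPP: "?T \<subseteq> PP" using SPP by blast
  have VP: "V \<subseteq> PP" "W \<subseteq> PP" using V W closedin_zar_subset Pn_subset_PP by blast+
  have "morphism ?T V segre_fst" "morphism ?T W segre_snd"
    by (rule morphism_restrict[OF m(1) SPP order.refl TS _ VP(1)] morphism_restrict[OF m(2) SPP order.refl TS _ VP(2)], blast)+
  then have "morphism ?T (Pn r) (\<lambda>c. a (segre_fst c))" "morphism ?T (Pn r) (\<lambda>c. b (segre_snd c))"
    using a b by (auto intro: morphism_comp)
  then have "locpoly ?T (\<lambda>c. a (segre_fst c))" "locpoly ?T (\<lambda>c. b (segre_snd c))"
    using morphism_imp_locpoly[OF _ TPP] by blast+
  from neq_open[OF this TPP] have "openin (zar ?T) {c\<in>?T. a (segre_fst c) \<noteq> b (segre_snd c)}" .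
  then have TC: "closedin (zar ?T) (?T - {c\<in>?T. a (segre_fst c) \<noteq> b (segre_snd c)})"
    using closedin_diff[OF closedin_topspace, of "zar ?T"] unfolding topspace_zar[OF TPP] by blast
  have eq: "?T - {c\<in>?T. a (segre_fst c) \<noteq> b (segre_snd c)} = {segre x y | x y. x \<in> V \<and> y \<in> W \<and> a x = b y}"
    (is "_ = ?C")
  proof
    show "?T - {c\<in>?T. a (segre_fst c) \<noteq> b (segre_snd c)} \<subseteq> ?C" 
    proof
      fix c assume c: "c \<in> ?T - {c\<in>?T. a (segre_fst c) \<noteq> b (segre_snd c)}"
      then have "c \<in> ?S" by blast
      then obtain x y where xy: "x \<in> Pn n" "y \<in> Pn m" "c = segre x y" by (rule prod_varietyE)
      with c s[OF xy(1,2)] show "c \<in> ?C" by auto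
    qed
    have "V \<subseteq> Pn n" "W \<subseteq> Pn m" using V W closedin_zar_subset by blast+
    then show "?C \<subseteq> ?T - {c\<in>?T. a (segre_fst c) \<noteq> b (segre_snd c)}"
      using s by (auto intro!: prod_varietyI simp: subset_iff)
  qed
  have TN: "closedin (zar (Pn N)) ?T"
    using SN T by (rule closedin_zar_trans)
  show ?thesis using closedin_zar_trans[OF TN TC] unfolding eq .
qed

section \<open>The projective line and the map tau\<close>

lemma P1_eq_iff:
  assumes "pcls v \<in> P1" "pcls w \<in> P1"
  shows "pcls v = pcls w \<longleftrightarrow> v 0 * w 1 = v 1 * w 0"
proof -
  have "\<exists>i. v i \<noteq> 0" "\<exists>i. w i \<noteq> 0" using assms Pn_rep(2) pcls_self by blast+
  then obtain k l where "v k \<noteq> 0" "w l \<noteq> 0" by blast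
  then have "pcls v = pcls w \<longleftrightarrow> (\<forall>i j. v i * w j = v j * w i)" by (rule pcls_eq_iff)
  also have "\<dots> \<longleftrightarrow> v 0 * w 1 = v 1 * w 0"
  proof (intro iffI allI)
    assume *: "v 0 * w 1 = v 1 * w 0"
    fix i j
    have "l = 0 \<or> l = 1 \<or> l > 1" for l :: nat by arith
    from this[of i] this[of j] show "v i * w j = v j * w i"
      using * Pn_rep(3)[OF assms(1) pcls_self] Pn_rep(3)[OF assms(2) pcls_self]
      by (auto simp: mult.commute)
  qed auto
  finally show ?thesis .
qed

lemma hpt_in_P1: "(s, t) \<noteq> (0, 0) \<Longrightarrow> hpt s t \<in> P1"
  unfolding hpt_def by (rule PnI[where i = "if s = 0 then 1 else 0"]) auto

lemma P1_hpt:
  assumes "q \<in> P1" obtains s t where "q = hpt s t" "(s, t) \<noteq> (0, 0)"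
proof -
  obtain v i where v: "q = pcls v" "v i \<noteq> 0" "\<forall>j>1. v j = 0" using assms by (rule PnE)
  have "v = (\<lambda>i. if i = 0 then v 0 else if i = 1 then v 1 else 0)"
    using v(3) by (auto simp: fun_eq_iff)
  then have "q = hpt (v 0) (v 1)" unfolding hpt_def v(1) by (rule arg_cong)
  moreover have "(v 0, v 1) \<noteq> (0, 0)" using v(2) v(3)[rule_format, of i] by (cases "i = 0"; cases "i = 1") auto
  ultimately show ?thesis using that by blast
qed

lemma hpt_eq_iff:
  assumes "(s, t) \<noteq> (0, 0)" "(s', t') \<noteq> (0, 0)"
  shows "hpt s t = hpt s' t' \<longleftrightarrow> s * t' = t * s'"
  using P1_eq_iff[OF hpt_in_P1[OF assms(1), unfolded hpt_def] hpt_in_P1[OF assms(2), unfolded hpt_def]]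
  by (simp add: hpt_def)

lemma tau_pcls: "tau (pcls v) = pcls (\<lambda>i. v i ^ 3)"
proof
  show "tau (pcls v) \<subseteq> pcls (\<lambda>i. v i ^ 3)"
  proof
    fix u assume "u \<in> tau (pcls v)"
    then obtain c e where "c \<noteq> 0" "e \<noteq> 0" "u = (\<lambda>i. c * (e * v i) ^ 3)"
      unfolding tau_def mem_pcls by blast
    then show "u \<in> pcls (\<lambda>i. v i ^ 3)"
      unfolding mem_pcls by (intro exI[of _ "c * e ^ 3"]) (auto simp: power_mult_distrib)
  qed
  show "pcls (\<lambda>i. v i ^ 3) \<subseteq> tau (pcls v)"
    unfolding tau_def pcls_def[of "\<lambda>i. v i ^ 3"] using pcls_self[of v] by blast
qed

lemma morphism_tau: "morphism P1 P1 (tau :: 'k::field pt \<Rightarrow> 'k pt)"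
proof (rule locpoly_imp_morphism)
  show "locpoly (P1 :: 'k pt set) tau"
  proof (rule locpolyI)
    fix x :: "'k pt" assume x: "x \<in> P1"
    have "represents_on P1 (\<lambda>i v. v i ^ 3) (tau :: 'k pt \<Rightarrow> 'k pt)"
      using Pn_rep(1,2) tau_pcls by (intro represents_onI) fastforce
    moreover have "hpoly (1 * 3) (\<lambda>v :: nat \<Rightarrow> 'k. v i ^ 3)" for i by (intro hpoly_power hpoly_var)
    moreover have "openin (zar P1) (P1 :: 'k pt set)" by (rule openin_zar_self[OF Pn_subset_PP])
    ultimately show "locpoly_at P1 tau x"
      using x by (intro locpoly_atI[where P = "\<lambda>i v. v i ^ 3"]) simp_all
  qed
  show "tau ` P1 \<subseteq> (P1 :: 'k pt set)"
  proof
    fix y :: "'k pt" assume "y \<in> tau ` P1"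
    then obtain x where x: "x \<in> P1" "y = tau x" by blast
    obtain v i where v: "x = pcls v" "v i \<noteq> 0" "\<forall>j>1. v j = 0" using x(1) by (rule PnE)
    show "y \<in> P1" unfolding x(2) v(1) tau_pcls using v(2,3) by (intro PnI[of _ i]) auto
  qed
qed (use Pn_subset_PP in auto)

text \<open>The map [s:t] to [s:ct]. For \<open>c\<close> a third root of unity these are the deck
  transformations of \<open>tau\<close>.\<close>

definition scale1 :: "'k::field \<Rightarrow> 'k pt \<Rightarrow> 'k pt" where
  "scale1 c x = (\<lambda>v i. if i = 1 then c * v i else v i) ` x"

lemma scale1_pcls: "scale1 c (pcls v) = pcls (\<lambda>i. if i = 1 then c * v i else v i)"
proof -
  have "(\<lambda>i. if i = 1 then c * (d * v i) else d * v i) = (\<lambda>i. d * (if i = 1 then c * v i else v i))" for d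
    by auto
  then show ?thesis unfolding scale1_def pcls_def image_Collect by (simp add: ex_simps(1)[symmetric] conj_commute cong: conj_cong)
qed

lemma morphism_scale1:
  assumes c: "c \<noteq> 0" shows "morphism P1 P1 (scale1 (c :: 'k::field))"
proof (rule locpoly_imp_morphism)
  have nz: "\<exists>i. (if i = 1 then c * v i else v i) \<noteq> 0" if "\<exists>i. v i \<noteq> 0" for v :: "nat \<Rightarrow> 'k"
    using that c by (metis mult_eq_0_iff)
  show "locpoly P1 (scale1 c)"
  proof (rule locpolyI)
    fix x :: "'k pt" assume x: "x \<in> P1"
    have "represents_on P1 (\<lambda>i v. if i = 1 then c * v i else v i) (scale1 c)"
    proof (rule represents_onI)
      fix y and v :: "nat \<Rightarrow> 'k" assume "y \<in> P1" "v \<in> y"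
      then show "scale1 c y = pcls (\<lambda>i. if i = 1 then c * v i else v i) \<and> (\<exists>i. (if i = 1 then c * v i else v i) \<noteq> 0)"
        using Pn_rep(1,2)[of y 1 v] nz[of v] scale1_pcls[of c v] by blast
    qed
    moreover have "hpoly 1 (\<lambda>v :: nat \<Rightarrow> 'k. if i = 1 then c * v i else v i)" for i
      by (cases "i = 1") (auto intro: hpoly_cmult hpoly_var simp flip: One_nat_def)
    moreover have "openin (zar P1) (P1 :: 'k pt set)" by (rule openin_zar_self[OF Pn_subset_PP])
    ultimately show "locpoly_at P1 (scale1 c) x"
      using x by (intro locpoly_atI)
  qed
  show "scale1 c ` P1 \<subseteq> P1"
  proof
    fix y assume "y \<in> scale1 c ` P1"
    then obtain v where v: "y = scale1 c (pcls v)" "\<exists>i. v i \<noteq> 0" "\<forall>i>1. v i = 0"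
      unfolding Pn_def by blast
    obtain i where "(if i = 1 then c * v i else v i) \<noteq> 0" using nz[OF v(2)] by blast
    then show "y \<in> P1" unfolding v(1) scale1_pcls using v(3) by (intro PnI[of _ i]) auto
  qed
qed (use Pn_subset_PP in auto)

text \<open>In coordinates the equation is \<open>a ^ 3 = b ^ 3\<close> for the two cross products,
  and each of the three linear factors of the difference of cubes gives one deck
  transformation.\<close>

lemma tau_eq_imp_scale1:
  fixes \<zeta> :: "'k::field"
  assumes \<zeta>: "1 + \<zeta> + \<zeta>\<^sup>2 = 0" and p: "p \<in> P1" and q: "q \<in> P1" and eq: "tau p = tau q"
  shows "q = scale1 1 p \<or> q = scale1 \<zeta> p \<or> q = scale1 (\<zeta>\<^sup>2) p"
proof -
  obtain v i where v: "p = pcls v" "v i \<noteq> 0" using p by (rule PnE)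
  obtain w j where w: "q = pcls w" "w j \<noteq> 0" using q by (rule PnE)
  have nz: "\<zeta> \<noteq> 0" using \<zeta> by auto
  have tp: "tau p \<in> P1" "tau q \<in> P1" using morphism_in[OF morphism_tau] p q by blast+
  have "v 0 ^ 3 * w 1 ^ 3 = v 1 ^ 3 * w 0 ^ 3"
    using eq tp P1_eq_iff unfolding v(1) w(1) tau_pcls by blast
  then have "(v 0 * w 1) ^ 3 - (v 1 * w 0) ^ 3 = 0" by (simp add: power_mult_distrib)
  \<comment> \<open>An identity in any commutative ring: the correction term is a multiple of
    \<open>1 + \<zeta> + \<zeta>\<^sup>2\<close>, so the defining relation of \<open>\<zeta>\<close>
    is the only one that enters.\<close>
  moreover have "(a - b) * ((a - \<zeta> * b) * (a - \<zeta>\<^sup>2 * b)) =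
      a ^ 3 - b ^ 3 - (1 + \<zeta> + \<zeta>\<^sup>2) * (a\<^sup>2 * b - \<zeta> * a * b\<^sup>2 + (\<zeta> - 1) * b ^ 3)" for a b
    by (simp add: algebra_simps power2_eq_square power3_eq_cube)
  ultimately have "(v 0 * w 1 - v 1 * w 0) *
      ((v 0 * w 1 - \<zeta> * (v 1 * w 0)) * (v 0 * w 1 - \<zeta>\<^sup>2 * (v 1 * w 0))) = 0"
    using \<zeta> by (metis diff_zero mult_zero_left)
  then have "v 0 * w 1 = v 1 * w 0 \<or> v 0 * w 1 = \<zeta> * v 1 * w 0 \<or> v 0 * w 1 = \<zeta>\<^sup>2 * v 1 * w 0"
    by (auto simp: mult.assoc)
  moreover have "scale1 c p = q \<longleftrightarrow> v 0 * w 1 = c * v 1 * w 0" if "c \<noteq> 0" for c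
    using P1_eq_iff[of "\<lambda>i. if i = 1 then c * v i else v i" w] morphism_in[OF morphism_scale1[OF that] p] q
    unfolding v(1) w(1) scale1_pcls by simp
  ultimately show ?thesis using nz by (metis mult_1 one_neq_zero power_not_zero)
qed

lemma locpoly_const:
  assumes "V \<subseteq> PP" "p \<in> PP" shows "locpoly V (\<lambda>_. p)"
proof (rule locpolyI)
  fix x assume x: "x \<in> V"
  obtain w i where w: "p = pcls w" "w i \<noteq> 0" using assms(2) by (rule PP_cases)
  have "openin (zar V) V" by (rule openin_zar_self[OF assms(1)])
  moreover have "represents_on V (\<lambda>i _. w i) (\<lambda>_. p)" using w by (intro represents_onI) auto
  ultimately show "locpoly_at V (\<lambda>_. p) x" using x hpoly_const by (intro locpoly_atI)
qed

lemma closedin_point: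
  assumes V: "V \<subseteq> Pn n" and p: "p \<in> V" shows "closedin (zar V) {p}"
proof -
  have PP: "V \<subseteq> PP" "p \<in> PP" using V p Pn_subset_PP by blast+
  have "openin (zar V) {x\<in>V. x \<noteq> p}"
    by (rule neq_open[OF morphism_imp_locpoly[OF morphism_id[OF order.refl PP(1)] PP(1) V]
          locpoly_const[OF PP] PP(1)])
  moreover have "{x\<in>V. x \<noteq> p} = V - {p}" by blast
  ultimately show ?thesis using p by (simp add: closedin_def topspace_zar[OF PP(1)] del: topspace_subtopology)
qed

lemma infinite_P1: "infinite (P1 :: 'k::field_char_0 pt set)"
proof -
  have "inj (\<lambda>t::'k. hpt 1 t)" by (auto simp: inj_def hpt_eq_iff)
  then have "infinite (range (\<lambda>t::'k. hpt 1 t))" using infinite_UNIV_char_0 finite_imageD by blast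
  moreover have "range (\<lambda>t::'k. hpt 1 t) \<subseteq> P1" by (rule image_subsetI, rule hpt_in_P1) simp
  ultimately show ?thesis using finite_subset by blast
qed

section \<open>Function fields\<close>

lemma ratfun_mem:
  "(U', f') \<in> ratfun V U f \<longleftrightarrow> U' \<noteq> {} \<and> regular V U' f' \<and> (\<forall>x\<in>U \<inter> U'. f' x = f x)"
  by (simp add: ratfun_def)

lemma ratfun_self: "U \<noteq> {} \<Longrightarrow> regular V U f \<Longrightarrow> (U, f) \<in> ratfun V U f"
  by (simp add: ratfun_mem)

locale irreducible_variety =
  fixes V :: "'k::field pt set"
  assumes irreducible: "irreducible_space (zar V)" and subset_PP: "V \<subseteq> PP"
begin

lemma nonempty: "V \<noteq> {}"
  using irreducible topspace_zar[OF subset_PP] by (auto simp: irreducible_space_def)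

lemma openin_self: "openin (zar V) V"
  by (rule openin_zar_self[OF subset_PP])

lemma opens_meet:
  "openin (zar V) A \<Longrightarrow> openin (zar V) B \<Longrightarrow> A \<noteq> {} \<Longrightarrow> B \<noteq> {} \<Longrightarrow> A \<inter> B \<noteq> {}"
  by (rule irreducible_opens_meet[OF irreducible])

lemma regular_meet:
  "regular V A f \<Longrightarrow> regular V B g \<Longrightarrow> A \<noteq> {} \<Longrightarrow> B \<noteq> {} \<Longrightarrow> A \<inter> B \<noteq> {}"
  by (rule opens_meet) (auto dest: regular_openin)

lemmas eq_dense = regular_eq_dense[OF irreducible subset_PP]

text \<open>A class consists of all regular functions compatible with one representative; the
  identity theorem carries compatibility over to another representative.\<close>

lemma ratfun_subset:
  assumes "regular V U f" "regular V U' f'" "U \<noteq> {}" "\<And>x. x \<in> U \<inter> U' \<Longrightarrow> f x = f' x"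
  shows "ratfun V U f \<subseteq> ratfun V U' f'"
proof (rule subrelI)
  fix A h assume "(A, h) \<in> ratfun V U f"
  then have A: "A \<noteq> {}" "regular V A h" "\<And>x. x \<in> U \<inter> A \<Longrightarrow> h x = f x" by (auto simp: ratfun_mem)
  have "h x = f' x" if "x \<in> A \<inter> U'" for x
    by (rule eq_dense[OF A(2) assms(2) regular_openin[OF assms(1)] assms(3) _ that])
      (use A(3) assms(4) in auto)
  then show "(A, h) \<in> ratfun V U' f'" using A(1,2) by (auto simp: ratfun_mem)
qed

lemma ratfun_eq_iff:
  assumes "regular V U f" "regular V U' f'" "U \<noteq> {}" "U' \<noteq> {}"
  shows "ratfun V U f = ratfun V U' f' \<longleftrightarrow> (\<forall>x\<in>U \<inter> U'. f x = f' x)"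
proof
  assume "ratfun V U f = ratfun V U' f'"
  then have "(U, f) \<in> ratfun V U' f'" using ratfun_self assms(1,3) by blast
  then show "\<forall>x\<in>U \<inter> U'. f x = f' x" by (auto simp: ratfun_mem)
next
  assume "\<forall>x\<in>U \<inter> U'. f x = f' x"
  then show "ratfun V U f = ratfun V U' f'"
    using ratfun_subset[OF assms(1,2,3)] ratfun_subset[OF assms(2,1,4)] by (metis Int_commute subset_antisym)
qed

text \<open>The operation is defined by compatibility with all pairs of representatives. Since the
  open sets involved are dense, testing a single pair suffices.\<close>

lemma ratfun_op_ratfun:
  assumes op: "\<And>A f B g. regular V A f \<Longrightarrow> regular V B g \<Longrightarrow> regular V (A \<inter> B) (\<lambda>x. opr (f x) (g x))"
    and f: "regular V U f" "U \<noteq> {}" and g: "regular V U' g" "U' \<noteq> {}"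
  shows "ratfun_op V opr (ratfun V U f) (ratfun V U' g) = ratfun V (U \<inter> U') (\<lambda>x. opr (f x) (g x))"
proof (intro equalityI subrelI)
  fix W h assume "(W, h) \<in> ratfun_op V opr (ratfun V U f) (ratfun V U' g)"
  then have W: "W \<noteq> {}" "regular V W h"
    and *: "\<forall>(U, f)\<in>ratfun V U f. \<forall>(U', f')\<in>ratfun V U' g. \<forall>x\<in>W \<inter> U \<inter> U'. h x = opr (f x) (f' x)"
    by (auto simp: ratfun_op_def)
  have "\<forall>x\<in>W \<inter> U \<inter> U'. h x = opr (f x) (g x)"
    using bspec[OF bspec[OF *[unfolded case_prod_unfold] ratfun_self[OF f(2,1)]] ratfun_self[OF g(2,1)]]
    by simp
  then show "(W, h) \<in> ratfun V (U \<inter> U') (\<lambda>x. opr (f x) (g x))" using W by (auto simp: ratfun_mem)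
next
  fix W h assume "(W, h) \<in> ratfun V (U \<inter> U') (\<lambda>x. opr (f x) (g x))"
  then have W: "W \<noteq> {}" "regular V W h" "\<And>x. x \<in> U \<inter> U' \<inter> W \<Longrightarrow> h x = opr (f x) (g x)"
    by (auto simp: ratfun_mem)
  have "h x = opr (p x) (q x)"
    if "(A, p) \<in> ratfun V U f" "(B, q) \<in> ratfun V U' g" "x \<in> W \<inter> A \<inter> B" for A p B q x
  proof -
    have A: "regular V A p" "\<And>x. x \<in> U \<inter> A \<Longrightarrow> p x = f x" using that(1) by (auto simp: ratfun_mem)
    have B: "regular V B q" "\<And>x. x \<in> U' \<inter> B \<Longrightarrow> q x = g x" using that(2) by (auto simp: ratfun_mem)
    have "openin (zar V) (U \<inter> U')" using f(1) g(1) by (auto dest: regular_openin)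
    moreover have "U \<inter> U' \<noteq> {}" using regular_meet f g by blast
    ultimately show ?thesis
      by (rule eq_dense[OF W(2) op[OF A(1) B(1)]]) (use A(2) B(2) W(3) that(3) in auto)
  qed
  then show "(W, h) \<in> ratfun_op V opr (ratfun V U f) (ratfun V U' g)"
    using W(1,2) unfolding ratfun_op_def by auto
qed

lemma function_field_cases:
  assumes "a \<in> carrier (function_field V)"
  obtains U f where "U \<noteq> {}" "regular V U f" "a = ratfun V U f"
  using assms by (auto simp: function_field_def)

lemma function_field_mult:
  assumes "regular V U f" "U \<noteq> {}" "regular V U' g" "U' \<noteq> {}"
  shows "ratfun V U f \<otimes>\<^bsub>function_field V\<^esub> ratfun V U' g = ratfun V (U \<inter> U') (\<lambda>x. f x * g x)"
proof -
  have "mult (function_field V) = ratfun_op V (*)" by (simp add: function_field_def)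
  moreover have "ratfun_op V (*) (ratfun V U f) (ratfun V U' g) = ratfun V (U \<inter> U') (\<lambda>x. f x * g x)"
    by (rule ratfun_op_ratfun[OF _ assms]) (rule regular_mult)
  ultimately show ?thesis by (simp only:)
qed

lemma function_field_add:
  assumes "regular V U f" "U \<noteq> {}" "regular V U' g" "U' \<noteq> {}"
  shows "ratfun V U f \<oplus>\<^bsub>function_field V\<^esub> ratfun V U' g = ratfun V (U \<inter> U') (\<lambda>x. f x + g x)"
proof -
  have "add (function_field V) = ratfun_op V (+)" by (simp add: function_field_def)
  moreover have "ratfun_op V (+) (ratfun V U f) (ratfun V U' g) = ratfun V (U \<inter> U') (\<lambda>x. f x + g x)"
    by (rule ratfun_op_ratfun[OF _ assms]) (rule regular_add)
  ultimately show ?thesis by (simp only:)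
qed

end

text \<open>Pullback along a rational map: \<open>\<Psi>\<close> has meaning only on the open set
  \<open>U\<close>, while the resulting functions may live on larger parts of \<open>X\<close>. For
  \<open>U = X\<close> it is \<open>ratfun_pullback\<close>.\<close>

definition partial_pullback :: "'k::field pt set \<Rightarrow> 'k pt set \<Rightarrow> ('k pt \<Rightarrow> 'k pt) \<Rightarrow>
    'k ratfun \<Rightarrow> 'k ratfun" where
  "partial_pullback X U \<Psi> a = {(W, h). W \<noteq> {} \<and> regular X W h \<and>
     (\<forall>(V, f)\<in>a. \<forall>x\<in>W \<inter> U. \<Psi> x \<in> V \<longrightarrow> h x = f (\<Psi> x))}"

lemma ratfun_pullback_partial: "ratfun_pullback V \<phi> a = partial_pullback V V \<phi> a"
proof -
  have "W \<inter> V = W" if "regular V W h" for W h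
    using openin_zar_subset[OF regular_openin[OF that]] by blast
  then show ?thesis unfolding ratfun_pullback_def partial_pullback_def by (auto cong: conj_cong)
qed

locale dominant_map =
  X: irreducible_variety X + C: irreducible_variety C for X C :: "'k::field pt set" +
  fixes U :: "'k pt set" and \<Psi> :: "'k pt \<Rightarrow> 'k pt"
  assumes U: "openin (zar X) U" and \<Psi>: "morphism U C \<Psi>"
    and dominant: "\<And>V. openin (zar C) V \<Longrightarrow> V \<noteq> {} \<Longrightarrow> \<exists>x\<in>U. \<Psi> x \<in> V"
begin

lemma pullback_regular:
  assumes "regular C V f" shows "regular X {x\<in>U. \<Psi> x \<in> V} (\<lambda>x. f (\<Psi> x))"
  using regular_open_subvariety[OF U morphism_regular[OF \<Psi> assms]] .

lemma pullback_nonempty: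
  assumes "regular C V f" "V \<noteq> {}" shows "{x\<in>U. \<Psi> x \<in> V} \<noteq> {}"
  using dominant[OF regular_openin[OF assms(1)] assms(2)] by blast

lemma partial_pullback_ratfun:
  assumes f: "regular C V f" "V \<noteq> {}"
  shows "partial_pullback X U \<Psi> (ratfun C V f) = ratfun X {x\<in>U. \<Psi> x \<in> V} (\<lambda>x. f (\<Psi> x))"
proof (intro equalityI subrelI)
  fix W h assume "(W, h) \<in> partial_pullback X U \<Psi> (ratfun C V f)"
  then have W: "W \<noteq> {}" "regular X W h"
    and *: "\<forall>(V, f)\<in>ratfun C V f. \<forall>x\<in>W \<inter> U. \<Psi> x \<in> V \<longrightarrow> h x = f (\<Psi> x)"
    by (auto simp: partial_pullback_def)
  have "\<forall>x\<in>W \<inter> U. \<Psi> x \<in> V \<longrightarrow> h x = f (\<Psi> x)"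
    using bspec[OF *[unfolded case_prod_unfold] ratfun_self[OF f(2,1)]] by simp
  then show "(W, h) \<in> ratfun X {x\<in>U. \<Psi> x \<in> V} (\<lambda>x. f (\<Psi> x))" using W by (auto simp: ratfun_mem)
next
  fix W h assume "(W, h) \<in> ratfun X {x\<in>U. \<Psi> x \<in> V} (\<lambda>x. f (\<Psi> x))"
  then have W: "W \<noteq> {}" "regular X W h" "\<And>x. x \<in> U \<Longrightarrow> \<Psi> x \<in> V \<Longrightarrow> x \<in> W \<Longrightarrow> h x = f (\<Psi> x)"
    by (auto simp: ratfun_mem)
  have "h x = p (\<Psi> x)" if "(A, p) \<in> ratfun C V f" "x \<in> W \<inter> U" "\<Psi> x \<in> A" for A p x
  proof -
    have A: "regular C A p" "\<And>y. y \<in> V \<inter> A \<Longrightarrow> p y = f y" using that(1) by (auto simp: ratfun_mem)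
    show ?thesis
      by (rule X.eq_dense[OF W(2) pullback_regular[OF A(1)] regular_openin[OF pullback_regular[OF f(1)]]
            pullback_nonempty[OF f]]) (use A(2) W(3) that(2,3) in auto)
  qed
  then show "(W, h) \<in> partial_pullback X U \<Psi> (ratfun C V f)"
    using W(1,2) unfolding partial_pullback_def by auto
qed

text \<open>Density of the image already gives a well-defined injective homomorphism; only
  surjectivity has to be supplied, and it is asked for in terms of single representatives.\<close>

lemma partial_pullback_ring_iso:
  assumes surj: "\<And>V f. regular X V f \<Longrightarrow> V \<noteq> {} \<Longrightarrow>
    \<exists>V' f'. regular C V' f' \<and> V' \<noteq> {} \<and> (\<forall>x\<in>V. x \<in> U \<longrightarrow> \<Psi> x \<in> V' \<longrightarrow> f x = f' (\<Psi> x))"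
  shows "partial_pullback X U \<Psi> \<in> ring_iso (function_field C) (function_field X)"
proof -
  let ?p = "\<lambda>V. {x\<in>U. \<Psi> x \<in> V}"
  have Int: "?p V \<inter> ?p V' = ?p (V \<inter> V')" for V V' by blast
  have hom: "partial_pullback X U \<Psi> \<in> ring_hom (function_field C) (function_field X)"
  proof (rule ring_hom_memI)
    fix a assume "a \<in> carrier (function_field C)"
    then obtain V f where a: "V \<noteq> {}" "regular C V f" "a = ratfun C V f" by (rule C.function_field_cases)
    show "partial_pullback X U \<Psi> a \<in> carrier (function_field X)"
      using pullback_regular[OF a(2)] pullback_nonempty[OF a(2,1)]
      unfolding a(3) partial_pullback_ratfun[OF a(2,1)] function_field_def by auto
    fix b assume "b \<in> carrier (function_field C)"
    then obtain V' f' where b: "V' \<noteq> {}" "regular C V' f'" "b = ratfun C V' f'" by (rule C.function_field_cases)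
    have ne: "V \<inter> V' \<noteq> {}" using C.regular_meet[OF a(2) b(2) a(1) b(1)] .
    note pa = pullback_regular[OF a(2)] pullback_nonempty[OF a(2,1)]
    note pb = pullback_regular[OF b(2)] pullback_nonempty[OF b(2,1)]
    show "partial_pullback X U \<Psi> (a \<otimes>\<^bsub>function_field C\<^esub> b) =
      partial_pullback X U \<Psi> a \<otimes>\<^bsub>function_field X\<^esub> partial_pullback X U \<Psi> b"
      unfolding a(3) b(3) C.function_field_mult[OF a(2,1) b(2,1)] partial_pullback_ratfun[OF a(2,1)]
        partial_pullback_ratfun[OF b(2,1)] X.function_field_mult[OF pa pb] Int
      by (rule partial_pullback_ratfun[OF regular_mult[OF a(2) b(2)] ne])
    show "partial_pullback X U \<Psi> (a \<oplus>\<^bsub>function_field C\<^esub> b) =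
      partial_pullback X U \<Psi> a \<oplus>\<^bsub>function_field X\<^esub> partial_pullback X U \<Psi> b"
      unfolding a(3) b(3) C.function_field_add[OF a(2,1) b(2,1)] partial_pullback_ratfun[OF a(2,1)]
        partial_pullback_ratfun[OF b(2,1)] X.function_field_add[OF pa pb] Int
      by (rule partial_pullback_ratfun[OF regular_add[OF a(2) b(2)] ne])
  next
    have one: "regular C C (\<lambda>_. 1)" "regular X X (\<lambda>_. 1)"
      using C.openin_self X.openin_self by (auto intro: regular_const)
    have "ratfun X (?p C) (\<lambda>_. 1) = ratfun X X (\<lambda>_. 1)"
      using X.ratfun_eq_iff[OF pullback_regular[OF one(1)] one(2) pullback_nonempty[OF one(1) C.nonempty] X.nonempty]
      by simp
    then show "partial_pullback X U \<Psi> \<one>\<^bsub>function_field C\<^esub> = \<one>\<^bsub>function_field X\<^esub>"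
      using partial_pullback_ratfun[OF one(1) C.nonempty] by (simp add: function_field_def)
  qed
  have inj: "inj_on (partial_pullback X U \<Psi>) (carrier (function_field C))"
  proof (rule inj_onI)
    fix a b assume "a \<in> carrier (function_field C)" "b \<in> carrier (function_field C)"
      and eq: "partial_pullback X U \<Psi> a = partial_pullback X U \<Psi> b"
    from this(1) obtain V f where a: "V \<noteq> {}" "regular C V f" "a = ratfun C V f" by (rule C.function_field_cases)
    from \<open>b \<in> _\<close> obtain V' f' where b: "V' \<noteq> {}" "regular C V' f'" "b = ratfun C V' f'" by (rule C.function_field_cases)
    have *: "\<forall>x\<in>?p V \<inter> ?p V'. f (\<Psi> x) = f' (\<Psi> x)"
      using eq X.ratfun_eq_iff[OF pullback_regular[OF a(2)] pullback_regular[OF b(2)]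
          pullback_nonempty[OF a(2,1)] pullback_nonempty[OF b(2,1)]]
      unfolding a(3) b(3) partial_pullback_ratfun[OF a(2,1)] partial_pullback_ratfun[OF b(2,1)] by blast
    have "{y\<in>V \<inter> V'. f y \<noteq> f' y} = {}"
    proof (rule ccontr)
      assume "{y\<in>V \<inter> V'. f y \<noteq> f' y} \<noteq> {}"
      from dominant[OF regular_neq_open[OF a(2) b(2) C.subset_PP] this] * show False by blast
    qed
    then show "a = b" unfolding a(3) b(3) using C.ratfun_eq_iff[OF a(2) b(2) a(1) b(1)] by blast
  qed
  have "carrier (function_field X) \<subseteq> partial_pullback X U \<Psi> ` carrier (function_field C)"
  proof
    fix a assume "a \<in> carrier (function_field X)"
    then obtain V f where a: "V \<noteq> {}" "regular X V f" "a = ratfun X V f" by (rule X.function_field_cases)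
    obtain V' f' where c: "regular C V' f'" "V' \<noteq> {}" "\<forall>x\<in>V. x \<in> U \<longrightarrow> \<Psi> x \<in> V' \<longrightarrow> f x = f' (\<Psi> x)"
      using surj[OF a(2,1)] by (elim exE conjE)
    have "partial_pullback X U \<Psi> (ratfun C V' f') = a"
      unfolding a(3) partial_pullback_ratfun[OF c(1,2)]
        X.ratfun_eq_iff[OF pullback_regular[OF c(1)] a(2) pullback_nonempty[OF c(1,2)] a(1)]
      using c(3) by auto
    moreover have "ratfun C V' f' \<in> carrier (function_field C)" using c(1,2) by (auto simp: function_field_def)
    ultimately show "a \<in> partial_pullback X U \<Psi> ` carrier (function_field C)" by blast
  qed
  moreover have "partial_pullback X U \<Psi> ` carrier (function_field C) \<subseteq> carrier (function_field X)"
    using ring_hom_closed[OF hom] by blast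
  ultimately show ?thesis
    using hom inj by (auto simp: ring_iso_def bij_betw_def)
qed

text \<open>Linearity over the function field of the base: both sides pull back the same function,
  along maps that agree on the dense set \<open>U\<close>.\<close>

lemma partial_pullback_base:
  assumes g: "dominant_map C B C g" and E: "dominant_map X B X E"
    and eq: "\<And>x. x \<in> U \<Longrightarrow> g (\<Psi> x) = E x" and a: "a \<in> carrier (function_field B)"
  shows "partial_pullback X U \<Psi> (ratfun_pullback C g a) = ratfun_pullback X E a"
proof -
  interpret g: dominant_map C B C g by (rule g)
  interpret E: dominant_map X B X E by (rule E)
  obtain V f where V: "V \<noteq> {}" "regular B V f" "a = ratfun B V f"
    using a by (rule g.C.function_field_cases)
  note 1 = g.pullback_regular[OF V(2)] g.pullback_nonempty[OF V(2,1)]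
  show ?thesis
    unfolding ratfun_pullback_partial V(3) g.partial_pullback_ratfun[OF V(2,1)]
      E.partial_pullback_ratfun[OF V(2,1)] partial_pullback_ratfun[OF 1]
      X.ratfun_eq_iff[OF pullback_regular[OF 1(1)] E.pullback_regular[OF V(2)]
        pullback_nonempty[OF 1] E.pullback_nonempty[OF V(2,1)]]
    using eq by auto
qed

end

lemma dominant_mapI_surj:
  assumes "irreducible_variety X" "irreducible_variety C" "morphism X C \<phi>" "\<phi> ` X = C"
  shows "dominant_map X C X \<phi>"
proof -
  interpret X: irreducible_variety X by fact
  interpret C: irreducible_variety C by fact
  show ?thesis
  proof
    show "openin (zar X) X" by (rule X.openin_self)
    show "\<exists>x\<in>X. \<phi> x \<in> V" if "openin (zar C) V" "V \<noteq> {}" for V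
      using openin_zar_subset[OF that(1)] that(2) assms(4) by blast
  qed fact
qed

section \<open>The blow-up away from its centre\<close>

lemma open_in_closed_quasi_projective:
  assumes X: "closedin (zar (Pn n)) X" "irreducible_space (zar X)"
    and U: "openin (zar X) U" "U \<noteq> {}"
  shows "quasi_projective_variety U"
proof -
  obtain T where T: "openin zariski T" "U = T \<inter> X" using U(1) by (auto simp: openin_subtopology)
  have "openin (zar (Pn n)) (T \<inter> Pn n)" using T(1) by (auto simp: openin_subtopology)
  moreover have "U = (T \<inter> Pn n) \<inter> X" using T(2) closedin_zar_subset[OF X(1)] by blast
  ultimately show ?thesis
    using X(1) irreducible_open_subset[OF X(2) U] unfolding quasi_projective_variety_def
    by (intro conjI exI[of _ n] exI[of _ "T \<inter> Pn n"] exI[of _ X])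
qed

lemma eq_nearI:
  assumes "Y \<subseteq> PP" "y \<in> Y" "\<And>z. z \<in> Y \<Longrightarrow> p z = q z" shows "eq_near Y y p q"
  using openin_zar_self[OF assms(1)] assms(2,3) unfolding eq_near_def by (intro exI[of _ Y]) simp

lemma regular_at_const: "Y \<subseteq> PP \<Longrightarrow> y \<in> Y \<Longrightarrow> regular_at Y y (\<lambda>_. c)"
  using openin_zar_self regular_const unfolding regular_at_def by blast

lemma regular_atI: "regular V U f \<Longrightarrow> x \<in> U \<Longrightarrow> regular_at V x f"
  unfolding regular_at_def by blast

lemma regular_at_morphism:
  assumes "morphism Y X \<phi>" "regular X A f" "y \<in> Y" "\<phi> y \<in> A"
  shows "regular_at Y y (\<lambda>z. f (\<phi> z))"
  by (rule regular_atI[OF morphism_regular[OF assms(1,2)]]) (use assms in simp)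

text \<open>The stalk of the inverse image ideal at \<open>y\<close> is generated by the pullback of
  one section; invertibility is always established in this way below.\<close>

abbreviation principal_at :: "'k::field pt set \<Rightarrow> 'k pt set \<Rightarrow> 'k pt set \<Rightarrow> ('k pt \<Rightarrow> 'k pt) \<Rightarrow>
    'k pt \<Rightarrow> bool" where
  "principal_at X Z Y \<phi> y \<equiv> (\<exists>A f. \<phi> y \<in> A \<and> ideal_section X Z A f \<and>
     \<not> eq_near Y y (\<lambda>z. f (\<phi> z)) (\<lambda>_. 0) \<and>
     (\<forall>A' f'. \<phi> y \<in> A' \<and> ideal_section X Z A' f' \<longrightarrow>
       (\<exists>g. regular_at Y y g \<and> eq_near Y y (\<lambda>z. f' (\<phi> z)) (\<lambda>z. g z * f (\<phi> z)))))"

lemma invertible_inverse_imageI: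
  assumes Y: "Y \<subseteq> PP" and \<phi>: "morphism Y X \<phi>"
    and gen: "\<And>y. y \<in> Y \<Longrightarrow> principal_at X Z Y \<phi> y"
  shows "invertible_inverse_image X Z Y \<phi>"
  unfolding invertible_inverse_image_def
proof (rule ballI)
  fix y assume y: "y \<in> Y"
  obtain A f where A: "\<phi> y \<in> A" "ideal_section X Z A f"
    and ne: "\<not> eq_near Y y (\<lambda>z. f (\<phi> z)) (\<lambda>_. 0)"
    and div: "\<forall>A' f'. \<phi> y \<in> A' \<and> ideal_section X Z A' f' \<longrightarrow>
        (\<exists>g. regular_at Y y g \<and> eq_near Y y (\<lambda>z. f' (\<phi> z)) (\<lambda>z. g z * f (\<phi> z)))"
    using gen[OF y] by (elim exE conjE)
  have "regular_at Y y (\<lambda>z. f (\<phi> z))"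
    using A(2) by (intro regular_at_morphism[OF \<phi> _ y A(1)]) (simp add: ideal_section_def)
  moreover have "\<exists>(n::nat) U fs g. \<phi> y \<in> U \<and> (\<forall>i<n. ideal_section X Z U (fs i) \<and> regular_at Y y (g i)) \<and>
           eq_near Y y (\<lambda>z. f (\<phi> z)) (\<lambda>z. \<Sum>i<n. g i z * fs i (\<phi> z))"
  proof (intro exI conjI)
    show "\<phi> y \<in> A" by (rule A)
    show "\<forall>i<Suc 0. ideal_section X Z A ((\<lambda>_. f) i) \<and> regular_at Y y ((\<lambda>_ _. 1) i)"
      using A(2) regular_at_const[OF Y y] by simp
    show "eq_near Y y (\<lambda>z. f (\<phi> z)) (\<lambda>z. \<Sum>i<Suc 0. (\<lambda>_ _. 1) i z * (\<lambda>_. f) i (\<phi> z))"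
      by (rule eq_nearI[OF Y y]) simp
  qed
  ultimately show "\<exists>h. regular_at Y y h \<and> \<not> eq_near Y y h (\<lambda>_. 0) \<and>
        (\<forall>U f. \<phi> y \<in> U \<and> ideal_section X Z U f \<longrightarrow>
           (\<exists>g. regular_at Y y g \<and> eq_near Y y (\<lambda>z. f (\<phi> z)) (\<lambda>z. g z * h z))) \<and>
        (\<exists>(n::nat) U f g. \<phi> y \<in> U \<and>
           (\<forall>i<n. ideal_section X Z U (f i) \<and> regular_at Y y (g i)) \<and>
           eq_near Y y h (\<lambda>z. \<Sum>i<n. g i z * f i (\<phi> z)))"
    using ne div by (intro exI[of _ "\<lambda>z. f (\<phi> z)"]) simp
qed

text \<open>Away from the centre the ideal contains 1, which generates every stalk.\<close>

lemma invertible_inverse_image_off_centre: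
  assumes Y: "Y \<subseteq> PP" and \<phi>: "morphism Y X \<phi>" and U: "openin (zar X) U" "U \<inter> Z = {}"
    and im: "\<And>y. y \<in> Y \<Longrightarrow> \<phi> y \<in> U"
  shows "invertible_inverse_image X Z Y \<phi>"
proof (rule invertible_inverse_imageI[OF Y \<phi>])
  fix y assume y: "y \<in> Y"
  have "ideal_section X Z U (\<lambda>_. 1)" unfolding ideal_section_def using regular_const[OF U(1)] U(2) by auto
  moreover have "\<not> eq_near Y y (\<lambda>_. 1) (\<lambda>_. 0)" unfolding eq_near_def by auto
  moreover have "\<forall>A' f'. \<phi> y \<in> A' \<and> ideal_section X Z A' f' \<longrightarrow>
      (\<exists>g. regular_at Y y g \<and> eq_near Y y (\<lambda>z. f' (\<phi> z)) (\<lambda>z. g z * 1))"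
  proof (intro allI impI exI conjI)
    fix A' f' assume *: "\<phi> y \<in> A' \<and> ideal_section X Z A' f'"
    show "regular_at Y y (\<lambda>z. f' (\<phi> z))"
      using * by (intro regular_at_morphism[OF \<phi> _ y]) (auto simp: ideal_section_def)
    show "eq_near Y y (\<lambda>z. f' (\<phi> z)) (\<lambda>z. f' (\<phi> z) * 1)" by (rule eq_nearI[OF Y y]) simp
  qed
  ultimately show "principal_at X Z Y \<phi> y"
    using im[OF y] by (intro exI[of _ U] exI[of _ "\<lambda>_. 1"]) simp
qed

lemma blow_up_universal:
  assumes "blow_up X Z Y \<eta>" "quasi_projective_variety Y'" "morphism Y' X \<phi>"
    "invertible_inverse_image X Z Y' \<phi>"
  obtains \<psi> where "morphism Y' Y \<psi>" "\<forall>y\<in>Y'. \<eta> (\<psi> y) = \<phi> y"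
    "\<forall>\<psi>'. morphism Y' Y \<psi>' \<and> (\<forall>y\<in>Y'. \<eta> (\<psi>' y) = \<phi> y) \<longrightarrow> (\<forall>y\<in>Y'. \<psi>' y = \<psi> y)"
proof -
  have "\<forall>Y' \<phi>. quasi_projective_variety Y' \<and> morphism Y' X \<phi> \<and>
        invertible_inverse_image X Z Y' \<phi> \<longrightarrow>
        (\<exists>\<psi>. morphism Y' Y \<psi> \<and> (\<forall>y\<in>Y'. \<eta> (\<psi> y) = \<phi> y) \<and>
           (\<forall>\<psi>'. morphism Y' Y \<psi>' \<and> (\<forall>y\<in>Y'. \<eta> (\<psi>' y) = \<phi> y) \<longrightarrow> (\<forall>y\<in>Y'. \<psi>' y = \<psi> y)))"
    using assms(1) unfolding blow_up_def by (elim conjE)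
  note ex = this[THEN spec, THEN spec, THEN mp, OF conjI[OF assms(2) conjI[OF assms(3,4)]]]
  show ?thesis by (rule exE[OF ex], elim conjE, rule that)
qed

text \<open>The existence half of the universal property, applied to the inclusion of
  \<open>U\<close>, gives \<open>\<psi>\<close>. The uniqueness half, applied to
  \<open>\<eta>\<close> on the preimage of \<open>U\<close>, forces
  \<open>\<psi> \<circ> \<eta>\<close> to be the identity there, both being lifts of
  \<open>\<eta>\<close>.\<close>

lemma blow_up_section:
  assumes bl: "blow_up X Z Y \<eta>" and X: "closedin (zar (Pn n)) X" "irreducible_space (zar X)"
    and U: "openin (zar X) U" "U \<noteq> {}" "U \<inter> Z = {}"
  obtains \<psi> where "morphism U Y \<psi>" "\<forall>x\<in>U. \<eta> (\<psi> x) = x" "\<forall>y\<in>Y. \<eta> y \<in> U \<longrightarrow> \<psi> (\<eta> y) = y"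
proof -
  have Y: "projective_variety Y" and \<eta>: "morphism Y X \<eta>" using bl by (auto simp: blow_up_def)
  then obtain m where m: "closedin (zar (Pn m)) Y" and irr: "irreducible_space (zar Y)"
    by (auto simp: projective_variety_def)
  have XP: "X \<subseteq> Pn n" "Y \<subseteq> Pn m" using X m closedin_zar_subset by blast+
  then have PP: "X \<subseteq> PP" "Y \<subseteq> PP" using Pn_subset_PP by blast+
  have UX: "U \<subseteq> X" using U(1) by (rule openin_zar_subset)
  have UPP: "U \<subseteq> PP" using UX PP by blast
  have incl: "morphism U X (\<lambda>x. x)" by (rule morphism_id[OF UX PP(1)])
  have "invertible_inverse_image X Z U (\<lambda>x. x)"
    by (rule invertible_inverse_image_off_centre[OF UPP incl U(1,3)])
  then obtain \<psi> where \<psi>: "morphism U Y \<psi>" "\<forall>x\<in>U. \<eta> (\<psi> x) = x"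
    by (rule blow_up_universal[OF bl open_in_closed_quasi_projective[OF X U(1,2)] incl])
  define W where "W = {y\<in>Y. \<eta> y \<in> U}"
  have W: "openin (zar Y) W" unfolding W_def by (rule morphism_preimage_open[OF \<eta> U(1) PP(2)])
  have WY: "W \<subseteq> Y" by (auto simp: W_def)
  then have WPP: "W \<subseteq> PP" using PP by blast
  \<comment> \<open>\<open>W\<close> has to be nonempty to be a variety and hence a test object;
    \<open>\<psi>\<close> supplies a point of it.\<close>
  obtain x0 where "x0 \<in> U" using U(2) by blast
  then have "\<psi> x0 \<in> W" using \<psi>(2) morphism_in[OF \<psi>(1)] by (simp add: W_def)
  then have "W \<noteq> {}" by blast
  note qp = open_in_closed_quasi_projective[OF m irr W this]
  have \<eta>W: "morphism W X \<eta>" "morphism W U \<eta>"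
    by (rule morphism_restrict[OF \<eta> PP(2) XP(1) WY]; use PP UPP morphism_in[OF \<eta>] in \<open>auto simp: W_def\<close>)+
  have inv: "invertible_inverse_image X Z W \<eta>"
    by (rule invertible_inverse_image_off_centre[OF WPP \<eta>W(1) U(1,3)]) (simp add: W_def)
  obtain \<chi> where \<chi>: "\<forall>\<psi>'. morphism W Y \<psi>' \<and> (\<forall>y\<in>W. \<eta> (\<psi>' y) = \<eta> y) \<longrightarrow> (\<forall>y\<in>W. \<psi>' y = \<chi> y)"
    by (rule blow_up_universal[OF bl qp \<eta>W(1) inv])
  have "\<forall>y\<in>W. y = \<chi> y"
    using \<chi>[rule_format, of "\<lambda>y. y"] morphism_id[OF WY PP(2)] by blast
  moreover have "\<forall>y\<in>W. \<psi> (\<eta> y) = \<chi> y"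
    using \<chi>[rule_format, of "\<lambda>y. \<psi> (\<eta> y)"] morphism_comp[OF \<eta>W(2) \<psi>(1)] \<psi>(2) by (simp add: W_def)
  ultimately have "\<forall>y\<in>Y. \<eta> y \<in> U \<longrightarrow> \<psi> (\<eta> y) = y" by (simp add: W_def)
  with \<psi> show ?thesis by (rule that)
qed

section \<open>The cyclic triple cover\<close>

lemma scale1_scale1: "scale1 c (scale1 d x) = scale1 (c * d) x"
proof -
  have "(\<lambda>v (i::nat). if i = 1 then c * v i else v i) \<circ> (\<lambda>v i. if i = 1 then d * v i else v i) =
    (\<lambda>v i. if i = 1 then c * d * v i else v i)" by (auto simp: fun_eq_iff)
  then show ?thesis unfolding scale1_def image_comp by (simp only:)
qed

lemma scale1_1: "scale1 1 x = x"
proof -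
  have "(\<lambda>v i. if i = 1 then 1 * v i else v i) = (\<lambda>v :: nat \<Rightarrow> 'a. v)"
    by (intro ext) (simp only: mult_1_left if_cancel)
  then show ?thesis unfolding scale1_def by (simp only: image_ident)
qed

text \<open>The locus where the affine coordinate \<open>coord_ratio 0 1\<close> is regular and
  invertible; it is stable under every \<open>scale1 c\<close> with \<open>c\<close>
  nonzero.\<close>

definition torus :: "'k::field pt set" where
  "torus = {q\<in>P1. \<forall>v\<in>q. v 0 \<noteq> 0 \<and> v 1 \<noteq> 0}"

lemma openin_torus: "openin (zar P1) torus"
proof -
  have eq: "torus = {q\<in>P1. \<forall>v\<in>q. v 0 \<noteq> 0} \<inter> {q\<in>P1. \<forall>v\<in>q. v 1 \<noteq> 0}"
    unfolding torus_def by blast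
  show ?thesis unfolding eq by (intro openin_Int openin_zar_nonzero[OF hpoly_var Pn_subset_PP])
qed

lemma torus_subset: "torus \<subseteq> P1"
  unfolding torus_def by blast

lemma hpt_1_1_torus: "hpt 1 1 \<in> torus"
  unfolding torus_def by (auto intro!: hpt_in_P1 simp del: One_nat_def) (auto simp: hpt_def mem_pcls)

lemma torus_scale1: "q \<in> torus \<Longrightarrow> c \<noteq> 0 \<Longrightarrow> scale1 c q \<in> torus"
  using morphism_in[OF morphism_scale1, of c q] unfolding torus_def scale1_def by auto

lemma coord_ratio_scale1:
  assumes "q \<in> torus" "c \<noteq> 0"
  shows "coord_ratio 0 1 (scale1 c q) = c * coord_ratio 0 1 q"
proof -
  have PP: "q \<in> PP" "scale1 c q \<in> PP"
    using torus_subset torus_scale1[OF assms] assms(1) Pn_subset_PP by blast+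
  then obtain v where v: "v \<in> q" using PP_nonempty by blast
  then have "(\<lambda>i. if i = 1 then c * v i else v i) \<in> scale1 c q" by (simp add: scale1_def)
  then show ?thesis using coord_ratio_eq[OF PP(2)] coord_ratio_eq[OF PP(1) v] by simp
qed

lemma coord_ratio_torus:
  assumes "q \<in> torus" shows "coord_ratio 0 1 q \<noteq> 0"
proof -
  have "q \<in> PP" using torus_subset assms Pn_subset_PP by blast
  then show ?thesis using assms PP_nonempty coord_ratio_eq unfolding torus_def by fastforce
qed

lemma regular_coord_torus: "regular P1 torus (coord_ratio 0 1)"
  by (rule regular_subset[OF regular_coord_ratio[OF Pn_subset_PP] openin_torus]) (auto simp: torus_def)

text \<open>\<open>Y\<close> plays the blow-up, \<open>Q\<close> its quotient, \<open>F\<close> the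
  type 2 fibration and \<open>U\<close> an open set over which \<open>\<eta>\<close> has the inverse
  \<open>\<psi>\<close>. The relation between \<open>F\<close> and \<open>\<sigma>\<close> is
  imposed at points \<open>\<eta> z\<close> because \<open>\<eta>\<close> is not assumed
  surjective.\<close>

locale triple_cover =
  fixes X Y Q :: "'k::field_char_0 pt set" and U :: "'k pt set"
    and \<sigma> \<sigma>' \<eta> \<psi> \<pi> F FQ :: "'k pt \<Rightarrow> 'k pt" and \<zeta> :: 'k and nX nY nQ :: nat
  assumes X: "closedin (zar (Pn nX)) X" "irreducible_space (zar X)"
    and Y: "closedin (zar (Pn nY)) Y" "irreducible_space (zar Y)"
    and Q: "closedin (zar (Pn nQ)) Q"
    and \<sigma>: "morphism X X \<sigma>" and \<sigma>3: "\<And>x. x \<in> X \<Longrightarrow> \<sigma> (\<sigma> (\<sigma> x)) = x"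
    and \<sigma>': "morphism Y Y \<sigma>'"
    and \<eta>: "morphism Y X \<eta>" and \<eta>\<sigma>: "\<And>z. z \<in> Y \<Longrightarrow> \<eta> (\<sigma>' z) = \<sigma> (\<eta> z)"
    and U: "openin (zar X) U" "U \<noteq> {}" and \<sigma>U: "\<And>x. x \<in> U \<Longrightarrow> \<sigma> x \<in> U"
    and \<psi>: "morphism U Y \<psi>" and \<eta>\<psi>: "\<And>x. x \<in> U \<Longrightarrow> \<eta> (\<psi> x) = x"
    and \<psi>\<eta>: "\<And>y. y \<in> Y \<Longrightarrow> \<eta> y \<in> U \<Longrightarrow> \<psi> (\<eta> y) = y"
    and \<pi>: "quotient_by Y \<sigma>' Q \<pi>"
    and F: "morphism X P1 F" "F ` X = P1" and FQ: "morphism Q P1 FQ"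
    and FQ\<pi>: "\<And>z. z \<in> Y \<Longrightarrow> FQ (\<pi> z) = tau (F (\<eta> z))"
    and \<zeta>: "1 + \<zeta> + \<zeta>\<^sup>2 = 0"
    and F\<sigma>: "\<And>z. z \<in> Y \<Longrightarrow> F (\<sigma> (\<eta> z)) = scale1 \<zeta> (F (\<eta> z))"
begin

lemma Pn_subsets: "X \<subseteq> Pn nX" "Y \<subseteq> Pn nY" "Q \<subseteq> Pn nQ"
  using X(1) Y(1) Q closedin_zar_subset by blast+

lemma PP_subsets: "X \<subseteq> PP" "Y \<subseteq> PP" "Q \<subseteq> PP"
  using Pn_subsets Pn_subset_PP by blast+

lemma \<pi>_props:
  "morphism Y Q \<pi>" "\<pi> ` Y = Q"
  "\<forall>x\<in>Y. \<forall>y\<in>Y. \<pi> x = \<pi> y \<longleftrightarrow> (\<exists>n. y = (\<sigma>' ^^ n) x)"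
  "\<forall>A. A \<subseteq> Q \<longrightarrow> (openin (zar Q) A \<longleftrightarrow> openin (zar Y) {y\<in>Y. \<pi> y \<in> A})"
  "\<forall>A f. openin (zar Q) A \<longrightarrow>
     (regular Q A f \<longleftrightarrow> regular Y {y\<in>Y. \<pi> y \<in> A} (\<lambda>y. f (\<pi> y)))"
  using \<pi> unfolding quotient_by_def by - (elim conjE, assumption)+

lemmas \<pi>_morphism = \<pi>_props(1)
lemmas \<pi>_surj = \<pi>_props(2)
lemmas \<pi>_eq = \<pi>_props(3)[rule_format]
lemmas \<pi>_open = \<pi>_props(4)[rule_format]
lemmas \<pi>_regular = \<pi>_props(5)[rule_format]

section \<open>Orbits and the descent of invariant functions\<close>

lemma orbit:
  assumes "z \<in> Y" shows "(\<sigma>' ^^ n) z \<in> Y" "\<eta> ((\<sigma>' ^^ n) z) = (\<sigma> ^^ n) (\<eta> z)"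
proof -
  have "(\<sigma>' ^^ n) z \<in> Y \<and> \<eta> ((\<sigma>' ^^ n) z) = (\<sigma> ^^ n) (\<eta> z)"
    using assms morphism_in[OF \<sigma>'] \<eta>\<sigma> by (induction n) auto
  then show "(\<sigma>' ^^ n) z \<in> Y" "\<eta> ((\<sigma>' ^^ n) z) = (\<sigma> ^^ n) (\<eta> z)" by auto
qed

lemma same_\<pi>:
  assumes "y \<in> Y" "z \<in> Y" "\<pi> y = \<pi> z"
  obtains n where "\<eta> z = (\<sigma> ^^ n) (\<eta> y)"
  using \<pi>_eq[OF assms(1,2)] assms(3) orbit(2)[OF assms(1)] by metis

text \<open>The value at an arbitrary point over \<open>P\<close>; it is independent of the choice
  only where \<open>h\<close> is invariant under \<open>\<sigma>\<close>. Functions on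
  \<open>X\<close> are descended, by way of \<open>\<eta>\<close>, since that is where invariance is
  known.\<close>

definition descend :: "('k pt \<Rightarrow> 'b) \<Rightarrow> 'k pt \<Rightarrow> 'b" where
  "descend h P = h (\<eta> (SOME z. z \<in> Y \<and> \<pi> z = P))"

lemma descend:
  assumes S: "\<And>x. x \<in> S \<Longrightarrow> \<sigma> x \<in> S" and h: "\<And>x. x \<in> S \<Longrightarrow> h (\<sigma> x) = h x"
    and z: "z \<in> Y" "\<eta> z \<in> S"
  shows "descend h (\<pi> z) = h (\<eta> z)"
proof -
  let ?z = "SOME y. y \<in> Y \<and> \<pi> y = \<pi> z"
  have "?z \<in> Y \<and> \<pi> ?z = \<pi> z" by (rule someI[of _ z]) (use z in blast)
  then obtain n where n: "\<eta> ?z = (\<sigma> ^^ n) (\<eta> z)" using same_\<pi>[OF z(1), of ?z] by metis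
  have "(\<sigma> ^^ n) (\<eta> z) \<in> S \<and> h ((\<sigma> ^^ n) (\<eta> z)) = h (\<eta> z)"
    using z(2) S h by (induction n) auto
  then show ?thesis unfolding descend_def n by blast
qed

text \<open>A \<open>\<sigma>\<close>-stable set has a saturated preimage in \<open>Y\<close>, so
  its image in \<open>Q\<close> is open and regularity can be tested upstairs, the quotient being
  one of spaces with functions.\<close>

lemma descend_regular:
  assumes h: "regular X S h" and S: "\<And>x. x \<in> S \<Longrightarrow> \<sigma> x \<in> S" and inv: "\<And>x. x \<in> S \<Longrightarrow> h (\<sigma> x) = h x"
  shows "regular Q (\<pi> ` {z\<in>Y. \<eta> z \<in> S}) (descend h)"
    and "z \<in> Y \<Longrightarrow> \<pi> z \<in> \<pi> ` {z\<in>Y. \<eta> z \<in> S} \<longleftrightarrow> \<eta> z \<in> S"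
proof -
  have stable: "(\<sigma> ^^ n) x \<in> S" if "x \<in> S" for n x
    using that S by (induction n) auto
  show iff: "\<pi> z \<in> \<pi> ` {z\<in>Y. \<eta> z \<in> S} \<longleftrightarrow> \<eta> z \<in> S" if z: "z \<in> Y" for z
  proof
    assume "\<pi> z \<in> \<pi> ` {z\<in>Y. \<eta> z \<in> S}"
    then obtain y where y: "y \<in> Y" "\<eta> y \<in> S" "\<pi> y = \<pi> z" by auto
    obtain n where "\<eta> z = (\<sigma> ^^ n) (\<eta> y)" using same_\<pi>[OF y(1) z y(3)] .
    then show "\<eta> z \<in> S" using stable y(2) by simp
  qed (use z in blast)
  then have eq: "{z\<in>Y. \<pi> z \<in> \<pi> ` {z\<in>Y. \<eta> z \<in> S}} = {z\<in>Y. \<eta> z \<in> S}" by blast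
  have sub: "\<pi> ` {z\<in>Y. \<eta> z \<in> S} \<subseteq> Q" using \<pi>_surj by blast
  have r: "regular Y {z\<in>Y. \<eta> z \<in> S} (\<lambda>z. h (\<eta> z))" by (rule morphism_regular[OF \<eta> h])
  then have "openin (zar Q) (\<pi> ` {z\<in>Y. \<eta> z \<in> S})"
    using \<pi>_open[OF sub] unfolding eq by (auto dest: regular_openin)
  moreover have "regular Y {z\<in>Y. \<eta> z \<in> S} (\<lambda>z. descend h (\<pi> z))"
    by (rule regular_cong[OF r]) (use descend[of S h] S inv in auto)
  ultimately show "regular Q (\<pi> ` {z\<in>Y. \<eta> z \<in> S}) (descend h)"
    using \<pi>_regular[of "\<pi> ` {z\<in>Y. \<eta> z \<in> S}" "descend h"] unfolding eq by blast
qed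

text \<open>Proved from open sets and regular functions, not from local coordinates, because that is
  the form in which the quotient \<open>\<pi>\<close> is known.\<close>

lemma descend_morphism:
  assumes E: "morphism X P1 E" and inv: "\<And>x. x \<in> X \<Longrightarrow> E (\<sigma> x) = E x"
  shows "morphism Q P1 (descend E)" and "z \<in> Y \<Longrightarrow> descend E (\<pi> z) = E (\<eta> z)"
proof -
  show eq: "descend E (\<pi> z) = E (\<eta> z)" if "z \<in> Y" for z
    using morphism_in[OF \<sigma>] inv that morphism_in[OF \<eta> that] by (rule descend[of X E])
  have E\<eta>: "morphism Y P1 (\<lambda>z. E (\<eta> z))" by (rule morphism_comp[OF \<eta> E])
  have im: "descend E ` Q \<subseteq> P1"
    using \<pi>_surj eq morphism_in[OF E\<eta>] by auto
  have pre: "{z\<in>Y. \<pi> z \<in> {P\<in>Q. descend E P \<in> A}} = {z\<in>Y. E (\<eta> z) \<in> A}" for A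
    using eq \<pi>_surj by auto
  have op: "openin (zar Q) {P\<in>Q. descend E P \<in> A}" if "openin (zar P1) A" for A
    using \<pi>_open[of "{P\<in>Q. descend E P \<in> A}"] morphism_preimage_open[OF E\<eta> that PP_subsets(2)]
    unfolding pre by blast
  have "regular Q {P\<in>Q. descend E P \<in> A} (\<lambda>P. f (descend E P))" if f: "regular P1 A f" for A f
  proof -
    have "regular Y {z\<in>Y. E (\<eta> z) \<in> A} (\<lambda>z. f (descend E (\<pi> z)))"
      by (rule regular_cong[OF morphism_regular[OF E\<eta> f]]) (use eq in auto)
    then show ?thesis using \<pi>_regular[OF op[OF regular_openin[OF f]]] unfolding pre by blast
  qed
  moreover have "continuous_map (zar Q) (zar P1) (descend E)"
    unfolding continuous_map topspace_zar[OF PP_subsets(3)] topspace_zar[OF Pn_subset_PP]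
    using im op by blast
  ultimately show "morphism Q P1 (descend E)" using im unfolding morphism_def by blast
qed

section \<open>The fibre product \<open>C\<close> and the rational map from \<open>X\<close> to
  it\<close>

abbreviation C :: "'k pt set" where "C \<equiv> fibre_product_tau Q FQ"

lemma C_cases:
  assumes "c \<in> C" obtains r q where "r \<in> Q" "q \<in> P1" "FQ r = tau q" "c = segre r q"
  using assms unfolding fibre_product_tau_def by blast

lemma C_closed: "\<exists>N. closedin (zar (Pn N)) C"
proof -
  obtain N where "\<forall>i\<le>nQ. \<forall>j\<le>1. prod_encode (i, j) \<le> N" using ex_segre_bound by blast
  moreover have "closedin (zar P1) P1" by (rule closedin_zar_self[OF Pn_subset_PP])
  ultimately have "closedin (zar (Pn N)) C"
    unfolding fibre_product_tau_def using closedin_fibre_product[OF Q _ FQ morphism_tau, of 1 N] by blast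
  then show ?thesis ..
qed

lemma C_PP: "C \<subseteq> PP"
proof -
  obtain N where "closedin (zar (Pn N)) C" using C_closed ..
  from closedin_zar_subset[OF this] show ?thesis using Pn_subset_PP by (rule order.trans)
qed

lemma seg_C: "r \<in> Q \<Longrightarrow> q \<in> P1 \<Longrightarrow> segre_fst (segre r q) = r" "r \<in> Q \<Longrightarrow> q \<in> P1 \<Longrightarrow> segre_snd (segre r q) = q"
  by (rule segre_fst_segre segre_snd_segre; use PP_subsets(3) Pn_subset_PP[of 1] in blast)+

lemma seg_morphism: "morphism C Q segre_fst" "morphism C P1 segre_snd"
proof -
  have "C \<subseteq> prod_variety PP PP"
    unfolding fibre_product_tau_def prod_variety_def using PP_subsets(3) Pn_subset_PP by blast
  note lp = locpoly_seg[OF this C_PP]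
  have "segre_fst ` C \<subseteq> Q" "segre_snd ` C \<subseteq> P1" using seg_C unfolding fibre_product_tau_def by auto
  then show "morphism C Q segre_fst" "morphism C P1 segre_snd"
    using locpoly_imp_morphism[OF lp(1) C_PP PP_subsets(3)] locpoly_imp_morphism[OF lp(2) C_PP Pn_subset_PP]
    by blast+
qed

definition \<Phi> :: "'k pt \<Rightarrow> 'k pt" where
  "\<Phi> z = segre (\<pi> z) (F (\<eta> z))"

lemma F\<eta>: "morphism Y P1 (\<lambda>z. F (\<eta> z))"
  by (rule morphism_comp[OF \<eta> F(1)])

lemma \<Phi>_in: "z \<in> Y \<Longrightarrow> \<Phi> z \<in> C"
  unfolding \<Phi>_def fibre_product_tau_def
  using morphism_in[OF \<pi>_morphism] morphism_in[OF F\<eta>] FQ\<pi> by blast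

lemma \<Phi>_morphism: "morphism Y C \<Phi>"
proof (rule locpoly_imp_morphism)
  show "locpoly Y \<Phi>"
    unfolding \<Phi>_def
    by (rule locpoly_segre[OF morphism_imp_locpoly[OF \<pi>_morphism PP_subsets(2) Pn_subsets(3)]
          morphism_imp_locpoly[OF F\<eta> PP_subsets(2) order.refl]])
qed (use PP_subsets C_PP \<Phi>_in in auto)

text \<open>Both \<open>Y \<rightarrow> Q\<close> and \<open>C \<rightarrow> Q\<close> have orbits of a group of order 3 as fibres, and \<open>\<sigma>'\<close> acts on the
  second coordinate of \<open>\<Phi>\<close> as a primitive third root of unity.\<close>

lemma \<Phi>_surj: "\<Phi> ` Y = C"
proof
  show "C \<subseteq> \<Phi> ` Y"
  proof
    fix c assume "c \<in> C"
    then obtain r q where c: "r \<in> Q" "q \<in> P1" "FQ r = tau q" "c = segre r q" by (rule C_cases)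
    obtain z where z: "z \<in> Y" "r = \<pi> z" using c(1) \<pi>_surj by blast
    have step: "\<sigma>' y \<in> Y" "\<pi> (\<sigma>' y) = \<pi> y" "F (\<eta> (\<sigma>' y)) = scale1 \<zeta> (F (\<eta> y))" if y: "y \<in> Y" for y
    proof -
      show 1: "\<sigma>' y \<in> Y" by (rule morphism_in[OF \<sigma>' y])
      show "\<pi> (\<sigma>' y) = \<pi> y" using \<pi>_eq[OF y 1] exI[of "\<lambda>n. \<sigma>' y = (\<sigma>' ^^ n) y" 1] by simp
      show "F (\<eta> (\<sigma>' y)) = scale1 \<zeta> (F (\<eta> y))" using F\<sigma>[OF y] \<eta>\<sigma>[OF y] by simp
    qed
    note s1 = step[OF z(1)] note s2 = step[OF s1(1)]
    have "tau (F (\<eta> z)) = tau q" using FQ\<pi>[OF z(1)] z(2) c(3) by simp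
    from tau_eq_imp_scale1[OF \<zeta> morphism_in[OF F\<eta> z(1)] c(2) this]
    have "q = F (\<eta> z) \<or> q = F (\<eta> (\<sigma>' z)) \<or> q = F (\<eta> (\<sigma>' (\<sigma>' z)))"
      unfolding s2(3) s1(3) scale1_scale1 scale1_1 power2_eq_square .
    then have "c = \<Phi> z \<or> c = \<Phi> (\<sigma>' z) \<or> c = \<Phi> (\<sigma>' (\<sigma>' z))"
      unfolding \<Phi>_def s2(2) s1(2) c(4) z(2) by blast
    then show "c \<in> \<Phi> ` Y" using z(1) s1(1) s2(1) by blast
  qed
qed (use \<Phi>_in in blast)

lemma C_irreducible: "irreducible_space (zar C)"
proof (rule irreducible_space_image[OF Y(2)])
  show "continuous_map (zar Y) (zar C) \<Phi>" using \<Phi>_morphism by (simp add: morphism_def)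
  show "\<Phi> ` topspace (zar Y) = topspace (zar C)"
    unfolding topspace_zar[OF PP_subsets(2)] topspace_zar[OF C_PP] by (rule \<Phi>_surj)
qed

lemma C_projective: "projective_variety C"
  using C_closed C_irreducible by (simp add: projective_variety_def)

sublocale CV: irreducible_variety C
  by unfold_locales (rule C_irreducible C_PP)+

sublocale XV: irreducible_variety X
  by unfold_locales (rule X PP_subsets)+

text \<open>A rational map from \<open>X\<close> itself, through \<open>\<psi>\<close>: the function
  field to be compared with that of \<open>C\<close> is the one of \<open>X\<close>, not of
  \<open>Y\<close>.\<close>

definition \<Psi> :: "'k pt \<Rightarrow> 'k pt" where
  "\<Psi> x = \<Phi> (\<psi> x)"

lemma \<Psi>_morphism: "morphism U C \<Psi>"
  unfolding \<Psi>_def by (rule morphism_comp[OF \<psi> \<Phi>_morphism])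

lemma \<Psi>_seg: "x \<in> U \<Longrightarrow> segre_fst (\<Psi> x) = \<pi> (\<psi> x)" "x \<in> U \<Longrightarrow> segre_snd (\<Psi> x) = F x"
  unfolding \<Psi>_def \<Phi>_def
  using seg_C morphism_in[OF \<psi>] morphism_in[OF \<pi>_morphism] morphism_in[OF F\<eta>] \<eta>\<psi> by metis+

text \<open>\<open>\<Phi>\<close> is onto, so a nonempty open set of \<open>C\<close> has nonempty
  preimage in \<open>Y\<close>; by irreducibility of \<open>Y\<close> this preimage meets the part
  lying over \<open>U\<close>.\<close>

sublocale \<Psi>: dominant_map X C U \<Psi>
proof
  show "openin (zar X) U" by (rule U)
  show "morphism U C \<Psi>" by (rule \<Psi>_morphism)
  fix V assume V: "openin (zar C) V" "V \<noteq> {}"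
  obtain c where c: "c \<in> V" using V(2) by blast
  then have "c \<in> \<Phi> ` Y" using \<Phi>_surj openin_zar_subset[OF V(1)] by blast
  then have "{z\<in>Y. \<Phi> z \<in> V} \<noteq> {}" using c by blast
  moreover have "{z\<in>Y. \<eta> z \<in> U} \<noteq> {}" using U(2) morphism_in[OF \<psi>] \<eta>\<psi> by fastforce
  ultimately have "{z\<in>Y. \<Phi> z \<in> V} \<inter> {z\<in>Y. \<eta> z \<in> U} \<noteq> {}"
    using irreducible_opens_meet[OF Y(2) morphism_preimage_open[OF \<Phi>_morphism V(1) PP_subsets(2)]
        morphism_preimage_open[OF \<eta> U(1) PP_subsets(2)]] by blast
  then obtain z where "z \<in> Y" "\<Phi> z \<in> V" "\<eta> z \<in> U" by blast
  then show "\<exists>x\<in>U. \<Psi> x \<in> V" using \<psi>\<eta> unfolding \<Psi>_def by (intro bexI[of _ "\<eta> z"]) auto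
qed

lemma F\<sigma>_U: "x \<in> U \<Longrightarrow> F (\<sigma> x) = scale1 \<zeta> (F x)"
  using F\<sigma>[OF morphism_in[OF \<psi>]] \<eta>\<psi> by simp

text \<open>Decomposing \<open>f\<close> into eigenvectors of \<open>\<sigma>\<close> and dividing by powers of the coordinate of \<open>F\<close>,
  itself an eigenvector, expresses \<open>f\<close> through \<open>\<sigma>\<close>-invariant functions, which descend to \<open>Q\<close>.\<close>

lemma pullback_surj:
  assumes f: "regular X V f" "V \<noteq> {}"
  shows "\<exists>V' f'. regular C V' f' \<and> V' \<noteq> {} \<and> (\<forall>x\<in>V. x \<in> U \<longrightarrow> \<Psi> x \<in> V' \<longrightarrow> f x = f' (\<Psi> x))"
proof -
  have VX: "V \<subseteq> X" using openin_zar_subset[OF regular_openin[OF f(1)]] .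
  have \<zeta>3: "\<zeta> ^ 3 = 1"
  proof -
    have "\<zeta> ^ 3 - 1 = (\<zeta> - 1) * (1 + \<zeta> + \<zeta>\<^sup>2)"
      by (simp add: algebra_simps power2_eq_square power3_eq_cube)
    then show ?thesis using \<zeta> by simp
  qed
  have \<zeta>0: "\<zeta> \<noteq> 0" using \<zeta> by auto
  let ?V1 = "{x\<in>X. \<sigma> x \<in> V}" let ?V2 = "{x\<in>X. \<sigma> (\<sigma> x) \<in> V}" let ?T = "{x\<in>X. F x \<in> torus}"
  have \<sigma>\<sigma>: "morphism X X (\<lambda>x. \<sigma> (\<sigma> x))" by (rule morphism_comp[OF \<sigma> \<sigma>])
  note f1 = morphism_regular[OF \<sigma> f(1)] and f2 = morphism_regular[OF \<sigma>\<sigma> f(1)]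
  define u where "u x = coord_ratio 0 1 (F x)" for x
  have u: "regular X ?T u" unfolding u_def by (rule morphism_regular[OF F(1) regular_coord_torus])
  have u0: "u x \<noteq> 0" if "x \<in> ?T" for x
    using that coord_ratio_torus[of "F x"] unfolding u_def by blast
  \<comment> \<open>A \<open>\<sigma>\<close>-stable open set on which \<open>f\<close>, its two
    translates and the inverse of the coordinate \<open>u\<close> are all regular.\<close>
  define S where "S = U \<inter> V \<inter> ?V1 \<inter> ?V2 \<inter> ?T"
  have op: "openin (zar X) S"
    unfolding S_def using U(1) f(1) f1 f2 u by (intro openin_Int) (auto dest: regular_openin)
  have "?V1 \<noteq> {}" "?V2 \<noteq> {}"
  proof -
    obtain y where y: "y \<in> V" "y \<in> X" using f(2) VX by blast
    have "\<sigma> y \<in> X" "\<sigma> (\<sigma> y) \<in> X" using y(2) morphism_in[OF \<sigma>] by blast+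
    then have "\<sigma> (\<sigma> y) \<in> ?V1" "\<sigma> y \<in> ?V2" using y(1) \<sigma>3[OF y(2)] by simp_all
    then show "?V1 \<noteq> {}" "?V2 \<noteq> {}" by blast+
  qed
  moreover have "?T \<noteq> {}"
  proof -
    have "hpt 1 1 \<in> F ` X" unfolding F(2) using hpt_1_1_torus torus_subset by blast
    then obtain x where "x \<in> X" "hpt 1 1 = F x" by (rule imageE)
    then have "x \<in> ?T" using hpt_1_1_torus[where 'a = 'k] by (simp del: One_nat_def)
    then show ?thesis by blast
  qed
  ultimately have "S \<noteq> {}"
    unfolding S_def using U f f1 f2 u
    by (intro XV.opens_meet openin_Int) (auto dest: regular_openin)
  then obtain x0 where x0: "x0 \<in> S" by blast
  have SX: "S \<subseteq> X" using op by (rule openin_zar_subset)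
  have stable: "\<sigma> x \<in> S" if "x \<in> S" for x
    using that \<sigma>U \<sigma>3 F\<sigma>_U torus_scale1[OF _ \<zeta>0] morphism_in[OF \<sigma>] unfolding S_def by auto
  have u\<sigma>: "u (\<sigma> x) = \<zeta> * u x" if "x \<in> S" for x
    using that F\<sigma>_U coord_ratio_scale1[OF _ \<zeta>0] unfolding S_def u_def by auto
  \<comment> \<open>The bracket is three times the projection of \<open>f\<close> to the eigenvalue
    \<open>\<zeta> ^ i\<close>, since \<open>\<zeta> ^ (2 * i)\<close> is the inverse of
    \<open>\<zeta> ^ i\<close>; dividing by \<open>u ^ i\<close>, which has the same eigenvalue,
    makes it invariant.\<close>
  define h where "h i x = (f x + \<zeta> ^ (2 * i) * f (\<sigma> x) + (\<zeta> ^ (2 * i))\<^sup>2 * f (\<sigma> (\<sigma> x))) * inverse (u x) ^ i"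
    for i x
  have h: "regular X S (h i)" for i
  proof -
    have "regular X S f" "regular X S (\<lambda>x. f (\<sigma> x))" "regular X S (\<lambda>x. f (\<sigma> (\<sigma> x)))"
      "regular X S (\<lambda>x. inverse (u x))"
      by (rule regular_subset[OF f(1) op] regular_subset[OF f1 op] regular_subset[OF f2 op]
          regular_subset[OF regular_inverse[OF u PP_subsets(1) u0] op]; auto simp: S_def)+
    then show ?thesis unfolding h_def
      by (intro regular_add' regular_mult' regular_power regular_const op)
  qed
  have inv: "h i (\<sigma> x) = h i x" if x: "x \<in> S" for i x
  proof -
    have "x \<in> X" using x SX by blast
    have "inverse \<zeta> = \<zeta>\<^sup>2"
      using \<zeta>3 \<zeta>0 by (simp add: field_simps power2_eq_square power3_eq_cube)
    then have iu: "inverse (u (\<sigma> x)) ^ i = \<zeta> ^ (2 * i) * inverse (u x) ^ i"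
      by (simp add: u\<sigma>[OF x] power_mult power_mult_distrib)
    have a: "\<zeta> ^ (2 * i) * (\<zeta> ^ (2 * i))\<^sup>2 = 1"
    proof -
      have "\<zeta> ^ (2 * i) * (\<zeta> ^ (2 * i))\<^sup>2 = (\<zeta> ^ 3) ^ (2 * i)"
        by (simp add: power2_eq_square flip: power_add power_mult)
      then show ?thesis by (simp add: \<zeta>3)
    qed
    \<comment> \<open>Here \<open>b\<close> stands for \<open>\<zeta> ^ (2 * i)\<close>: applying
      \<open>\<sigma>\<close> permutes the three translates cyclically, and the cube of
      \<open>b\<close> being 1 absorbs the shift.\<close>
    have "(p + b * q + b\<^sup>2 * t) * (b * w) = (t + b * p + b\<^sup>2 * q) * w"
      if b: "b * b\<^sup>2 = 1" for p q t b w :: 'k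
    proof -
      have "(p + b * q + b\<^sup>2 * t) * (b * w) = (b * b\<^sup>2 * t + b * p + b\<^sup>2 * q) * w"
        by (simp add: algebra_simps power2_eq_square)
      then show ?thesis by (simp only: b mult_1)
    qed
    then show ?thesis unfolding h_def iu \<sigma>3[OF \<open>x \<in> X\<close>] using a by blast
  qed
  define Q' where "Q' = \<pi> ` {z\<in>Y. \<eta> z \<in> S}"
  have desc: "regular Q Q' (descend (h i))" "z \<in> Y \<Longrightarrow> \<pi> z \<in> Q' \<longleftrightarrow> \<eta> z \<in> S" for i z
    unfolding Q'_def 
    using descend_regular(1)[OF h stable inv] descend_regular(2)[OF h stable inv] by simp_all
  define V' where "V' = {c\<in>C. segre_fst c \<in> Q'} \<inter> {c\<in>C. segre_snd c \<in> torus}"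
  \<comment> \<open>On \<open>C\<close> the coordinate \<open>u\<close> is that of the second
    factor, so multiplying by its power undoes the division in \<open>h\<close>.\<close>
  define g where "g i c = descend (h i) (segre_fst c) * coord_ratio 0 1 (segre_snd c) ^ i" for i c
  have g: "regular C V' (g i)" for i
  proof -
    have 1: "regular C {c\<in>C. segre_fst c \<in> Q'} (\<lambda>c. descend (h i) (segre_fst c))"
      by (rule morphism_regular[OF seg_morphism(1) desc(1)])
    have 2: "regular C {c\<in>C. segre_snd c \<in> torus} (\<lambda>c. coord_ratio 0 1 (segre_snd c) ^ i)"
      by (rule regular_power[OF morphism_regular[OF seg_morphism(2) regular_coord_torus]])
    show ?thesis unfolding g_def V'_def by (rule regular_mult[OF 1 2])
  qed
  \<comment> \<open>The three functions \<open>g i\<close> pull back to three times the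
    eigencomponents of \<open>f\<close>; 3 is invertible in characteristic 0.\<close>
  define f' where "f' c = 1 / 3 * (g 0 c + g 1 c + g 2 c)" for c
  have f': "regular C V' f'"
    unfolding f'_def by (intro regular_mult' regular_add' g regular_const regular_openin[OF g])
  have \<Psi>V': "x \<in> S \<longleftrightarrow> \<Psi> x \<in> V'" if x: "x \<in> U" for x
    using desc(2)[OF morphism_in[OF \<psi> x]] \<Psi>_seg[OF x] \<eta>\<psi>[OF x] morphism_in[OF \<Psi>_morphism x]
    unfolding V'_def S_def by auto
  have "f x = f' (\<Psi> x)" if x: "x \<in> U" "\<Psi> x \<in> V'" for x
  proof -
    have xS: "x \<in> S" using \<Psi>V' x by blast
    then have "u x \<noteq> 0" using u0 by (simp add: S_def)
    have "descend (h i) (segre_fst (\<Psi> x)) = h i x" for i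
      using descend[of S "h i" "\<psi> x"] stable inv morphism_in[OF \<psi> x(1)] \<eta>\<psi>[OF x(1)] xS \<Psi>_seg(1)[OF x(1)] by simp
    then have "g i (\<Psi> x) = f x + \<zeta> ^ (2 * i) * f (\<sigma> x) + (\<zeta> ^ (2 * i))\<^sup>2 * f (\<sigma> (\<sigma> x))" for i
      unfolding g_def h_def \<Psi>_seg(2)[OF x(1)] u_def[symmetric]
      using \<open>u x \<noteq> 0\<close> by (simp add: power_inverse)
    \<comment> \<open>The coefficients of both translates are sums over all third roots of unity and
      vanish.\<close>
    then have "f' (\<Psi> x) = 1 / 3 * (3 * f x + (1 + \<zeta> ^ 2 + \<zeta> ^ 4) * f (\<sigma> x) + (1 + \<zeta> ^ 4 + \<zeta> ^ 8) * f (\<sigma> (\<sigma> x)))"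
      unfolding f'_def by (simp add: algebra_simps flip: power_mult) (simp add: power2_eq_square)
    moreover have "\<zeta> ^ 4 = \<zeta> ^ 3 * \<zeta>" "\<zeta> ^ 8 = (\<zeta> ^ 3)\<^sup>2 * \<zeta>\<^sup>2"
      by (simp_all add: eval_nat_numeral)
    then have "\<zeta> ^ 4 = \<zeta>" "\<zeta> ^ 8 = \<zeta>\<^sup>2" by (simp_all only: \<zeta>3 power_one mult_1_left)
    moreover have "1 + \<zeta>\<^sup>2 + \<zeta> = 0" "1 + \<zeta> + \<zeta>\<^sup>2 = 0" using \<zeta> by (simp_all add: ac_simps)
    ultimately show ?thesis by (simp only:) simp
  qed
  moreover have "V' \<noteq> {}" using x0 \<Psi>V'[of x0] by (auto simp: S_def)
  ultimately show ?thesis using f' by blast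
qed

text \<open>\<open>g\<close> is \<open>E\<close> descended to \<open>Q\<close> and composed with the
  first projection, so its fibres are the parts of \<open>C\<close> over the induced curves.
  Surjectivity of \<open>g\<close> rests on \<open>E\<eta>\<close> and not on that of
  \<open>E\<close> alone, because \<open>\<eta>\<close> might miss points of
  \<open>X\<close>.\<close>

lemma generic_fibre:
  assumes E: "morphism X P1 E" "E ` X = P1" and inv: "\<And>x. x \<in> X \<Longrightarrow> E (\<sigma> x) = E x"
    and E\<eta>: "\<And>v. v \<in> P1 \<Longrightarrow> \<exists>z\<in>Y. E (\<eta> z) = v"
    and P1: "irreducible_variety (P1 :: 'k pt set)"
  obtains g where "morphism C P1 g" "g ` C = P1"
    "\<forall>z\<in>Y. \<forall>q\<in>P1. g (segre (\<pi> z) q) = E (\<eta> z)"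
    "\<exists>\<theta>\<in>ring_iso (function_field C) (function_field X).
        \<forall>a\<in>carrier (function_field P1). \<theta> (ratfun_pullback C g a) = ratfun_pullback X E a"
proof -
  define g where "g c = descend E (segre_fst c)" for c
  have dE: "morphism Q P1 (descend E)" "\<And>z. z \<in> Y \<Longrightarrow> descend E (\<pi> z) = E (\<eta> z)"
    using descend_morphism[OF E(1)] inv by blast+
  have g: "morphism C P1 g" unfolding g_def by (rule morphism_comp[OF seg_morphism(1) dE(1)])
  have eq: "g (segre (\<pi> z) q) = E (\<eta> z)" if "z \<in> Y" "q \<in> P1" for z q
    unfolding g_def using seg_C(1)[OF morphism_in[OF \<pi>_morphism that(1)] that(2)] dE(2)[OF that(1)] by simp
  have g\<Psi>: "g (\<Psi> x) = E x" if "x \<in> U" for x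
    unfolding g_def \<Psi>_seg(1)[OF that] dE(2)[OF morphism_in[OF \<psi> that]] \<eta>\<psi>[OF that] ..
  have surj: "g ` C = P1"
  proof
    show "P1 \<subseteq> g ` C"
    proof
      fix v :: "'k pt" assume "v \<in> P1"
      then obtain z where z: "z \<in> Y" "E (\<eta> z) = v" using E\<eta> by blast
      have "g (\<Phi> z) = v" unfolding \<Phi>_def using eq[OF z(1) morphism_in[OF F\<eta> z(1)]] z(2) by simp
      then show "v \<in> g ` C" using \<Phi>_in[OF z(1)] by blast
    qed
  qed (use morphism_in[OF g] in blast)
  have "dominant_map C P1 C g" "dominant_map X P1 X E"
    by (rule dominant_mapI_surj[OF CV.irreducible_variety_axioms P1 g surj]
        dominant_mapI_surj[OF XV.irreducible_variety_axioms P1 E])+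
  then have "\<forall>a\<in>carrier (function_field P1).
      partial_pullback X U \<Psi> (ratfun_pullback C g a) = ratfun_pullback X E a"
    using \<Psi>.partial_pullback_base g\<Psi> by blast
  with \<Psi>.partial_pullback_ring_iso[OF pullback_surj]
  have "\<exists>\<theta>\<in>ring_iso (function_field C) (function_field X).
      \<forall>a\<in>carrier (function_field P1). \<theta> (ratfun_pullback C g a) = ratfun_pullback X E a" by blast
  then show ?thesis by (intro that[OF g surj]) (use eq in blast)+
qed

end

section \<open>Hilbert's basis theorem and isolated points\<close>

definition subring_set :: "'a::comm_ring_1 set \<Rightarrow> bool" where
  "subring_set A \<longleftrightarrow> 0 \<in> A \<and> 1 \<in> A \<and> (\<forall>a\<in>A. - a \<in> A) \<and> (\<forall>a\<in>A. \<forall>b\<in>A. a + b \<in> A \<and> a * b \<in> A)"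

definition ideal_of :: "'a::comm_ring_1 set \<Rightarrow> 'a set \<Rightarrow> bool" where
  "ideal_of A I \<longleftrightarrow> I \<subseteq> A \<and> 0 \<in> I \<and> (\<forall>a\<in>I. \<forall>b\<in>I. a + b \<in> I) \<and> (\<forall>r\<in>A. \<forall>a\<in>I. r * a \<in> I)"

text \<open>Finite generation is phrased without spans, through all ideals that contain the
  generators.\<close>

definition noetherian_set :: "'a::comm_ring_1 set \<Rightarrow> bool" where
  "noetherian_set A \<longleftrightarrow> (\<forall>I. ideal_of A I \<longrightarrow>
     (\<exists>G. finite G \<and> G \<subseteq> I \<and> (\<forall>J. ideal_of A J \<and> G \<subseteq> J \<longrightarrow> I \<subseteq> J)))"

definition adjoin :: "'a::comm_ring_1 set \<Rightarrow> 'a \<Rightarrow> 'a set" where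
  "adjoin A x = {\<Sum>i<d. c i * x ^ i | d c. \<forall>i. c i \<in> A}"

lemma subring_setD:
  assumes "subring_set A"
  shows "0 \<in> A" "1 \<in> A" "a \<in> A \<Longrightarrow> - a \<in> A" "a \<in> A \<Longrightarrow> b \<in> A \<Longrightarrow> a + b \<in> A"
    "a \<in> A \<Longrightarrow> b \<in> A \<Longrightarrow> a * b \<in> A"
  using assms by (auto simp: subring_set_def)

lemma subring_set_sum:
  assumes "subring_set A" "\<And>i. i \<in> S \<Longrightarrow> c i \<in> A" shows "sum c S \<in> A"
  using assms(2) by (induction S rule: infinite_finite_induct) (auto intro: subring_setD[OF assms(1)])

lemma subring_set_prod:
  assumes "subring_set A" "\<And>i. i \<in> S \<Longrightarrow> c i \<in> A" shows "prod c S \<in> A"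
  using assms(2) by (induction S rule: infinite_finite_induct) (auto intro: subring_setD[OF assms(1)])

lemma subring_set_power: "subring_set A \<Longrightarrow> a \<in> A \<Longrightarrow> a ^ n \<in> A"
  by (induction n) (auto intro: subring_setD)

lemma ideal_ofD:
  assumes "ideal_of A I"
  shows "I \<subseteq> A" "0 \<in> I" "a \<in> I \<Longrightarrow> b \<in> I \<Longrightarrow> a + b \<in> I" "r \<in> A \<Longrightarrow> a \<in> I \<Longrightarrow> r * a \<in> I"
  using assms by (auto simp: ideal_of_def)

lemma ideal_of_diff:
  assumes "subring_set A" "ideal_of A I" "a \<in> I" "b \<in> I" shows "a - b \<in> I"
proof -
  have "- 1 \<in> A" using subring_setD[OF assms(1)] by blast
  then have "- 1 * b \<in> I" using ideal_ofD(4)[OF assms(2)] assms(4) by blast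
  from ideal_ofD(3)[OF assms(2,3) this] show ?thesis by simp
qed

lemma adjoinI: "(\<And>i. c i \<in> A) \<Longrightarrow> (\<Sum>i<d. c i * x ^ i) \<in> adjoin A x"
  unfolding adjoin_def by blast

lemma adjoinE:
  assumes "f \<in> adjoin A x"
  obtains d c where "\<And>i. c i \<in> A" "f = (\<Sum>i<d. c i * x ^ i)"
  using assms unfolding adjoin_def by blast

lemma adjoin_pad:
  assumes A: "subring_set A" and f: "f \<in> adjoin A x"
  shows "\<exists>d. \<forall>n\<ge>d. \<exists>c. (\<forall>i. c i \<in> A) \<and> f = (\<Sum>i<n. c i * x ^ i)"
proof -
  obtain d c where c: "\<And>i. c i \<in> A" "f = (\<Sum>i<d. c i * x ^ i)" using f by (rule adjoinE) blast
  let ?c = "\<lambda>i. if i < d then c i else 0"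
  have "f = (\<Sum>i<n. ?c i * x ^ i)" if "n \<ge> d" for n
    unfolding c(2) using that by (intro sum.mono_neutral_cong_left) auto
  moreover have "\<forall>i. ?c i \<in> A" using c(1) subring_setD(1)[OF A] by simp
  ultimately show ?thesis by (intro exI[of _ d] allI impI exI[of _ ?c]) simp
qed

lemma adjoin_coeff: "subring_set A \<Longrightarrow> a \<in> A \<Longrightarrow> a \<in> adjoin A x"
  using adjoinI[of "\<lambda>_. a" A x 1] by simp

lemma adjoin_var: "subring_set A \<Longrightarrow> x \<in> adjoin A x"
  using adjoinI[of "\<lambda>i. if i = 1 then 1 else 0" A x 2] subring_setD[of A]
  by (simp add: numeral_2_eq_2)

lemma adjoin_add:
  assumes A: "subring_set A" and f: "f \<in> adjoin A x" and g: "g \<in> adjoin A x"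
  shows "f + g \<in> adjoin A x"
proof -
  obtain d where d: "\<forall>n\<ge>d. \<exists>c. (\<forall>i. c i \<in> A) \<and> f = (\<Sum>i<n. c i * x ^ i)"
    using adjoin_pad[OF A f] ..
  obtain e where e: "\<forall>n\<ge>e. \<exists>c. (\<forall>i. c i \<in> A) \<and> g = (\<Sum>i<n. c i * x ^ i)"
    using adjoin_pad[OF A g] ..
  obtain c where c: "\<forall>i. c i \<in> A" "f = (\<Sum>i<max d e. c i * x ^ i)" using d[rule_format, of "max d e"] by auto
  obtain b where b: "\<forall>i. b i \<in> A" "g = (\<Sum>i<max d e. b i * x ^ i)" using e[rule_format, of "max d e"] by auto
  have "f + g = (\<Sum>i<max d e. (c i + b i) * x ^ i)"
    unfolding c(2) b(2) by (simp add: distrib_right sum.distrib)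
  then show ?thesis using c(1) b(1) adjoinI[of "\<lambda>i. c i + b i" A] subring_setD(4)[OF A] by simp
qed

lemma adjoin_sum:
  assumes "subring_set A" "\<And>i. i \<in> S \<Longrightarrow> f i \<in> adjoin A x" shows "sum f S \<in> adjoin A x"
  using assms(2)
  by (induction S rule: infinite_finite_induct)
    (auto intro: adjoin_add[OF assms(1)] adjoin_coeff[OF assms(1)] subring_setD[OF assms(1)])

lemma adjoin_monom:
  assumes "subring_set A" "a \<in> A" shows "a * x ^ n \<in> adjoin A x"
  using adjoinI[of "\<lambda>i. if i = n then a else 0" A x "Suc n"] assms(2) subring_setD(1)[OF assms(1)]
  by (simp add: if_distribR sum.delta cong: if_cong)

lemma adjoin_mult:
  assumes A: "subring_set A" and f: "f \<in> adjoin A x" and g: "g \<in> adjoin A x"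
  shows "f * g \<in> adjoin A x"
proof -
  obtain d c where c: "\<And>i. c i \<in> A" "f = (\<Sum>i<d. c i * x ^ i)" using f by (rule adjoinE) blast
  obtain e b where b: "\<And>i. b i \<in> A" "g = (\<Sum>i<e. b i * x ^ i)" using g by (rule adjoinE) blast
  have "f * g = (\<Sum>i<d. \<Sum>j<e. (c i * b j) * x ^ (i + j))"
    unfolding c(2) b(2) sum_product by (intro sum.cong refl) (simp add: power_add algebra_simps)
  then show ?thesis
    using c(1) b(1) subring_setD(5)[OF A] by (auto intro!: adjoin_sum[OF A] adjoin_monom[OF A])
qed

lemma subring_set_adjoin:
  assumes A: "subring_set A" shows "subring_set (adjoin A x)"
proof -
  have "- a \<in> adjoin A x" if "a \<in> adjoin A x" for a
    using adjoin_mult[OF A adjoin_coeff[OF A, of "- 1"] that] subring_setD[OF A] by auto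
  then show ?thesis
    unfolding subring_set_def
    using adjoin_add[OF A] adjoin_mult[OF A] adjoin_coeff[OF A] subring_setD(1,2)[OF A] by blast
qed

definition lead_coeffs :: "'a::comm_ring_1 set \<Rightarrow> 'a \<Rightarrow> 'a set \<Rightarrow> nat \<Rightarrow> 'a set" where
  "lead_coeffs A x I d = {a\<in>A. \<exists>c. (\<forall>i. c i \<in> A) \<and> (\<Sum>i<d. c i * x ^ i) + a * x ^ d \<in> I}"

lemma lead_coeffsE:
  assumes "a \<in> lead_coeffs A x I d"
  obtains c where "a \<in> A" "\<And>i. c i \<in> A" "(\<Sum>i<d. c i * x ^ i) + a * x ^ d \<in> I"
  using assms unfolding lead_coeffs_def by blast

lemma lead_coeffsI:
  "a \<in> A \<Longrightarrow> (\<And>i. c i \<in> A) \<Longrightarrow> (\<Sum>i<d. c i * x ^ i) + a * x ^ d \<in> I \<Longrightarrow> a \<in> lead_coeffs A x I d"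
  unfolding lead_coeffs_def by blast

lemma lead_coeffs_ideal:
  assumes A: "subring_set A" and I: "ideal_of (adjoin A x) I"
  shows "ideal_of A (lead_coeffs A x I d)"
  unfolding ideal_of_def
proof (intro conjI ballI)
  show "lead_coeffs A x I d \<subseteq> A" unfolding lead_coeffs_def by blast
  show "0 \<in> lead_coeffs A x I d"
    by (rule lead_coeffsI[of _ _ "\<lambda>_. 0"]) (use subring_setD(1)[OF A] ideal_ofD(2)[OF I] in auto)
  fix a assume "a \<in> lead_coeffs A x I d"
  then obtain c where c: "a \<in> A" "\<And>i. c i \<in> A" "(\<Sum>i<d. c i * x ^ i) + a * x ^ d \<in> I"
    by (rule lead_coeffsE) blast
  {
    fix b assume "b \<in> lead_coeffs A x I d"
    then obtain e where e: "b \<in> A" "\<And>i. e i \<in> A" "(\<Sum>i<d. e i * x ^ i) + b * x ^ d \<in> I"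
      by (rule lead_coeffsE) blast
    have "(\<Sum>i<d. (c i + e i) * x ^ i) + (a + b) * x ^ d =
      ((\<Sum>i<d. c i * x ^ i) + a * x ^ d) + ((\<Sum>i<d. e i * x ^ i) + b * x ^ d)"
      by (simp add: algebra_simps sum.distrib)
    then show "a + b \<in> lead_coeffs A x I d"
      using c e subring_setD(4)[OF A] ideal_ofD(3)[OF I]
      by (intro lead_coeffsI[of _ _ "\<lambda>i. c i + e i"]) auto
  }
  fix r assume r: "r \<in> A"
  have "(\<Sum>i<d. (r * c i) * x ^ i) + (r * a) * x ^ d = r * ((\<Sum>i<d. c i * x ^ i) + a * x ^ d)"
    by (simp add: algebra_simps sum_distrib_left)
  then show "r * a \<in> lead_coeffs A x I d"
    using c r subring_setD(5)[OF A] ideal_ofD(4)[OF I adjoin_coeff[OF A r]]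
    by (intro lead_coeffsI[of _ _ "\<lambda>i. r * c i"]) auto
qed

lemma lead_coeffs_mono:
  assumes A: "subring_set A" and I: "ideal_of (adjoin A x) I" and "d \<le> e"
  shows "lead_coeffs A x I d \<subseteq> lead_coeffs A x I e"
proof -
  have "lead_coeffs A x I d \<subseteq> lead_coeffs A x I (Suc d)" for d
  proof
    fix a assume "a \<in> lead_coeffs A x I d"
    then obtain c where c: "a \<in> A" "\<And>i. c i \<in> A" "(\<Sum>i<d. c i * x ^ i) + a * x ^ d \<in> I"
      by (rule lead_coeffsE) blast
    \<comment> \<open>Multiplication by \<open>x\<close> shifts the coefficients up by one and
      leaves the constant term 0.\<close>
    let ?c = "\<lambda>i. case i of 0 \<Rightarrow> 0 | Suc j \<Rightarrow> c j"
    have "(\<Sum>i<Suc d. ?c i * x ^ i) + a * x ^ Suc d = x * ((\<Sum>i<d. c i * x ^ i) + a * x ^ d)"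
      by (subst sum.lessThan_Suc_shift) (simp add: algebra_simps sum_distrib_left)
    then show "a \<in> lead_coeffs A x I (Suc d)"
      using c ideal_ofD(4)[OF I adjoin_var[OF A] c(3)] subring_setD(1)[OF A]
      by (intro lead_coeffsI[of _ _ ?c]) (auto split: nat.split)
  qed
  then show ?thesis using \<open>d \<le> e\<close> by (rule lift_Suc_mono_le)
qed

text \<open>\<open>adjoin A x\<close> need not be a polynomial ring: the classical argument with the ideals of leading
  coefficients never uses that representations are unique. Taking functions for \<open>x\<close> allows an
  induction over the number of variables within one type.\<close>

theorem hilbert_basis:
  assumes A: "subring_set A" and noeth: "noetherian_set A"
  shows "noetherian_set (adjoin A x)"
  unfolding noetherian_set_def
proof (intro allI impI)
  fix I assume I: "ideal_of (adjoin A x) I"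
  let ?L = "lead_coeffs A x"
  have gen: "\<exists>G. finite G \<and> G \<subseteq> K \<and> (\<forall>J. ideal_of A J \<and> G \<subseteq> J \<longrightarrow> K \<subseteq> J)" if "ideal_of A K" for K
    using noeth that unfolding noetherian_set_def by blast
  \<comment> \<open>An increasing union of ideals, finitely generated by assumption; its generators
    already occur at one level \<open>N\<close>, from which on the chain is constant.\<close>
  have "ideal_of A (\<Union>d. ?L I d)"
    unfolding ideal_of_def
  proof (intro conjI ballI)
    show "(\<Union>d. ?L I d) \<subseteq> A" "0 \<in> (\<Union>d. ?L I d)"
      using ideal_ofD(1,2)[OF lead_coeffs_ideal[OF A I]] by blast+
    fix a assume "a \<in> (\<Union>d. ?L I d)"
    then obtain d where a: "a \<in> ?L I d" by blast
    {
      fix b assume "b \<in> (\<Union>d. ?L I d)"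
      then obtain e where "b \<in> ?L I e" by blast
      then have "a \<in> ?L I (max d e)" "b \<in> ?L I (max d e)"
        using a lead_coeffs_mono[OF A I, of d "max d e"] lead_coeffs_mono[OF A I, of e "max d e"] by auto
      then show "a + b \<in> (\<Union>d. ?L I d)" using ideal_ofD(3)[OF lead_coeffs_ideal[OF A I]] by blast
    }
    show "r * a \<in> (\<Union>d. ?L I d)" if "r \<in> A" for r
      using ideal_ofD(4)[OF lead_coeffs_ideal[OF A I] that a] by blast
  qed
  from gen[OF this] obtain G where G: "finite G" "G \<subseteq> (\<Union>d. ?L I d)"
    "\<forall>J. ideal_of A J \<and> G \<subseteq> J \<longrightarrow> (\<Union>d. ?L I d) \<subseteq> J" by (elim exE conjE)
  have "\<exists>N. G \<subseteq> ?L I N"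
    using G(1,2)
  proof (induction G)
    case (insert a G)
    then obtain N d where "G \<subseteq> ?L I N" "a \<in> ?L I d" by blast
    then have "insert a G \<subseteq> ?L I (max N d)"
      using lead_coeffs_mono[OF A I, of N "max N d"] lead_coeffs_mono[OF A I, of d "max N d"] by auto
    then show ?case by blast
  qed simp
  then obtain N where N: "G \<subseteq> ?L I N" by blast
  have stable: "?L I d \<subseteq> ?L I N" for d
    using G(3) N lead_coeffs_ideal[OF A I, of N] by blast
  \<comment> \<open>For each \<open>d\<close>, generators of the ideal of leading coefficients are
    lifted to elements of \<open>I\<close>. Any ideal \<open>J\<close> containing these lifts then
    has the same leading coefficients in common with \<open>I\<close> at that level.\<close>
  have "\<exists>H. finite H \<and> H \<subseteq> I \<and> (\<forall>J. ideal_of (adjoin A x) J \<and> H \<subseteq> J \<longrightarrow> ?L I d \<subseteq> ?L (I \<inter> J) d)" for d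
  proof -
    obtain K where K: "finite K" "K \<subseteq> ?L I d" "\<forall>J. ideal_of A J \<and> K \<subseteq> J \<longrightarrow> ?L I d \<subseteq> J"
      using gen[OF lead_coeffs_ideal[OF A I, of d]] by (elim exE conjE)
    have "\<forall>a\<in>K. \<exists>c. a \<in> A \<and> (\<forall>i. c i \<in> A) \<and> (\<Sum>i<d. c i * x ^ i) + a * x ^ d \<in> I"
      using K(2) unfolding lead_coeffs_def by blast
    from bchoice[OF this] obtain c where
      c: "\<forall>a\<in>K. a \<in> A \<and> (\<forall>i. c a i \<in> A) \<and> (\<Sum>i<d. c a i * x ^ i) + a * x ^ d \<in> I" ..
    let ?H = "(\<lambda>a. (\<Sum>i<d. c a i * x ^ i) + a * x ^ d) ` K"
    have "?L I d \<subseteq> ?L (I \<inter> J) d" if J: "ideal_of (adjoin A x) J" "?H \<subseteq> J" for J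
    proof -
      have "ideal_of (adjoin A x) (I \<inter> J)" using I J(1) unfolding ideal_of_def by blast
      moreover have "K \<subseteq> ?L (I \<inter> J) d"
        using c J(2) by (auto intro!: lead_coeffsI[of _ _ "c _"])
      ultimately show ?thesis using K(3) lead_coeffs_ideal[OF A] by blast
    qed
    then show ?thesis using K(1) c by (intro exI[of _ ?H]) auto
  qed
  then obtain H where H: "\<And>d. finite (H d)" "\<And>d. H d \<subseteq> I"
    "\<And>d J. ideal_of (adjoin A x) J \<Longrightarrow> H d \<subseteq> J \<Longrightarrow> ?L I d \<subseteq> ?L (I \<inter> J) d" by metis
  have "I \<subseteq> J" if J: "ideal_of (adjoin A x) J" "(\<Union>d\<le>N. H d) \<subseteq> J" for J
  proof -
    have IJ: "ideal_of (adjoin A x) (I \<inter> J)" using I J(1) unfolding ideal_of_def by blast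
    have L: "?L I d \<subseteq> ?L (I \<inter> J) d" for d
    proof (cases "d \<le> N")
      case True
      then show ?thesis using H(3)[OF J(1), of d] J(2) by blast
    next
      case False
      have "?L I d \<subseteq> ?L I N" by (rule stable)
      also have "\<dots> \<subseteq> ?L (I \<inter> J) N" using H(3)[OF J(1), of N] J(2) by blast
      also have "\<dots> \<subseteq> ?L (I \<inter> J) d" using lead_coeffs_mono[OF A IJ] False by simp
      finally show ?thesis .
    qed
    have B: "subring_set (adjoin A x)" by (rule subring_set_adjoin[OF A])
    \<comment> \<open>Descent on the number of terms: an element of \<open>I \<inter> J\<close> with
      the same top term is subtracted, leaving an element of \<open>I\<close> with one term
      fewer.\<close>
    have "(\<Sum>i<d. c i * x ^ i) \<in> J" if "\<forall>i. c i \<in> A" "(\<Sum>i<d. c i * x ^ i) \<in> I" for c d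
      using that
    proof (induction d arbitrary: c)
      case 0
      then show ?case using ideal_ofD(2)[OF J(1)] by simp
    next
      case (Suc d)
      have f: "(\<Sum>i<d. c i * x ^ i) + c d * x ^ d \<in> I" using Suc.prems(2) by simp
      then have "c d \<in> ?L I d" using Suc.prems(1) by (intro lead_coeffsI[of _ _ c]) auto
      then have "c d \<in> ?L (I \<inter> J) d" using L by blast
      then obtain e where e: "\<And>i. e i \<in> A" "(\<Sum>i<d. e i * x ^ i) + c d * x ^ d \<in> I \<inter> J"
        by (rule lead_coeffsE) blast
      have eq: "(\<Sum>i<d. (c i - e i) * x ^ i) =
        ((\<Sum>i<d. c i * x ^ i) + c d * x ^ d) - ((\<Sum>i<d. e i * x ^ i) + c d * x ^ d)"
        by (simp add: algebra_simps sum_subtractf)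
      have "(\<Sum>i<d. (c i - e i) * x ^ i) \<in> J"
      proof (rule Suc.IH)
        show "\<forall>i. c i - e i \<in> A"
          using Suc.prems(1) e(1) subring_setD(3,4)[OF A] by (metis add_uminus_conv_diff)
        show "(\<Sum>i<d. (c i - e i) * x ^ i) \<in> I"
          unfolding eq using ideal_of_diff[OF B I f] e(2) by blast
      qed
      then have "(\<Sum>i<d. (c i - e i) * x ^ i) + ((\<Sum>i<d. e i * x ^ i) + c d * x ^ d) \<in> J"
        using ideal_ofD(3)[OF J(1)] e(2) by blast
      then show ?case unfolding eq by simp
    qed
    note in_J = this
    show "I \<subseteq> J"
    proof
      fix f assume f: "f \<in> I"
      then have "f \<in> adjoin A x" using ideal_ofD(1)[OF I] by blast
      then obtain d c where "\<And>i. c i \<in> A" "f = (\<Sum>i<d. c i * x ^ i)" by (rule adjoinE) blast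
      then show "f \<in> J" using in_J f by blast
    qed
  qed
  then show "\<exists>G. finite G \<and> G \<subseteq> I \<and> (\<forall>J. ideal_of (adjoin A x) J \<and> G \<subseteq> J \<longrightarrow> I \<subseteq> J)"
    using H(1,2) by (intro exI[of _ "\<Union>d\<le>N. H d"] conjI finite_UN_I UN_least) auto
qed

text \<open>The finitely many generators of the ideal spanned by \<open>M\<close> each depend on
  finitely many elements of \<open>M\<close>; collecting these gives \<open>T\<close>. This is the
  form behind quasi-compactness.\<close>

lemma noetherian_set_finite_subset:
  assumes A: "subring_set A" and noeth: "noetherian_set A" and M: "M \<subseteq> A"
  shows "\<exists>T. finite T \<and> T \<subseteq> M \<and> (\<forall>J. ideal_of A J \<and> T \<subseteq> J \<longrightarrow> M \<subseteq> J)"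
proof -
  \<comment> \<open>Membership in the ideal generated by a finite part of \<open>M\<close>;
    \<open>K\<close> is then the ideal generated by \<open>M\<close>, the finite parts being united
    when sums are taken.\<close>
  define gen where "gen T a \<longleftrightarrow> finite T \<and> T \<subseteq> M \<and> (\<forall>J. ideal_of A J \<and> T \<subseteq> J \<longrightarrow> a \<in> J)" for T a
  define K where "K = {a\<in>A. \<exists>T. gen T a}"
  have "gen {a} a" if "a \<in> M" for a using that unfolding gen_def by simp
  then have MK: "M \<subseteq> K" unfolding K_def using M by blast
  have "ideal_of A K"
    unfolding ideal_of_def
  proof (intro conjI ballI)
    show "K \<subseteq> A" unfolding K_def by blast
    have "gen {} 0" unfolding gen_def using ideal_ofD(2) by blast
    then show "0 \<in> K" unfolding K_def using subring_setD(1)[OF A] by blast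
    fix a assume "a \<in> K"
    then obtain S where a: "a \<in> A" "gen S a" unfolding K_def by blast
    {
      fix b assume "b \<in> K"
      then obtain T where b: "b \<in> A" "gen T b" unfolding K_def by blast
      have "gen (S \<union> T) (a + b)"
        using a(2) b(2) unfolding gen_def by (auto intro: ideal_ofD(3))
      then show "a + b \<in> K" unfolding K_def using subring_setD(4)[OF A a(1) b(1)] by blast
    }
    fix r assume r: "r \<in> A"
    have "gen S (r * a)" using a(2) r unfolding gen_def by (auto intro: ideal_ofD(4))
    then show "r * a \<in> K" unfolding K_def using subring_setD(5)[OF A r a(1)] by blast
  qed
  from noeth[unfolded noetherian_set_def, rule_format, OF this]
  obtain G where G: "finite G" "G \<subseteq> K" "\<forall>J. ideal_of A J \<and> G \<subseteq> J \<longrightarrow> K \<subseteq> J"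
    by (elim exE conjE) simp
  have "\<forall>a\<in>G. \<exists>T. gen T a" using G(2) unfolding K_def by blast
  from bchoice[OF this] obtain T where T: "\<forall>a\<in>G. gen (T a) a" ..
  have "M \<subseteq> J" if J: "ideal_of A J" "(\<Union>a\<in>G. T a) \<subseteq> J" for J
  proof -
    have "G \<subseteq> J" using T J unfolding gen_def by blast
    then show ?thesis using G(3) J(1) MK by blast
  qed
  then show ?thesis using T G(1) unfolding gen_def by (intro exI[of _ "\<Union>a\<in>G. T a"]) auto
qed

section \<open>Polynomial functions in finitely many variables and quasi-compactness\<close>

fun coord_ring :: "nat \<Rightarrow> ((nat \<Rightarrow> 'k::field) \<Rightarrow> 'k) set" where
  "coord_ring 0 = range (\<lambda>c _. c)"
| "coord_ring (Suc n) = adjoin (coord_ring n) (\<lambda>v. v n)"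

lemma subring_set_constants: "subring_set (range (\<lambda>(c :: 'k::field) (_ :: nat \<Rightarrow> 'k). c))"
  unfolding subring_set_def
  by (auto simp: zero_fun_def one_fun_def plus_fun_def times_fun_def fun_Compl_def)

lemma noetherian_set_constants: "noetherian_set (range (\<lambda>(c :: 'k::field) (_ :: nat \<Rightarrow> 'k). c))"
  unfolding noetherian_set_def
proof (intro allI impI)
  let ?A = "range (\<lambda>(c :: 'k) (_ :: nat \<Rightarrow> 'k). c)"
  fix I :: "((nat \<Rightarrow> 'k) \<Rightarrow> 'k) set"
  assume I: "ideal_of ?A I"
  show "\<exists>G. finite G \<and> G \<subseteq> I \<and> (\<forall>J. ideal_of ?A J \<and> G \<subseteq> J \<longrightarrow> I \<subseteq> J)"
  proof (cases "I \<subseteq> {0}")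
    case True
    then show ?thesis using ideal_ofD(2) by (intro exI[of _ "{}"]) blast
  next
    case False
    then obtain a where a: "a \<in> I" "a \<noteq> 0" by blast
    obtain c where c: "a = (\<lambda>_. c)" using a(1) ideal_ofD(1)[OF I] by blast
    have "c \<noteq> 0" using a(2) c by (auto simp: zero_fun_def)
    have "I \<subseteq> J" if J: "ideal_of ?A J" "{a} \<subseteq> J" for J
    proof
      fix b assume "b \<in> I"
      then obtain d where d: "b = (\<lambda>_. d)" using ideal_ofD(1)[OF I] by blast
      have "b = (\<lambda>_. d / c) * a" unfolding d c using \<open>c \<noteq> 0\<close> by (simp add: times_fun_def)
      then show "b \<in> J" using ideal_ofD(4)[OF J(1), of "\<lambda>_. d / c" a] J(2) by simp
    qed
    then show ?thesis using a(1) by (intro exI[of _ "{a}"]) simp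
  qed
qed

lemma coord_ring:
  "subring_set (coord_ring n :: ((nat \<Rightarrow> 'k::field) \<Rightarrow> 'k) set)"
  "noetherian_set (coord_ring n :: ((nat \<Rightarrow> 'k) \<Rightarrow> 'k) set)"
proof -
  have "subring_set (coord_ring n :: ((nat \<Rightarrow> 'k) \<Rightarrow> 'k) set) \<and>
      noetherian_set (coord_ring n :: ((nat \<Rightarrow> 'k) \<Rightarrow> 'k) set)"
  proof (induction n)
    case (Suc n)
    then have n: "subring_set (coord_ring n :: ((nat \<Rightarrow> 'k) \<Rightarrow> 'k) set)"
      "noetherian_set (coord_ring n :: ((nat \<Rightarrow> 'k) \<Rightarrow> 'k) set)" by auto
    show ?case
      unfolding coord_ring.simps using subring_set_adjoin[OF n(1)] hilbert_basis[OF n] by (rule conjI)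
  qed (simp add: subring_set_constants noetherian_set_constants)
  then show "subring_set (coord_ring n :: ((nat \<Rightarrow> 'k) \<Rightarrow> 'k) set)"
    "noetherian_set (coord_ring n :: ((nat \<Rightarrow> 'k) \<Rightarrow> 'k) set)" by auto
qed

lemma coord_ring_const: "(\<lambda>_. c) \<in> coord_ring n"
  by (induction n) (auto intro: adjoin_coeff coord_ring)

lemma coord_ring_var: "i < n \<Longrightarrow> (\<lambda>v. v i) \<in> coord_ring n"
proof (induction n)
  case (Suc n)
  then show ?case
    by (cases "i = n") (auto intro: adjoin_coeff adjoin_var coord_ring)
qed simp

lemma sum_fun_apply: "(\<Sum>i\<in>A. f i) v = (\<Sum>i\<in>A. f i v)"
  by (induction A rule: infinite_finite_induct) (auto simp: zero_fun_def plus_fun_def)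

lemma prod_fun_apply: "(\<Prod>i\<in>A. f i) v = (\<Prod>i\<in>A. (f i :: 'a \<Rightarrow> 'b::comm_ring_1) v)"
  by (induction A rule: infinite_finite_induct) (auto simp: one_fun_def times_fun_def)

lemma power_fun_apply: "((f :: 'a \<Rightarrow> 'b::comm_ring_1) ^ n) v = f v ^ n"
  by (induction n) (auto simp: one_fun_def times_fun_def)

text \<open>A form may involve variables of index \<open>n\<close> or more; setting them to 0
  changes nothing at points whose coordinates vanish there.\<close>

lemma hpoly_in_coord_ring:
  assumes "hpoly d F"
  shows "(\<lambda>v. F (\<lambda>i. if i < n then v i else 0)) \<in> coord_ring n"
proof -
  obtain p where p: "F = peval p" using assms by (rule hpolyE)
  define X where "X i = (\<lambda>v :: nat \<Rightarrow> 'a. if i < n then v i else 0)" for i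
  have X: "X i \<in> coord_ring n" for i
    unfolding X_def using coord_ring_var[of i n] coord_ring_const[of 0 n] by (cases "i < n") auto
  have eq: "(\<lambda>v. F (\<lambda>i. if i < n then v i else 0)) = (\<Sum>m\<in>Poly_Mapping.keys p.
      (\<lambda>_. Poly_Mapping.lookup p m) * (\<Prod>i\<in>Poly_Mapping.keys m. X i ^ Poly_Mapping.lookup m i))"
    by (rule ext) (simp add: p peval_def sum_fun_apply prod_fun_apply power_fun_apply times_fun_def X_def)
  show ?thesis unfolding eq
    using X coord_ring_const
    by (intro subring_set_sum subring_set_prod subring_set_power subring_setD(5) coord_ring(1)) auto
qed

lemma ideal_of_vanishing:
  fixes A :: "('a \<Rightarrow> 'b::comm_ring_1) set"
  assumes "subring_set A" shows "ideal_of A {a\<in>A. a v = 0}"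
  unfolding ideal_of_def using subring_setD[OF assms]
  by (auto simp: zero_fun_def plus_fun_def times_fun_def)

text \<open>Finitely many of the forms generate the ideal of all. If these vanish at
  \<open>y\<close>, the ideal of functions vanishing at a representative of \<open>y\<close>
  contains them, hence contains all the forms.\<close>

lemma zariski_quasi_compact:
  assumes S: "S \<subseteq> Pn n" and F: "\<And>z. z \<in> S \<Longrightarrow> hpoly (d z) (F z)"
  shows "\<exists>T. finite T \<and> T \<subseteq> S \<and>
    (\<forall>y\<in>Pn n. \<forall>z\<in>S. (\<forall>v\<in>y. F z v \<noteq> 0) \<longrightarrow> (\<exists>t\<in>T. \<forall>v\<in>y. F t v \<noteq> 0))"
proof -
  \<comment> \<open>\<open>Pn n\<close> has the \<open>n + 1\<close> coordinates with index at most
    \<open>n\<close>.\<close>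
  let ?A = "coord_ring (Suc n)"
  define R where "R z = (\<lambda>v. F z (\<lambda>i. if i < Suc n then v i else 0))" for z
  have "R ` S \<subseteq> ?A" unfolding R_def using hpoly_in_coord_ring[OF F] by blast
  from noetherian_set_finite_subset[OF coord_ring this] obtain M where
    M: "finite M" "M \<subseteq> R ` S" "\<forall>J. ideal_of ?A J \<and> M \<subseteq> J \<longrightarrow> R ` S \<subseteq> J" by (elim exE conjE)
  obtain T where T: "T \<subseteq> S" "finite T" "M = R ` T" using finite_subset_image[OF M(1,2)] by blast
  have "\<exists>t\<in>T. \<forall>v\<in>y. F t v \<noteq> 0" if y: "y \<in> Pn n" "z \<in> S" "\<forall>v\<in>y. F z v \<noteq> 0" for y z
  proof (rule ccontr)
    assume no: "\<not> (\<exists>t\<in>T. \<forall>v\<in>y. F t v \<noteq> 0)"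
    have yPP: "y \<in> PP" using y(1) Pn_subset_PP by blast
    obtain v where v: "v \<in> y" using PP_nonempty[OF yPP] ..
    have "(\<lambda>i. if i < Suc n then v i else 0) = v"
      using Pn_rep(3)[OF y(1) v] by (auto simp: fun_eq_iff)
    then have R: "R t v = F t v" for t by (simp add: R_def)
    have "R t v = 0" if "t \<in> T" for t
    proof -
      have "\<not> (\<forall>v\<in>y. F t v \<noteq> 0)" using no that by simp
      then obtain w where "w \<in> y" "F t w = 0" by auto
      then have "F t v = 0" using hpoly_nonzero_rep[OF F yPP v, of t w] subsetD[OF T(1) that] by simp
      then show ?thesis by (simp add: R)
    qed
    moreover have "ideal_of ?A {a\<in>?A. a v = 0}"
      by (rule ideal_of_vanishing[OF coord_ring(1)])
    moreover have "M \<subseteq> ?A" using M(2) \<open>R ` S \<subseteq> ?A\<close> by blast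
    ultimately have "R ` S \<subseteq> {a\<in>?A. a v = 0}" using M(3) T(3) by blast
    then have "F z v = 0" using y(2) R by auto
    then show False using y(3) v by blast
  qed
  then show ?thesis using T by blast
qed

text \<open>Each isolated point has a basic neighbourhood with no other fixed point, so in a finite
  subcover every isolated point must itself be the centre of a chosen neighbourhood.\<close>

lemma finite_isolated_points:
  assumes X: "X \<subseteq> Pn n"
  shows "finite (isolated_fixed_points X \<sigma>)" (is "finite ?Z")
proof -
  have PP: "X \<subseteq> PP" using X Pn_subset_PP by blast
  have "\<exists>F d. hpoly d F \<and> (\<forall>v\<in>z. F v \<noteq> 0) \<and> (\<forall>y\<in>X. (\<forall>v\<in>y. F v \<noteq> 0) \<longrightarrow> \<sigma> y = y \<longrightarrow> y = z)"
    if "z \<in> ?Z" for z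
  proof -
    obtain U where U: "openin (zar X) U" "z \<in> U" "\<forall>y\<in>U. \<sigma> y = y \<longrightarrow> y = z"
      using \<open>z \<in> ?Z\<close> unfolding isolated_fixed_points_def by blast
    obtain F d where "hpoly d F" "\<forall>v\<in>z. F v \<noteq> 0" "nonvanishing X F \<subseteq> U"
      using U(1,2) unfolding openin_zar_iff[OF PP] by blast
    then show ?thesis using U(3) by (intro exI[of _ F] exI[of _ d]) blast
  qed
  then have "\<forall>z\<in>?Z. \<exists>F d. hpoly d F \<and> (\<forall>v\<in>z. F v \<noteq> 0) \<and>
    (\<forall>y\<in>X. (\<forall>v\<in>y. F v \<noteq> 0) \<longrightarrow> \<sigma> y = y \<longrightarrow> y = z)" by blast
  from bchoice[OF this] obtain F where "\<forall>z\<in>?Z. \<exists>d. hpoly d (F z) \<and> (\<forall>v\<in>z. F z v \<noteq> 0) \<and>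
    (\<forall>y\<in>X. (\<forall>v\<in>y. F z v \<noteq> 0) \<longrightarrow> \<sigma> y = y \<longrightarrow> y = z)" ..
  from bchoice[OF this] obtain d where Fd: "\<forall>z\<in>?Z. hpoly (d z) (F z) \<and> (\<forall>v\<in>z. F z v \<noteq> 0) \<and>
    (\<forall>y\<in>X. (\<forall>v\<in>y. F z v \<noteq> 0) \<longrightarrow> \<sigma> y = y \<longrightarrow> y = z)" ..
  have ZX: "?Z \<subseteq> X" "\<And>z. z \<in> ?Z \<Longrightarrow> \<sigma> z = z" unfolding isolated_fixed_points_def by auto
  have "?Z \<subseteq> Pn n" using ZX(1) X by blast
  moreover have "hpoly (d z) (F z)" if "z \<in> ?Z" for z using Fd that by blast
  ultimately have "\<exists>T. finite T \<and> T \<subseteq> ?Z \<and>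
    (\<forall>y\<in>Pn n. \<forall>z\<in>?Z. (\<forall>v\<in>y. F z v \<noteq> 0) \<longrightarrow> (\<exists>t\<in>T. \<forall>v\<in>y. F t v \<noteq> 0))"
    by (rule zariski_quasi_compact)
  then obtain T where T: "finite T" "T \<subseteq> ?Z"
    "\<forall>y\<in>Pn n. \<forall>z\<in>?Z. (\<forall>v\<in>y. F z v \<noteq> 0) \<longrightarrow> (\<exists>t\<in>T. \<forall>v\<in>y. F t v \<noteq> 0)" by (elim exE conjE)
  have "z \<in> T" if z: "z \<in> ?Z" for z
  proof -
    have "\<forall>v\<in>z. F z v \<noteq> 0" using bspec[OF Fd z] by simp
    then have "\<exists>t\<in>T. \<forall>v\<in>z. F t v \<noteq> 0"
      using bspec[OF bspec[OF T(3) subsetD[OF \<open>?Z \<subseteq> Pn n\<close> z]] z] by simp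
    then obtain t where t: "t \<in> T" "\<forall>v\<in>z. F t v \<noteq> 0" ..
    then have "z = t"
      using bspec[OF Fd, of t] subsetD[OF T(2) t(1)] subsetD[OF ZX(1) z] ZX(2)[OF z] by simp
    then show ?thesis using t(1) by simp
  qed
  then show ?thesis using T(1) by (meson finite_subset subsetI)
qed

lemma closedin_finite:
  assumes "X \<subseteq> Pn n" "finite Z" "Z \<subseteq> X" shows "closedin (zar X) Z"
proof -
  have "closedin (zar X) (\<Union>z\<in>Z. {z})"
    using assms by (intro closedin_Union) (auto intro: closedin_point)
  then show ?thesis by simp
qed

section \<open>Local rings of the projective line\<close>

text \<open>Used for \<open>i \<le> 1\<close> only, where \<open>1 - i\<close> is the index of the other coordinate.\<close>

definition pvec :: "nat \<Rightarrow> 'k::field \<Rightarrow> nat \<Rightarrow> 'k" where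
  "pvec i t = (\<lambda>k. if k = i then 1 else if k = 1 - i then t else 0)"

lemma pcls_pvec: "i \<le> 1 \<Longrightarrow> pcls (pvec i t) \<in> P1"
  by (rule PnI[where i = i]) (auto simp: pvec_def)

text \<open>The normalised representative, with entry 1 at index \<open>i\<close>; on it forms
  become polynomials in one variable.\<close>

lemma P1_chart:
  assumes q: "q \<in> P1" and i: "i \<le> 1" and v: "v \<in> q" "v i \<noteq> 0"
  shows "pvec i (coord_ratio i (1 - i) q) \<in> q"
proof -
  have qPP: "q \<in> PP" using q Pn_subset_PP by blast
  have eq: "q = pcls v" by (rule PP_rep(1)[OF qPP v(1)])
  have zero: "v j = 0" if "j > 1" for j by (rule Pn_rep(3)[OF q v(1) that])
  have "pvec i (v (1 - i) / v i) = (\<lambda>k. inverse (v i) * v k)"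
  proof
    fix k
    have "k = i \<or> k = 1 - i \<or> k > 1" using i by arith
    then show "pvec i (v (1 - i) / v i) k = inverse (v i) * v k"
      using v(2) zero[of k] i by (auto simp: pvec_def field_simps)
  qed
  then have "pvec i (v (1 - i) / v i) \<in> pcls v" using v(2) by (intro pcls_memI[of "inverse (v i)"]) auto
  then show ?thesis unfolding coord_ratio_eq[OF qPP v(1)] by (simp only: eq)
qed

lemma hpoly_univariate:
  assumes "hpoly d F" shows "\<exists>a. \<forall>t. poly a t = F (pvec i t)"
proof -
  obtain p where p: "F = peval p" using assms by (rule hpolyE)
  define e where "e k = (if k = i then 1 else if k = 1 - i then [:0, 1:] else 0 :: 'a poly)" for k
  have e: "poly (e k) t = pvec i t k" for k t by (simp add: e_def pvec_def)
  show ?thesis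
    by (rule exI[of _ "\<Sum>m\<in>Poly_Mapping.keys p. smult (Poly_Mapping.lookup p m)
        (\<Prod>k\<in>Poly_Mapping.keys m. e k ^ Poly_Mapping.lookup m k)"])
      (simp add: p peval_def poly_sum poly_prod e)
qed

lemma ex_chart:
  assumes "q \<in> P1" "v \<in> q" obtains i where "i \<le> 1" "v i \<noteq> 0"
proof -
  obtain i where i: "v i \<noteq> 0" using Pn_rep(2)[OF assms] ..
  then have "i \<le> 1" using Pn_rep(3)[OF assms, of i] by force
  with i show ?thesis by (rule that[rotated])
qed

text \<open>A form vanishing on the whole chart around \<open>[1:0]\<close> could be nonzero only at \<open>[0:1]\<close>; in the other
  chart it is a polynomial with infinitely many zeros.\<close>

lemma hpoly_nonzero_P1:
  fixes F :: "(nat \<Rightarrow> 'k::field_char_0) \<Rightarrow> 'k"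
  assumes F: "hpoly d F" and q: "q \<in> P1" "v \<in> q" "F v \<noteq> 0"
    and a: "\<forall>t. poly a t = F (pvec 0 t)"
  shows "a \<noteq> 0"
proof
  assume a0: "a = 0"
  obtain b where b: "\<forall>t. poly b t = F (pvec 1 t)" using hpoly_univariate[OF F] ..
  obtain i where i: "i \<le> 1" "v i \<noteq> 0" using ex_chart[OF q(1,2)] .
  have "q \<in> PP" using q(1) Pn_subset_PP by blast
  then have ne: "F (pvec i (coord_ratio i (1 - i) q)) \<noteq> 0"
    using hpoly_nonzero_rep[OF F _ q(2) P1_chart[OF q(1) i(1) q(2) i(2)]] q(3) by blast
  then have i1: "i = 1" using a a0 i(1) by (cases "i = 0") auto
  then have "b \<noteq> 0" using ne b by auto
  \<comment> \<open>The extra factor forces \<open>t\<close> to be nonzero, so that [t:1] is also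
    the point [1:1/t] of the other chart.\<close>
  then have "b * [:0, 1:] \<noteq> 0" by simp
  then obtain t where t: "poly b t * t \<noteq> 0"
    using poly_all_0_iff_0[of "b * [:0, 1:]"] by auto
  have "pvec 1 t = (\<lambda>k. t * pvec 0 (1 / t) k)" using t by (auto simp: pvec_def fun_eq_iff)
  then have "F (pvec 1 t) = t ^ d * F (pvec 0 (1 / t))" using hpoly_scale[OF F] by simp
  moreover have "F (pvec 0 (1 / t)) = 0" using a a0 by (metis poly_0)
  ultimately show False using b t by simp
qed

text \<open>A nonempty open set contains all points [1:t] off the zeros of some nonzero polynomial,
  and the product of two such polynomials is nonzero somewhere because the field is
  infinite.\<close>

lemma irreducible_variety_P1: "irreducible_variety (P1 :: 'k::field_char_0 pt set)"
proof
  show "P1 \<subseteq> (PP :: 'k pt set)" by (rule Pn_subset_PP)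
  show "irreducible_space (zar (P1 :: 'k pt set))"
  proof (rule irreducible_spaceI)
    have "pcls (pvec 0 0) \<in> (P1 :: 'k pt set)" by (rule pcls_pvec) simp
    then show "topspace (zar (P1 :: 'k pt set)) \<noteq> {}"
      unfolding topspace_zar[OF Pn_subset_PP] by blast
    have nonzero: "\<exists>a. a \<noteq> 0 \<and> (\<forall>t. poly a t \<noteq> 0 \<longrightarrow> pcls (pvec 0 t) \<in> A)"
      if A: "openin (zar P1) A" "A \<noteq> {}" for A :: "'k pt set"
    proof -
      obtain q where q: "q \<in> A" using A(2) by blast
      have qP: "q \<in> P1" using q openin_zar_subset[OF A(1)] by blast
      obtain F d where F: "hpoly d F" "\<forall>v\<in>q. F v \<noteq> 0" "nonvanishing P1 F \<subseteq> A"
        using A(1) q unfolding openin_zar_iff[OF Pn_subset_PP] by blast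
      obtain v where v: "v \<in> q" using PP_nonempty qP Pn_subset_PP by blast
      obtain a where a: "\<forall>t. poly a t = F (pvec 0 t)" using hpoly_univariate[OF F(1)] ..
      have "a \<noteq> 0" using hpoly_nonzero_P1[OF F(1) qP v _ a] F(2) v by blast
      moreover have "pcls (pvec 0 t) \<in> A" if "poly a t \<noteq> 0" for t
      proof -
        have P: "pcls (pvec 0 t) \<in> P1" by (rule pcls_pvec) simp
        have "F (pvec 0 t) \<noteq> 0" using a that by simp
        then have "\<forall>w\<in>pcls (pvec 0 t). F w \<noteq> 0"
          using hpoly_nonzero_rep[OF F(1) subsetD[OF Pn_subset_PP P] pcls_self] by blast
        then show ?thesis using P F(3) by blast
      qed
      ultimately show ?thesis by blast
    qed
    fix A B :: "'k pt set" assume "openin (zar P1) A" "openin (zar P1) B" "A \<noteq> {}" "B \<noteq> {}"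
    then obtain a b where a: "a \<noteq> 0" "\<forall>t. poly a t \<noteq> 0 \<longrightarrow> pcls (pvec 0 t) \<in> A"
      and b: "b \<noteq> 0" "\<forall>t. poly b t \<noteq> 0 \<longrightarrow> pcls (pvec 0 t) \<in> B" using nonzero by metis
    have "a * b \<noteq> 0" using a(1) b(1) by simp
    then obtain t where "poly (a * b) t \<noteq> 0" using poly_all_0_iff_0[of "a * b"] by blast
    then have "pcls (pvec 0 t) \<in> A \<inter> B" using a(2) b(2) by simp
    then show "A \<inter> B \<noteq> {}" by blast
  qed
qed

lemma regular_poly:
  assumes "regular V U r" shows "regular V U (\<lambda>x. poly a (r x))"
proof (induction a)
  case 0
  then show ?case using regular_const[OF regular_openin[OF assms]] by simp
next
  case (pCons c a)
  then show ?case
    using regular_add'[OF regular_const[OF regular_openin[OF assms]] regular_mult'[OF assms]] by simp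
qed

text \<open>The stalks of the structure sheaf are discrete valuation rings; \<open>coord_ratio i (1 - i) q - c\<close> is a
  local parameter.\<close>

definition germ_order :: "nat \<Rightarrow> 'k::field pt \<Rightarrow> ('k pt \<Rightarrow> 'k) \<Rightarrow> nat \<Rightarrow> bool" where
  "germ_order i p f m \<longleftrightarrow> (\<exists>U u. p \<in> U \<and> regular P1 U u \<and> (\<forall>q\<in>U. u q \<noteq> 0) \<and>
     (\<forall>q\<in>U. f q = (coord_ratio i (1 - i) q - coord_ratio i (1 - i) p) ^ m * u q))"

text \<open>Near \<open>p\<close> the function is a quotient of polynomials \<open>a\<close> and
  \<open>b\<close> in the chart coordinate \<open>r\<close>, with denominator nonzero at
  \<open>p\<close>; the order is the multiplicity of \<open>r p\<close> as a root of
  \<open>a\<close>.\<close>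

lemma ex_germ_order:
  fixes p :: "'k::field_char_0 pt"
  assumes p: "p \<in> P1" and i: "i \<le> 1" "v \<in> p" "v i \<noteq> 0"
    and f: "regular P1 U f" "p \<in> U" and ne: "\<not> eq_near P1 p f (\<lambda>_. 0)"
  shows "\<exists>m. germ_order i p f m"
proof -
  define r :: "'k pt \<Rightarrow> 'k" where "r = coord_ratio i (1 - i)"
  let ?T = "{q\<in>P1. \<forall>v\<in>q. v i \<noteq> 0} :: 'k pt set"
  have r: "regular P1 ?T r" unfolding r_def by (rule regular_coord_ratio[OF Pn_subset_PP])
  have pT: "p \<in> ?T"
    using p hpoly_nonzero_rep[OF hpoly_var subsetD[OF Pn_subset_PP p] i(2), of _ i] i(3) by blast
  obtain W P Q d where W: "openin (zar P1) W" "p \<in> W" "W \<subseteq> U" "hpoly d P" "hpoly d Q" "fraction_on W P Q f"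
    using regularE[OF f] .
  obtain a where a: "\<forall>t. poly a t = P (pvec i t)" using hpoly_univariate[OF W(4)] ..
  obtain b where b: "\<forall>t. poly b t = Q (pvec i t)" using hpoly_univariate[OF W(5)] ..
  define N where "N = W \<inter> ?T"
  have N: "openin (zar P1) N" "p \<in> N"
    unfolding N_def using W(1,2) pT regular_openin[OF r] by auto
  have fr: "poly b (r q) \<noteq> 0" "f q = poly a (r q) / poly b (r q)" if q: "q \<in> N" for q
  proof -
    have qP: "q \<in> P1" and qW: "q \<in> W" using q by (auto simp: N_def)
    obtain w where w: "w \<in> q" using PP_nonempty qP Pn_subset_PP by blast
    have "w i \<noteq> 0" using q w by (auto simp: N_def)
    then have "pvec i (r q) \<in> q" unfolding r_def using P1_chart[OF qP i(1) w] by blast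
    from fraction_onD[OF W(6) qW this] a b
    show "poly b (r q) \<noteq> 0" "f q = poly a (r q) / poly b (r q)" by simp_all
  qed
  have "a \<noteq> 0"
  proof
    assume "a = 0"
    then have "eq_near P1 p f (\<lambda>_. 0)" unfolding eq_near_def using N fr(2) by (intro exI[of _ N]) simp
    with ne show False ..
  qed
  then obtain a' where a': "a = [:- r p, 1:] ^ Polynomial.order (r p) a * a'" "\<not> [:- r p, 1:] dvd a'"
    using order_decomp by blast
  have a'p: "poly a' (r p) \<noteq> 0" using a'(2) by (simp add: poly_eq_0_iff_dvd)
  have rN: "regular P1 N r" by (rule regular_subset[OF r N(1)]) (simp add: N_def)
  have u: "regular P1 N (\<lambda>q. poly a' (r q) * inverse (poly b (r q)))"
    by (intro regular_mult' regular_inverse regular_poly rN Pn_subset_PP fr(1))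
  \<comment> \<open>Shrinking to where the cofactor is nonzero turns it into the required
    unit.\<close>
  define N' where "N' = {q\<in>N. poly a' (r q) * inverse (poly b (r q)) \<noteq> 0}"
  have N': "openin (zar P1) N'" unfolding N'_def by (rule regular_nonzero_open[OF u Pn_subset_PP])
  have "p \<in> N'" unfolding N'_def using N(2) a'p fr(1)[OF N(2)] by simp
  moreover have "regular P1 N' (\<lambda>q. poly a' (r q) * inverse (poly b (r q)))"
    by (rule regular_subset[OF u N']) (auto simp: N'_def)
  moreover have "f q = (r q - r p) ^ Polynomial.order (r p) a * (poly a' (r q) * inverse (poly b (r q)))" if "q \<in> N'" for q
  proof -
    have "poly a (r q) = (r q - r p) ^ Polynomial.order (r p) a * poly a' (r q)"
      by (subst a'(1)) (simp add: algebra_simps)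
    then show ?thesis using fr(2)[of q] that by (simp add: N'_def field_simps)
  qed
  ultimately have "germ_order i p f (Polynomial.order (r p) a)"
    unfolding germ_order_def r_def[symmetric]
    by (intro exI[of _ N'] exI[of _ "\<lambda>q. poly a' (r q) * inverse (poly b (r q))"]) (auto simp: N'_def)
  then show ?thesis ..
qed

section \<open>Lifting sections to the blow-up\<close>

text \<open>A form vanishing on \<open>Z\<close> but not at \<open>y\<close>, divided by the
  \<open>d\<close>-th power of a coordinate nonzero at \<open>x\<close>, is regular near
  \<open>x\<close> and lies in the ideal. As \<open>y\<close> need not lie in the chart
  \<open>A\<close> of \<open>x\<close>, its neighbourhood \<open>B\<close> is kept separate.\<close>

lemma ideal_section_separating:
  assumes X: "X \<subseteq> PP" and Z: "closedin (zar X) Z" and x: "x \<in> X" and y: "y \<in> X" "y \<notin> Z"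
  obtains A f B where "x \<in> A" "ideal_section X Z A f" "openin (zar X) B" "y \<in> B"
    "\<forall>w\<in>A \<inter> B. f w \<noteq> 0"
proof -
  have "openin (zar X) (X - Z)"
    using Z unfolding closedin_def topspace_zar[OF X] by blast
  then obtain F d where F: "hpoly d F" "\<forall>v\<in>y. F v \<noteq> 0" "nonvanishing X F \<subseteq> X - Z"
    using y unfolding openin_zar_iff[OF X] by blast
  obtain v k where v: "x = pcls v" "v k \<noteq> 0" using PP_cases[OF subsetD[OF X x]] .
  define A where "A = {w\<in>X. \<forall>v\<in>w. v k \<noteq> 0}"
  define f where "f w = F (SOME v. v \<in> w) / (SOME v. v \<in> w) k ^ d" for w
  have f: "f w = F u / u k ^ d" if w: "w \<in> X" "u \<in> w" for w u
  proof -
    have "(SOME v. v \<in> w) \<in> w" using w(2) by (rule someI[of "\<lambda>v. v \<in> w"])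
    then have "(SOME v. v \<in> w) \<in> pcls u" using PP_rep(1)[OF subsetD[OF X w(1)] w(2)] by simp
    then obtain c where c: "c \<noteq> 0" "(SOME v. v \<in> w) = (\<lambda>i. c * u i)" by (rule pcls_memE)
    show ?thesis unfolding f_def c(2) hpoly_scale[OF F(1)] using c(1) by (simp add: power_mult_distrib)
  qed
  have "openin (zar X) A" unfolding A_def by (rule openin_zar_nonzero[OF hpoly_var X])
  moreover have "hpoly d (\<lambda>u. u k ^ d :: 'a)" using hpoly_power[OF hpoly_var, of d k] by simp
  moreover have "fraction_on A F (\<lambda>u. u k ^ d) f"
    using f by (intro fraction_onI) (auto simp: A_def)
  ultimately have "regular X A f" using F(1) by (intro regularI) (assumption, intro exI[of _ A] exI[of _ F] exI[of _ "\<lambda>u. u k ^ d"] exI[of _ d] conjI order.refl)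
  moreover have "f w = 0" if "w \<in> A \<inter> Z" for w
  proof -
    have wX: "w \<in> X" using that by (simp add: A_def)
    have "\<not> (\<forall>v\<in>w. F v \<noteq> 0)" using subsetD[OF F(3), of w] wX that by auto
    then obtain u where "u \<in> w" "F u = 0" by auto
    then show ?thesis using f[OF wX] by simp
  qed
  ultimately have "ideal_section X Z A f" by (simp add: ideal_section_def)
  moreover have "x \<in> A" using x v by (auto simp: A_def mem_pcls)
  moreover have "openin (zar X) (nonvanishing X F)" by (rule openin_zar_nonzero[OF F(1) X])
  moreover have "\<forall>w\<in>A \<inter> nonvanishing X F. f w \<noteq> 0"
  proof
    fix w assume w: "w \<in> A \<inter> nonvanishing X F"
    obtain u where u: "u \<in> w" using PP_nonempty w X by blast
    then show "f w \<noteq> 0" using f[of w u] w by (auto simp: A_def)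
  qed
  moreover have "y \<in> nonvanishing X F" using y F(2) by blast
  ultimately show ?thesis using that[of A f "nonvanishing X F"] by simp
qed

text \<open>Among the pullbacks of sections of the ideal, one of minimal order at \<open>p\<close> divides all others.\<close>

lemma invertible_inverse_image_P1:
  fixes X :: "'k::field_char_0 pt set"
  assumes X: "X \<subseteq> PP" and Z: "closedin (zar X) Z" and s: "morphism P1 X s"
    and q0: "q0 \<in> P1" "s q0 \<notin> Z"
  shows "invertible_inverse_image X Z P1 s"
proof (rule invertible_inverse_imageI[OF Pn_subset_PP s])
  interpret P1: irreducible_variety "P1 :: 'k pt set" by (rule irreducible_variety_P1)
  fix p :: "'k pt" assume p: "p \<in> P1"
  obtain v where v: "v \<in> p" using PP_nonempty p Pn_subset_PP by blast
  obtain i where i: "i \<le> 1" "v i \<noteq> 0" using ex_chart[OF p v] .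
  define good where "good A f \<longleftrightarrow> s p \<in> A \<and> ideal_section X Z A f" for A f
  have reg: "regular P1 {q\<in>P1. s q \<in> A} (\<lambda>q. f (s q))" "p \<in> {q\<in>P1. s q \<in> A}" if "good A f" for A f
    using that p morphism_regular[OF s] by (auto simp: good_def ideal_section_def)
  obtain A0 f0 B where A0: "s p \<in> A0" "ideal_section X Z A0 f0" "openin (zar X) B" "s q0 \<in> B"
    "\<forall>w\<in>A0 \<inter> B. f0 w \<noteq> 0"
    using ideal_section_separating[OF X Z morphism_in[OF s p] morphism_in[OF s q0(1)] q0(2)] .
  have g0: "good A0 f0" using A0 by (simp add: good_def)
  \<comment> \<open>If the pullback vanished near \<open>p\<close>, that neighbourhood would by
    irreducibility of the line meet the preimage of \<open>B\<close>, and \<open>f0\<close> has no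
    zeros on \<open>A0 \<inter> B\<close>.\<close>
  have "\<not> eq_near P1 p (\<lambda>q. f0 (s q)) (\<lambda>_. 0)"
  proof
    assume "eq_near P1 p (\<lambda>q. f0 (s q)) (\<lambda>_. 0)"
    then obtain N where N: "openin (zar P1) N" "p \<in> N" "\<forall>q\<in>N. f0 (s q) = 0" unfolding eq_near_def by blast
    let ?A = "{q\<in>P1. s q \<in> A0}" let ?B = "{q\<in>P1. s q \<in> B}"
    have A: "openin (zar P1) ?A" "p \<in> ?A" using reg[OF g0] by (auto dest: regular_openin)
    have B: "openin (zar P1) ?B" by (rule morphism_preimage_open[OF s A0(3) Pn_subset_PP])
    have "N \<inter> ?A \<noteq> {}" using N(2) A(2) by blast
    moreover have "?B \<noteq> {}" using A0(4) q0(1) by blast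
    ultimately have "(N \<inter> ?A) \<inter> ?B \<noteq> {}"
      using P1.opens_meet[OF openin_Int[OF N(1) A(1)] B] by blast
    then obtain q where "q \<in> N" "s q \<in> A0" "s q \<in> B" by blast
    then show False using N(3) A0(5) by blast
  qed
  from ex_germ_order[OF p i(1) v i(2) reg[OF g0] this]
  have ex: "\<exists>m A f. good A f \<and> \<not> eq_near P1 p (\<lambda>q. f (s q)) (\<lambda>_. 0) \<and> germ_order i p (\<lambda>q. f (s q)) m"
    using g0 \<open>\<not> eq_near P1 p (\<lambda>q. f0 (s q)) (\<lambda>_. 0)\<close> by blast
  define m where "m = (LEAST m. \<exists>A f. good A f \<and> \<not> eq_near P1 p (\<lambda>q. f (s q)) (\<lambda>_. 0) \<and> germ_order i p (\<lambda>q. f (s q)) m)"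
  obtain A f where A: "good A f" "\<not> eq_near P1 p (\<lambda>q. f (s q)) (\<lambda>_. 0)" "germ_order i p (\<lambda>q. f (s q)) m"
    using LeastI_ex[OF ex] unfolding m_def[symmetric] by (elim exE conjE)
  have min: "m \<le> m'" if "good A' f'" "\<not> eq_near P1 p (\<lambda>q. f' (s q)) (\<lambda>_. 0)" "germ_order i p (\<lambda>q. f' (s q)) m'" for A' f' m'
    unfolding m_def by (rule Least_le) (use that in blast)
  define r where "r q = coord_ratio i (1 - i) q - coord_ratio i (1 - i) p" for q
  obtain U u where u: "p \<in> U" "regular P1 U u" "\<forall>q\<in>U. u q \<noteq> 0" "\<forall>q\<in>U. f (s q) = r q ^ m * u q"
    using A(3) unfolding germ_order_def r_def[symmetric] by (elim exE conjE)
  have "\<exists>g. regular_at P1 p g \<and> eq_near P1 p (\<lambda>q. f' (s q)) (\<lambda>q. g q * f (s q))" if g': "good A' f'" for A' f'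
  proof (cases "eq_near P1 p (\<lambda>q. f' (s q)) (\<lambda>_. 0)")
    case True
    then show ?thesis using regular_at_const[OF Pn_subset_PP p, of 0] by (intro exI[of _ "\<lambda>_. 0"]) simp
  next
    case False
    obtain m' where m': "germ_order i p (\<lambda>q. f' (s q)) m'"
      using ex_germ_order[OF p i(1) v i(2) reg[OF g'] False] ..
    have le: "m \<le> m'" by (rule min[OF g' False m'])
    obtain U' u' where u': "p \<in> U'" "regular P1 U' u'" "\<forall>q\<in>U'. f' (s q) = r q ^ m' * u' q"
      using m' unfolding germ_order_def r_def[symmetric] by (elim exE conjE)
    let ?T = "{q\<in>P1. \<forall>v\<in>q. v i \<noteq> 0} :: 'k pt set"
    have T: "regular P1 ?T (coord_ratio i (1 - i))" by (rule regular_coord_ratio[OF Pn_subset_PP])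
    have r: "regular P1 ?T r"
      unfolding r_def diff_conv_add_uminus
      by (rule regular_add'[OF T regular_const[OF regular_openin[OF T]]])
    have pT: "p \<in> ?T"
      using p hpoly_nonzero_rep[OF hpoly_var subsetD[OF Pn_subset_PP p] v, of _ i] i(2) by blast
    \<comment> \<open>The quotient of the two germs: the power \<open>r q ^ m\<close> cancels, which
      is possible because \<open>m\<close> is minimal.\<close>
    define g where "g q = r q ^ (m' - m) * u' q * inverse (u q)" for q
    have "regular P1 (?T \<inter> U' \<inter> U) g"
      unfolding g_def using u(3)
      by (intro regular_mult regular_power r u'(2) regular_inverse[OF u(2) Pn_subset_PP]) blast
    then have g: "regular P1 (?T \<inter> U' \<inter> U) g" "p \<in> ?T \<inter> U' \<inter> U" using pT u(1) u'(1) by auto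
    have "f' (s q) = g q * f (s q)" if "q \<in> ?T \<inter> U' \<inter> U" for q
    proof -
      have "r q ^ m' = r q ^ (m' - m) * r q ^ m" using le by (simp flip: power_add)
      then show ?thesis using that u(3,4) u'(3) by (simp add: g_def)
    qed
    then have "eq_near P1 p (\<lambda>q. f' (s q)) (\<lambda>q. g q * f (s q))"
      unfolding eq_near_def using g(2) regular_openin[OF g(1)] by (intro exI[of _ "?T \<inter> U' \<inter> U"]) simp
    then show ?thesis using regular_atI[OF g] by blast
  qed
  then show "principal_at X Z P1 s p"
    using A(1,2) unfolding good_def by (intro exI[of _ A] exI[of _ f]) simp
qed

lemma blow_up_lift_P1:
  fixes X :: "'k::field_char_0 pt set"
  assumes bl: "blow_up X Z Y \<eta>" and X: "X \<subseteq> PP" and Z: "closedin (zar X) Z"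
    and s: "morphism P1 X s" and q: "q \<in> P1" "s q \<notin> Z"
  obtains s' where "morphism P1 Y s'" "\<forall>v\<in>P1. \<eta> (s' v) = s v"
proof -
  interpret P1: irreducible_variety "P1 :: 'k pt set" by (rule irreducible_variety_P1)
  have "closedin (zar P1) (P1 :: 'k pt set)" by (rule closedin_zar_self[OF Pn_subset_PP])
  then have "quasi_projective_variety (P1 :: 'k pt set)"
    by (rule open_in_closed_quasi_projective[OF _ P1.irreducible P1.openin_self P1.nonempty])
  then show ?thesis
    by (rule blow_up_universal[OF bl _ s invertible_inverse_image_P1[OF X Z s q]]) (rule that)
qed

text \<open>A section is injective. If all its points were isolated fixed points, it would run
  through further fixed points of \<open>\<sigma>\<close> near \<open>s p\<close>, against the
  isolation of \<open>s p\<close>.\<close>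

lemma section_avoids_isolated_points:
  fixes X :: "'k::field_char_0 pt set"
  assumes s: "morphism P1 X s" and Es: "\<forall>v\<in>P1. E (s v) = v"
  shows "\<exists>q\<in>P1. s q \<notin> isolated_fixed_points X \<sigma>"
proof (rule ccontr)
  interpret P1: irreducible_variety "P1 :: 'k pt set" by (rule irreducible_variety_P1)
  assume "\<not> ?thesis"
  then have iso: "s q \<in> isolated_fixed_points X \<sigma>" if "q \<in> P1" for q using that by blast
  obtain p :: "'k pt" where p: "p \<in> P1" using P1.nonempty by blast
  obtain N where N: "openin (zar X) N" "s p \<in> N" "\<forall>y\<in>N. \<sigma> y = y \<longrightarrow> y = s p"
    using iso[OF p] unfolding isolated_fixed_points_def by blast
  have "openin (zar P1) {q\<in>P1. s q \<in> N}" by (rule morphism_preimage_open[OF s N(1) Pn_subset_PP])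
  moreover have "openin (zar P1) (P1 - {p})"
    using closedin_point[OF order.refl p] unfolding closedin_def topspace_zar[OF Pn_subset_PP] by blast
  moreover have "{q\<in>P1. s q \<in> N} \<noteq> {}" using p N(2) by blast
  moreover have "P1 - {p} \<noteq> {}"
    using infinite_P1[where 'k = 'k] by (metis Diff_eq_empty_iff finite.emptyI finite_insert finite_subset)
  ultimately obtain q where q: "q \<in> P1" "s q \<in> N" "q \<noteq> p" using P1.opens_meet by blast
  have "\<sigma> (s q) = s q" using iso[OF q(1)] by (simp add: isolated_fixed_points_def)
  then have "s q = s p" using N(3) q(2) by blast
  then show False using Es p q by metis
qed

section \<open>Cubic covers and the action of \<open>\<sigma>\<close> on the base\<close>

lemma cubic_cover_eq:
  assumes "\<forall>P\<in>D. (x P, y P) \<noteq> (0, 0) \<and> h P = hpt (x P) (y P)"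
  shows "cubic_cover D x y = {segre P q | P q. P \<in> D \<and> q \<in> P1 \<and> h P = tau q}"
proof -
  \<comment> \<open>Cross multiplication for the equality of [x P : y P] with the image of [s:t]
    under \<open>tau\<close>; both are genuine points, by assumption and because
    \<open>(s, t)\<close> is nonzero.\<close>
  have *: "s ^ 3 * y P = t ^ 3 * x P \<longleftrightarrow> h P = tau (hpt s t)"
    if P: "P \<in> D" and st: "(s, t) \<noteq> (0, 0)" for P s t
  proof -
    have "(x P, y P) \<noteq> (0, 0)" "h P = hpt (x P) (y P)" using assms P by blast+
    moreover have "(s ^ 3, t ^ 3) \<noteq> (0, 0)" using st by simp
    ultimately show ?thesis unfolding tau_hpt using hpt_eq_iff by (metis mult.commute)
  qed
  show ?thesis
  proof (intro equalityI subsetI)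
    fix c assume "c \<in> cubic_cover D x y"
    then obtain P s t where "c = segre P (hpt s t)" "P \<in> D" "(s, t) \<noteq> (0, 0)" "s ^ 3 * y P = t ^ 3 * x P"
      unfolding cubic_cover_def by blast
    then show "c \<in> {segre P q | P q. P \<in> D \<and> q \<in> P1 \<and> h P = tau q}"
      using * hpt_in_P1 by blast
  next
    fix c assume "c \<in> {segre P q | P q. P \<in> D \<and> q \<in> P1 \<and> h P = tau q}"
    then obtain P q where c: "c = segre P q" "P \<in> D" "q \<in> P1" "h P = tau q" by blast
    obtain s t where "q = hpt s t" "(s, t) \<noteq> (0, 0)" using c(3) by (rule P1_hpt)
    then show "c \<in> cubic_cover D x y"
      unfolding cubic_cover_def using c * by blast
  qed
qed

text \<open>Stated for complements: an irreducible space covered by three closed sets equals one of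
  them.\<close>

lemma irreducible_cover3:
  assumes "irreducible_space T" "openin T A" "openin T B" "openin T C" "A \<inter> B \<inter> C = {}"
  shows "A = {} \<or> B = {} \<or> C = {}"
  using irreducible_opens_meet[OF assms(1,2,3)] irreducible_opens_meet[OF assms(1) openin_Int[OF assms(2,3)] assms(4)]
    assms(5) by blast

lemma primitive_root_square:
  fixes \<zeta> :: "'k::field"
  assumes "1 + \<zeta> + \<zeta>\<^sup>2 = 0" shows "1 + \<zeta>\<^sup>2 + (\<zeta>\<^sup>2)\<^sup>2 = 0"
proof -
  have "1 + \<zeta>\<^sup>2 + (\<zeta>\<^sup>2)\<^sup>2 = (1 + \<zeta> + \<zeta>\<^sup>2) * (1 - \<zeta> + \<zeta>\<^sup>2)"
    by (simp add: algebra_simps power2_eq_square)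
  then show ?thesis using assms by simp
qed

text \<open>Pointwise \<open>F \<circ> \<sigma>\<close> differs from \<open>F\<close> by one of the
  three deck transformations of \<open>tau\<close>; the three coincidence loci in \<open>Y\<close>
  are closed and cover it, so by irreducibility one factor serves everywhere. The factor 1 would
  make every fibre invariant.\<close>

lemma not_type1_imp_scale1:
  fixes X Y :: "'k::field_char_0 pt set"
  assumes X: "X \<subseteq> Pn nX" "irreducible_space (zar X)" and Y: "Y \<subseteq> Pn nY" "irreducible_space (zar Y)"
    and \<sigma>: "isomorphism X X \<sigma>" and \<eta>: "morphism Y X \<eta>" and F: "morphism X P1 F"
    and tau: "\<And>z. z \<in> Y \<Longrightarrow> tau (F (\<eta> z)) = tau (F (\<sigma> (\<eta> z)))"
    and U: "openin (zar X) U" "U \<noteq> {}" "\<And>x. x \<in> U \<Longrightarrow> \<exists>z\<in>Y. \<eta> z = x"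
    and not1: "\<not> fibration_type1 X \<sigma> F" and \<zeta>: "1 + \<zeta> + \<zeta>\<^sup>2 = (0 :: 'k)"
  obtains \<xi> :: 'k where "1 + \<xi> + \<xi>\<^sup>2 = 0" "\<forall>z\<in>Y. F (\<sigma> (\<eta> z)) = scale1 \<xi> (F (\<eta> z))"
proof -
  have PP: "X \<subseteq> PP" "Y \<subseteq> PP" using X Y Pn_subset_PP by blast+
  have \<sigma>m: "morphism X X \<sigma>" using \<sigma> by (simp add: isomorphism_def)
  have F\<eta>: "morphism Y P1 (\<lambda>z. F (\<eta> z))" and F\<sigma>: "morphism X P1 (\<lambda>x. F (\<sigma> x))"
    by (rule morphism_comp[OF \<eta> F] morphism_comp[OF \<sigma>m F])+
  have F\<sigma>\<eta>: "morphism Y P1 (\<lambda>z. F (\<sigma> (\<eta> z)))" by (rule morphism_comp[OF \<eta> F\<sigma>])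
  define N where "N c = {z\<in>Y. F (\<sigma> (\<eta> z)) \<noteq> scale1 c (F (\<eta> z))}" for c
  have N: "openin (zar Y) (N c)" if "c \<noteq> 0" for c
    unfolding N_def
    by (rule neq_open[OF morphism_imp_locpoly[OF F\<sigma>\<eta> PP(2) order.refl]
          morphism_imp_locpoly[OF morphism_comp[OF F\<eta> morphism_scale1[OF that]] PP(2) order.refl] PP(2)])
  have "\<zeta> \<noteq> 0" using \<zeta> by auto
  have "z \<notin> N 1 \<or> z \<notin> N \<zeta> \<or> z \<notin> N (\<zeta>\<^sup>2)" for z
    using tau_eq_imp_scale1[OF \<zeta> morphism_in[OF F\<eta>] morphism_in[OF F\<sigma>\<eta>] tau] unfolding N_def by blast
  then have "N 1 \<inter> N \<zeta> \<inter> N (\<zeta>\<^sup>2) = {}" by blast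
  then have "N 1 = {} \<or> N \<zeta> = {} \<or> N (\<zeta>\<^sup>2) = {}"
    using irreducible_cover3[OF Y(2) N N N, of 1 \<zeta> "\<zeta>\<^sup>2"] \<open>\<zeta> \<noteq> 0\<close> by simp
  moreover have "N 1 \<noteq> {}"
  proof
    assume N1: "N 1 = {}"
    \<comment> \<open>An identity on \<open>Y\<close> only reaches points in the image of
      \<open>\<eta>\<close>; these include \<open>U\<close>, and density extends the identity to
      \<open>X\<close>.\<close>
    have "F (\<sigma> x) = F x" if x: "x \<in> U" for x
    proof -
      obtain z where "z \<in> Y" "\<eta> z = x" using U(3)[OF x] by blast
      then show ?thesis using N1 unfolding N_def scale1_1 by blast
    qed
    then have "{x\<in>X. F (\<sigma> x) \<noteq> F x} \<inter> U = {}" by blast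
    then have "{x\<in>X. F (\<sigma> x) \<noteq> F x} = {}"
      using irreducible_opens_meet[OF X(2) neq_open[OF morphism_imp_locpoly[OF F\<sigma> PP(1) order.refl]
            morphism_imp_locpoly[OF F PP(1) order.refl] PP(1)] U(1)] U(2) by blast
    then have inv: "F (\<sigma> x) = F x" if "x \<in> X" for x using that by blast
    \<comment> \<open>Invariance of \<open>F\<close> only shows that \<open>\<sigma>\<close> maps
      each fibre into itself; the inverse automorphism shows that it maps onto.\<close>
    obtain \<sigma>' where \<sigma>': "morphism X X \<sigma>'" "\<forall>x\<in>X. \<sigma> (\<sigma>' x) = x"
      using \<sigma> unfolding isomorphism_def by blast
    have "\<sigma> ` fibre X F v = fibre X F v" for v
    proof (intro equalityI subsetI)
      show "x \<in> fibre X F v" if "x \<in> \<sigma> ` fibre X F v" for x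
        using that inv morphism_in[OF \<sigma>m] unfolding fibre_def by auto
    next
      fix x assume x: "x \<in> fibre X F v"
      then have *: "\<sigma>' x \<in> X" "\<sigma> (\<sigma>' x) = x" using morphism_in[OF \<sigma>'(1)] \<sigma>'(2) by (auto simp: fibre_def)
      then have "F (\<sigma>' x) = F x" using inv[of "\<sigma>' x"] by simp
      then have "\<sigma>' x \<in> fibre X F v" using x *(1) by (simp add: fibre_def)
      then show "x \<in> \<sigma> ` fibre X F v" using *(2) by (metis imageI)
    qed
    then show False using not1 by (simp add: fibration_type1_def)
  qed
  ultimately consider "N \<zeta> = {}" | "N (\<zeta>\<^sup>2) = {}" by blast
  then show ?thesis
  proof cases
    case 1
    then show ?thesis using that[OF \<zeta>] unfolding N_def by blast
  next
    case 2
    then show ?thesis using that[OF primitive_root_square[OF \<zeta>]] unfolding N_def by blast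
  qed
qed

theorem proposition3p15:
  fixes X Xt Rt R :: "'k :: {alg_closed_field, field_char_0} pt set"
    and \<sigma> \<sigma>t \<eta> \<pi> \<rho> E_X E_Rt E_R E :: "'k pt \<Rightarrow> 'k pt"
    and D :: "'k pt \<Rightarrow> 'k pt set"
    and x y :: "'k pt \<Rightarrow> 'k pt \<Rightarrow> 'k"
  assumes "K3_surface X"
    and "automorphism X \<sigma>" "automorphism_order X \<sigma> 3" "non_symplectic X \<sigma>"
    and "jacobian_fibration X E_X" "fibration_type2 X \<sigma> E_X"
    and "rational_elliptic_surface R E_R" "base_change_by_tau X E_X R E_R"
    and "blow_up X (isolated_fixed_points X \<sigma>) Xt \<eta>"
    and "automorphism Xt \<sigma>t" "\<forall>z\<in>Xt. \<eta> (\<sigma>t z) = \<sigma> (\<eta> z)"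
    and "quotient_by Xt \<sigma>t Rt \<pi>"
    and "morphism Rt P1 E_Rt" "\<forall>z\<in>Xt. E_Rt (\<pi> z) = tau (E_X (\<eta> z))"
    and "relatively_minimal_model Rt E_Rt R E_R \<rho>"
    and "jacobian_fibration X E" "fibration_type1 X \<sigma> E"
    and "\<forall>v\<in>P1. D v = induced_curve Xt \<eta> \<pi> E v"
    and "\<forall>v\<in>P1. \<forall>P\<in>D v. (x v P, y v P) \<noteq> (0, 0) \<and> E_Rt P = hpt (x v P) (y v P)"
  shows "\<exists>C g. C = (\<Union>v\<in>P1. cubic_cover (D v) (x v) (y v)) \<and>
           (\<forall>v\<in>P1. fibre C g v = cubic_cover (D v) (x v) (y v)) \<and>
           generic_fibre_is_smooth_model X E C g"
proof -
  let ?Z = "isolated_fixed_points X \<sigma>"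
  have surf: "projective_variety X" "krull_dim X = 2" "smooth X"
    using assms(1) by (auto simp: K3_surface_def smooth_projective_surface_def)
  obtain nX where nX: "closedin (zar (Pn nX)) X" and irrX: "irreducible_space (zar X)"
    using surf(1) by (auto simp: projective_variety_def)
  have bl: "projective_variety Xt" "morphism Xt X \<eta>" using assms(9) by (auto simp: blow_up_def)
  obtain nY where nY: "closedin (zar (Pn nY)) Xt" and irrY: "irreducible_space (zar Xt)"
    using bl(1) by (auto simp: projective_variety_def)
  obtain nQ where nQ: "closedin (zar (Pn nQ)) Rt"
    using assms(12) by (auto simp: quotient_by_def projective_variety_def)
  have Pn: "X \<subseteq> Pn nX" "Xt \<subseteq> Pn nY" using closedin_zar_subset[OF nX] closedin_zar_subset[OF nY] by blast+
  then have PP: "X \<subseteq> PP" "Xt \<subseteq> PP" using Pn_subset_PP by blast+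
  have \<sigma>: "morphism X X \<sigma>" using assms(2) by (simp add: isomorphism_def)
  have \<sigma>t: "morphism Xt Xt \<sigma>t" using assms(10) by (simp add: isomorphism_def)
  have \<sigma>3: "\<sigma> (\<sigma> (\<sigma> a)) = a" if "a \<in> X" for a
    using assms(3) that by (simp add: automorphism_order_def numeral_3_eq_3)
  have "\<exists>a\<in>X. (\<sigma> ^^ 1) a \<noteq> a"
    using assms(3) unfolding automorphism_order_def by (metis one_less_numeral_iff semiring_norm(77) zero_less_one)
  then obtain a0 where a0: "a0 \<in> X" "\<sigma> a0 \<noteq> a0" by auto
  have E_X: "morphism X P1 E_X" "E_X ` X = P1" and E: "morphism X P1 E" "E ` X = P1"
    using assms(5,16) by (auto simp: jacobian_fibration_def elliptic_fibration_def)
  \<comment> \<open>The moved points: an open set by separatedness, disjoint from the centre of the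
    blow-up, and nonempty since \<open>\<sigma>\<close> has order 3.\<close>
  define U where "U = {a\<in>X. \<sigma> a \<noteq> a}"
  have U: "openin (zar X) U"
    unfolding U_def by (rule neq_open[OF morphism_imp_locpoly[OF \<sigma> PP(1) Pn(1)]
          morphism_imp_locpoly[OF morphism_id[OF order.refl PP(1)] PP(1) Pn(1)] PP(1)])
  have Une: "U \<noteq> {}" using a0 by (auto simp: U_def)
  have UZ: "U \<inter> ?Z = {}" by (auto simp: U_def isolated_fixed_points_def)
  have \<sigma>U: "\<sigma> a \<in> U" if "a \<in> U" for a
    using that \<sigma>3[of a] morphism_in[OF \<sigma>, of a] by (auto simp: U_def)
  obtain \<psi> where \<psi>: "morphism U Xt \<psi>" "\<forall>a\<in>U. \<eta> (\<psi> a) = a" "\<forall>z\<in>Xt. \<eta> z \<in> U \<longrightarrow> \<psi> (\<eta> z) = z"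
    using blow_up_section[OF assms(9) nX irrX U Une UZ] .
  \<comment> \<open>In characteristic 0 a root of this quadratic is a primitive third root of unity;
    algebraic closedness provides one.\<close>
  obtain \<zeta>0 :: 'k where \<zeta>0: "1 + \<zeta>0 + \<zeta>0\<^sup>2 = 0"
    using alg_closed[of 2 "\<lambda>_. 1 :: 'k"] by (auto simp: numeral_2_eq_2)
  \<comment> \<open>\<open>\<pi>\<close> does not distinguish \<open>z\<close> from
    \<open>\<sigma>t z\<close>, and \<open>tau \<circ> E_X \<circ> \<eta>\<close> factors through
    \<open>\<pi>\<close>.\<close>
  have tau_eq: "tau (E_X (\<eta> z)) = tau (E_X (\<sigma> (\<eta> z)))" if z: "z \<in> Xt" for z
  proof -
    have z': "\<sigma>t z \<in> Xt" by (rule morphism_in[OF \<sigma>t z])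
    have "\<forall>a\<in>Xt. \<forall>b\<in>Xt. \<pi> a = \<pi> b \<longleftrightarrow> (\<exists>n. b = (\<sigma>t ^^ n) a)"
      using assms(12) unfolding quotient_by_def by (elim conjE)
    then have "\<pi> z = \<pi> (\<sigma>t z)" using z z' exI[of "\<lambda>n. \<sigma>t z = (\<sigma>t ^^ n) z" 1] by simp
    then show ?thesis using assms(11,14) z z' by metis
  qed
  have lift: "\<exists>z\<in>Xt. \<eta> z = a" if "a \<in> U" for a using morphism_in[OF \<psi>(1) that] \<psi>(2) that by blast
  have not1: "\<not> fibration_type1 X \<sigma> E_X" using assms(6) by (simp add: fibration_type2_def)
  obtain \<zeta> where \<zeta>: "1 + \<zeta> + \<zeta>\<^sup>2 = 0" "\<forall>z\<in>Xt. E_X (\<sigma> (\<eta> z)) = scale1 \<zeta> (E_X (\<eta> z))"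
    by (rule not_type1_imp_scale1[OF Pn(1) irrX Pn(2) irrY assms(2) bl(2) E_X(1) tau_eq U Une lift not1 \<zeta>0])
  interpret triple_cover X Xt Rt U \<sigma> \<sigma>t \<eta> \<psi> \<pi> E_X E_Rt \<zeta> nX nY nQ
    by unfold_locales
      (use nX irrX nY irrY nQ \<sigma> \<sigma>3 \<sigma>t bl(2) assms(11,12,13,14) U Une \<sigma>U \<psi> E_X \<zeta> in \<open>simp_all\<close>)
  have inv: "E (\<sigma> a) = E a" if a: "a \<in> X" for a
  proof -
    have "\<sigma> a \<in> \<sigma> ` fibre X E (E a)" using a by (simp add: fibre_def)
    moreover have "E a \<in> P1" by (rule morphism_in[OF E(1) a])
    ultimately have "\<sigma> a \<in> fibre X E (E a)" using assms(17) unfolding fibration_type1_def by blast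
    then show ?thesis by (simp add: fibre_def)
  qed
  obtain s where s: "morphism P1 X s" "\<forall>v\<in>P1. E (s v) = v"
    using assms(16) by (auto simp: jacobian_fibration_def)
  have Z: "closedin (zar X) ?Z"
    by (rule closedin_finite[OF Pn(1) finite_isolated_points[OF Pn(1)]]) (auto simp: isolated_fixed_points_def)
  obtain q0 where q0: "q0 \<in> P1" "s q0 \<notin> ?Z" using section_avoids_isolated_points[OF s] by blast
  obtain s' where s': "morphism P1 Xt s'" "\<forall>v\<in>P1. \<eta> (s' v) = s v"
    using blow_up_lift_P1[OF assms(9) PP(1) Z s(1) q0] .
  have E\<eta>: "\<exists>z\<in>Xt. E (\<eta> z) = v" if "v \<in> P1" for v
    using morphism_in[OF s'(1) that] s'(2) s(2) that by (intro bexI[of _ "s' v"]) auto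
  obtain g where g: "morphism C P1 g" "g ` C = P1"
    "\<forall>z\<in>Xt. \<forall>q\<in>P1. g (segre (\<pi> z) q) = E (\<eta> z)"
    "\<exists>\<theta>\<in>ring_iso (function_field C) (function_field X).
        \<forall>a\<in>carrier (function_field P1). \<theta> (ratfun_pullback C g a) = ratfun_pullback X E a"
    by (rule generic_fibre[OF E inv E\<eta> irreducible_variety_P1])
  have D: "D v = \<pi> ` {z\<in>Xt. E (\<eta> z) = v}" if "v \<in> P1" for v
    using assms(18) that by (simp add: induced_curve_def)
  have cover: "cubic_cover (D v) (x v) (y v) = {segre P q | P q. P \<in> D v \<and> q \<in> P1 \<and> E_Rt P = tau q}"
    if "v \<in> P1" for v
    using assms(19) that by (intro cubic_cover_eq) blast
  have fib: "fibre C g v = cubic_cover (D v) (x v) (y v)" if v: "v \<in> P1" for v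
    unfolding cover[OF v]
  proof (intro equalityI subsetI)
    fix c assume "c \<in> fibre C g v"
    then have c: "c \<in> C" "g c = v" by (auto simp: fibre_def)
    obtain r q where rq: "r \<in> Rt" "q \<in> P1" "E_Rt r = tau q" "c = segre r q" using c(1) by (rule C_cases)
    obtain z where z: "z \<in> Xt" "r = \<pi> z" using rq(1) \<pi>_surj by blast
    have "E (\<eta> z) = v" using g(3) z rq(2,4) c(2) by metis
    then have "r \<in> D v" unfolding D[OF v] z(2) using z(1) by blast
    then show "c \<in> {segre P q | P q. P \<in> D v \<and> q \<in> P1 \<and> E_Rt P = tau q}" using rq by blast
  next
    fix c assume "c \<in> {segre P q | P q. P \<in> D v \<and> q \<in> P1 \<and> E_Rt P = tau q}"
    then obtain P q where c: "c = segre P q" "P \<in> D v" "q \<in> P1" "E_Rt P = tau q" by blast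
    obtain z where z: "z \<in> Xt" "P = \<pi> z" "E (\<eta> z) = v" using c(2) unfolding D[OF v] by blast
    have "P \<in> Rt" using z(1,2) \<pi>_surj by blast
    then have "c \<in> C" unfolding fibre_product_tau_def using c by blast
    moreover have "g c = v" unfolding c(1) z(2) using g(3) z(1,3) c(3) by simp
    ultimately show "c \<in> fibre C g v" by (simp add: fibre_def)
  qed
  have "C = (\<Union>v\<in>P1. cubic_cover (D v) (x v) (y v))"
  proof -
    have "C = (\<Union>v\<in>P1. fibre C g v)" using morphism_in[OF g(1)] by (auto simp: fibre_def)
    then show ?thesis using fib by simp
  qed
  moreover have "generic_fibre_is_smooth_model X E C g"
  proof -
    \<comment> \<open>Off the finitely many bad values \<open>E\<close> is submersive along the
      fibres; the complement is open because finite sets are closed, and nonempty because the line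
      is infinite.\<close>
    define bad where "bad = {v\<in>P1. \<not> (smooth_curve (fibre X E v) \<and> genus (fibre X E v) = 1 \<and>
                      (\<forall>x\<in>fibre X E v. submersive_at X P1 E x))}"
    have bad: "finite bad" "bad \<subseteq> P1"
      using assms(16) by (auto simp: jacobian_fibration_def elliptic_fibration_def bad_def)
    have "openin (zar P1) (P1 - bad)"
      using closedin_finite[OF order.refl bad] unfolding closedin_def topspace_zar[OF Pn_subset_PP] by blast
    moreover have "P1 - bad \<noteq> {}" using infinite_P1[where 'k = 'k] bad(1) by (metis Diff_eq_empty_iff finite_subset)
    moreover have "enat (tangent_dim X a) = krull_dim X \<and> submersive_at X P1 E a"
      if "a \<in> X" "E a \<in> P1 - bad" for a
      using that surf(3) unfolding smooth_def bad_def fibre_def by blast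
    ultimately have "\<exists>U. openin (zar P1) U \<and> U \<noteq> {} \<and> (\<forall>a\<in>X. E a \<in> U \<longrightarrow>
        enat (tangent_dim X a) = krull_dim X \<and> submersive_at X P1 E a)"
      by (intro exI[of _ "P1 - bad"]) blast
    then show ?thesis
      unfolding generic_fibre_is_smooth_model_def using surf E C_projective g by blast
  qed
  ultimately show ?thesis using fib by blast
qed

end
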